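(* Let $\Phi:\mathfrak{A}\to\mathfrak{B}$ be a Jordan $^*$-epimorphism between JB$^*$-algebras. Suppose that $0\le b\le d$ in $\mathfrak{B}$ and that $\Phi(c)=d$ for some $c\in\mathfrak{A}$ with $c\ge0$. Then there exists $a\in\mathfrak{A}$ such that $0\le a\le c$ and $b=\Phi(a)$.
   Context: A JB$^*$-algebra is a complex Banach space $\mathfrak{A}$ with a commutative bilinear product $\circ$ satisfying the Jordan identity $(x\circ y)\circ x^2 = x\circ(y\circ x^2)$, with $\|a\circ b\|\le\|a\|\,\|b\|$, and with a conjugate-linear algebra involution $^*$ such that $\|U_a(a^* )\|=\|a\|^3$ for all $a$, where $U_a(b)=2(a\circ b)\circ a-a^2\circ b$. An element is positive ($\ge0$) if it is the square of a self-adjoint element (equivalently, it is self-adjoint with non-negative spectrum), and $x\le y$ means that $x,y$ are self-adjoint and $y-x\ge0$. A Jordan $^*$-epimorphism is a surjective linear map with $\Phi(x\circ y)=\Phi(x)\circ\Phi(y)$ and $\Phi(x^* )=\Phi(x)^*$ for all $x,y$. *)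

theory Defs
  imports "HOL-Analysis.Analysis"
begin

text \<open>
  A complex Banach space is given by a type of class \<open>banach\<close> (which carries the underlying
  real Banach space) together with a complex scalar multiplication that extends the real one
  and for which the norm is absolutely homogeneous. No unit element is assumed.
\<close>

definition jordan_U :: "('a::real_vector \<Rightarrow> 'a \<Rightarrow> 'a) \<Rightarrow> 'a \<Rightarrow> 'a \<Rightarrow> 'a" where
  "jordan_U jp a b = 2 *\<^sub>R jp (jp a b) a - jp (jp a a) b"

locale jb_star_algebra = vector_space cscale
  for cscale :: "complex \<Rightarrow> 'a::banach \<Rightarrow> 'a"  (infixr \<open>*\<^sub>C\<close> 75) +
  fixes jprod :: "'a \<Rightarrow> 'a \<Rightarrow> 'a"  (infixl \<open>\<circ>\<^sub>J\<close> 70)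
    and star :: "'a \<Rightarrow> 'a"
  assumes cscale_of_real: "complex_of_real r *\<^sub>C x = r *\<^sub>R x"
    and norm_cscale: "norm (z *\<^sub>C x) = cmod z * norm x"
    and jprod_commute: "x \<circ>\<^sub>J y = y \<circ>\<^sub>J x"
    \<comment> \<open>linearity in the second argument follows by commutativity\<close>
    and jprod_add_left: "(x + y) \<circ>\<^sub>J w = x \<circ>\<^sub>J w + y \<circ>\<^sub>J w"
    and jprod_cscale_left: "(z *\<^sub>C x) \<circ>\<^sub>J y = z *\<^sub>C (x \<circ>\<^sub>J y)"
    and jordan_identity: "(x \<circ>\<^sub>J y) \<circ>\<^sub>J (x \<circ>\<^sub>J x) = x \<circ>\<^sub>J (y \<circ>\<^sub>J (x \<circ>\<^sub>J x))"
    and norm_jprod_le: "norm (x \<circ>\<^sub>J y) \<le> norm x * norm y"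
    and star_add: "star (x + y) = star x + star y"
    and star_cscale: "star (z *\<^sub>C x) = cnj z *\<^sub>C star x"
    and star_star: "star (star x) = x"
    and star_jprod: "star (x \<circ>\<^sub>J y) = star x \<circ>\<^sub>J star y"
    and norm_jordan_U_star: "norm (jordan_U jprod x (star x)) = norm x ^ 3"

definition self_adjoint :: "('a \<Rightarrow> 'a) \<Rightarrow> 'a \<Rightarrow> bool" where
  "self_adjoint star x \<longleftrightarrow> star x = x"

definition jb_positive :: "('a \<Rightarrow> 'a \<Rightarrow> 'a) \<Rightarrow> ('a \<Rightarrow> 'a) \<Rightarrow> 'a \<Rightarrow> bool" where
  "jb_positive jp star x \<longleftrightarrow> (\<exists>h. self_adjoint star h \<and> x = jp h h)"

definition jb_le :: "('a::ab_group_add \<Rightarrow> 'a \<Rightarrow> 'a) \<Rightarrow> ('a \<Rightarrow> 'a) \<Rightarrow> 'a \<Rightarrow> 'a \<Rightarrow> bool" where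
  "jb_le jp star x y \<longleftrightarrow>
     self_adjoint star x \<and> self_adjoint star y \<and> jb_positive jp star (y - x)"

locale jordan_star_epimorphism =
  dom: jb_star_algebra csA jpA starA + cod: jb_star_algebra csB jpB starB
  for csA :: "complex \<Rightarrow> 'a::banach \<Rightarrow> 'a" and jpA starA
    and csB :: "complex \<Rightarrow> 'b::banach \<Rightarrow> 'b" and jpB starB +
  fixes \<Phi> :: "'a \<Rightarrow> 'b"
  assumes linear: "Vector_Spaces.linear csA csB \<Phi>"
    and map_jprod: "\<Phi> (jpA x y) = jpB (\<Phi> x) (\<Phi> y)"
    and map_star: "\<Phi> (starA x) = starB (\<Phi> x)"
    and surj: "surj \<Phi>"

end

theory Submission
  imports Defs
begin

text \<open>
  Write \<open>b = \<Phi> x\<close> with \<open>x \<ge> 0\<close>. Since \<open>\<Phi> x \<le> \<Phi> c\<close>, the positive part \<open>y\<close> of \<open>x - c\<close> lies in the kernel,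
  and \<open>x \<le> c + y\<close>. For \<open>\<eta> > 0\<close> put \<open>p = sqrt (\<eta> + c + y)\<close> and \<open>p' = sqrt (\<eta> + c)\<close>; then
  \<open>x' = U\<^bsub>p'\<^esub> U\<^bsub>p\<^esub>\<^sup>-\<^sup>1 x\<close> satisfies \<open>0 \<le> x' \<le> \<eta> + c\<close> and \<open>\<Phi> x' = b\<close>, because \<open>p\<close> and \<open>p'\<close> have the same image.
  Moreover \<open>x'\<close> is close to \<open>x\<close> if \<open>y\<close> is small, so iterating with \<open>\<eta> \<rightarrow> 0\<close> gives a Cauchy sequence
  whose limit is the required \<open>a\<close>.

  No unit is available, so the order is studied in the unitization. A square \<open>k\<^sup>2\<close> acts on the algebra
  as a dissipative operator: the fundamental formula and the norm axiom make \<open>U\<^bsub>u\<^esub>\<close> isometric for unitary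
  \<open>u\<close>, and \<open>1 - t k\<^sup>2\<close> is the value at the origin of a Blaschke factor with unitary boundary values, so that
  \<open>U\<close> of it is a contraction. Dissipativity is stable under sums and limits, and by the
  functional calculus of one element it characterizes squares. Hence the squares form a closed convex cone.
\<close>

section \<open>Jordan algebra identities\<close>

text \<open>Within one commutative subalgebra everything is C*-theory. The obstacle is that a sum of
  two squares, or \<open>U p x\<close> with \<open>x\<close> positive, involves elements from
  different subalgebras, and exceptional algebras have no Hilbert space representation to fall back
  on. Sums are settled by dissipativity. For \<open>U p x\<close>, the unit is joined to
  \<open>p\<close> by a path inside one subalgebra; each of N short steps preserves positivity up to
  an error of order 1/N^2. The sum norm of the unitization is in general not a JB*-norm, so the
  cubic norm axiom is used only on elements with scalar part 0, and operator bounds are tested on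
  that ideal. Many norm constants, such as 3, are therefore crude. The shift by \<eta> makes the
  roots invertible, at the price that x' lies only below \<eta> + c. If x lies below \<theta> + c,
  then y has norm at most 3\<theta>, so the excess left by one stage controls the length of the next
  step. Turning this into a summable bound needs a modulus of continuity of the root that is uniform
  over arguments which need not commute.\<close>

locale jordan_algebra =
  fixes mult :: "'v::real_vector \<Rightarrow> 'v \<Rightarrow> 'v"  (infixl \<open>\<odot>\<close> 70)
  assumes commute: "x \<odot> y = y \<odot> x"
    and add_left: "(x + y) \<odot> z = x \<odot> z + y \<odot> z"
    and scaleR_left: "(r *\<^sub>R x) \<odot> y = r *\<^sub>R (x \<odot> y)"
    and jordan: "(x \<odot> y) \<odot> (x \<odot> x) = x \<odot> (y \<odot> (x \<odot> x))"
begin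

lemma add_right: "z \<odot> (x + y) = z \<odot> x + z \<odot> y"
  using add_left commute by metis

lemma scaleR_right: "y \<odot> (r *\<^sub>R x) = r *\<^sub>R (y \<odot> x)"
  using scaleR_left commute by metis

lemma minus_left: "(- x) \<odot> y = - (x \<odot> y)"
  using scaleR_left[of "-1" x y] by simp

lemma minus_right: "y \<odot> (- x) = - (y \<odot> x)"
  using minus_left commute by metis

lemma diff_left: "(x - y) \<odot> z = x \<odot> z - y \<odot> z"
  using add_left[of x "-y" z] by (simp add: minus_left)

lemma diff_right: "z \<odot> (x - y) = z \<odot> x - z \<odot> y"
  using diff_left commute by metis

lemma zero_left [simp]: "0 \<odot> x = 0"
  using scaleR_left[of 0 0 x] by simp

lemma zero_right [simp]: "x \<odot> 0 = 0"
  using zero_left commute by metis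

lemmas distribs = add_left add_right diff_left diff_right scaleR_left scaleR_right
  minus_left minus_right

text \<open>Polarization of the cubic expression \<open>?f\<close>: in
  \<open>?f (x + z) - ?f (x - z) - 2 *\<^sub>R ?f z\<close> only twice the part quadratic in
  \<open>x\<close> and linear in \<open>z\<close> survives.\<close>

lemma jordan_linear1:
  "(z \<odot> w) \<odot> (x \<odot> x) + 2 *\<^sub>R ((x \<odot> w) \<odot> (x \<odot> z)) = z \<odot> (w \<odot> (x \<odot> x)) + 2 *\<^sub>R (x \<odot> (w \<odot> (x \<odot> z)))"
proof -
  let ?f = "\<lambda>x. (x \<odot> w) \<odot> (x \<odot> x) - x \<odot> (w \<odot> (x \<odot> x))"
  let ?g = "(z \<odot> w) \<odot> (x \<odot> x) + 2 *\<^sub>R ((x \<odot> w) \<odot> (x \<odot> z)) - (z \<odot> (w \<odot> (x \<odot> x)) + 2 *\<^sub>R (x \<odot> (w \<odot> (x \<odot> z))))"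
  have f0: "?f y = 0" for y by (simp add: jordan)
  have "?f (x + z) - ?f (x - z) - 2 *\<^sub>R ?f z = 2 *\<^sub>R ?g"
    by (simp add: distribs commute[of z x] algebra_simps scaleR_2)
  then have "2 *\<^sub>R ?g = 0" unfolding f0 by simp
  then show ?thesis by simp
qed

text \<open>Second polarization, of the remaining quadratic dependence on \<open>x\<close>.\<close>

lemma jordan_linear:
  "(x \<odot> y) \<odot> (z \<odot> w) + (y \<odot> z) \<odot> (x \<odot> w) + (z \<odot> x) \<odot> (y \<odot> w)
    = z \<odot> (w \<odot> (x \<odot> y)) + x \<odot> (w \<odot> (y \<odot> z)) + y \<odot> (w \<odot> (z \<odot> x))"
proof -
  let ?g = "\<lambda>x. (z \<odot> w) \<odot> (x \<odot> x) + 2 *\<^sub>R ((x \<odot> w) \<odot> (x \<odot> z)) - (z \<odot> (w \<odot> (x \<odot> x)) + 2 *\<^sub>R (x \<odot> (w \<odot> (x \<odot> z))))"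
  have g0: "?g y = 0" for y by (simp add: jordan_linear1)
  have c: "z \<odot> w \<odot> (x \<odot> y) = x \<odot> y \<odot> (z \<odot> w)" "x \<odot> w \<odot> (y \<odot> z) = y \<odot> z \<odot> (x \<odot> w)"
     "y \<odot> w \<odot> (x \<odot> z) = x \<odot> z \<odot> (y \<odot> w)"
    by (rule commute)+
  have "?g (x + y) - ?g x - ?g y = 2 *\<^sub>R ((x \<odot> y) \<odot> (z \<odot> w) + (y \<odot> z) \<odot> (x \<odot> w) + (x \<odot> z) \<odot> (y \<odot> w)
    - (z \<odot> (w \<odot> (x \<odot> y)) + x \<odot> (w \<odot> (y \<odot> z)) + y \<odot> (w \<odot> (x \<odot> z))))"
    by (simp add: distribs commute[of y x] c algebra_simps scaleR_2)
  then have "2 *\<^sub>R ((x \<odot> y) \<odot> (z \<odot> w) + (y \<odot> z) \<odot> (x \<odot> w) + (x \<odot> z) \<odot> (y \<odot> w)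
    - (z \<odot> (w \<odot> (x \<odot> y)) + x \<odot> (w \<odot> (y \<odot> z)) + y \<odot> (w \<odot> (x \<odot> z)))) = 0"
    unfolding g0 by simp
  then show ?thesis by (simp add: commute[of z x])
qed

text \<open>The Jordan triple product {x, y, z}; its diagonal {x, y, x} is the quadratic operator.
  With all three slots free, identities for \<open>U\<close> follow by substitution.\<close>

definition trip :: "'v \<Rightarrow> 'v \<Rightarrow> 'v \<Rightarrow> 'v" where
  "trip x y z = (x \<odot> y) \<odot> z + x \<odot> (y \<odot> z) - y \<odot> (x \<odot> z)"

lemma trip_commute: "trip x y z = trip z y x"
  unfolding trip_def by (metis (no_types, opaque_lifting) commute add.commute)

lemma trip_linear:
  "trip (x + x') y z = trip x y z + trip x' y z"
  "trip x (y + y') z = trip x y z + trip x y' z"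
  "trip x y (z + z') = trip x y z + trip x y z'"
  "trip (x - x') y z = trip x y z - trip x' y z"
  "trip x (y - y') z = trip x y z - trip x y' z"
  "trip x y (z - z') = trip x y z - trip x y z'"
  "trip (r *\<^sub>R x) y z = r *\<^sub>R trip x y z"
  "trip x (r *\<^sub>R y) z = r *\<^sub>R trip x y z"
  "trip x y (r *\<^sub>R z) = r *\<^sub>R trip x y z"
  by (simp_all add: trip_def distribs algebra_simps)

text \<open>Three instances of the linearized identity share the left side \<open>?S\<close>; the
  two sides of the claim differ by the first plus the second minus the third. Multiplication thus
  acts as a derivation up to the sign in the middle slot.\<close>

lemma mult_trip:
  "a \<odot> trip u v w = trip (a \<odot> u) v w - trip u (a \<odot> v) w + trip u v (a \<odot> w)"
proof -
  let ?S = "(a \<odot> u) \<odot> (v \<odot> w) + (a \<odot> v) \<odot> (u \<odot> w) + (a \<odot> w) \<odot> (u \<odot> v)"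
  have w: "?S = a \<odot> (w \<odot> (u \<odot> v)) + u \<odot> (w \<odot> (a \<odot> v)) + v \<odot> (w \<odot> (a \<odot> u))"
    using jordan_linear[of a u v w] by (simp add: commute algebra_simps)
  have u: "?S = a \<odot> (u \<odot> (v \<odot> w)) + v \<odot> (u \<odot> (a \<odot> w)) + w \<odot> (u \<odot> (a \<odot> v))"
    using jordan_linear[of a v w u] by (simp add: commute algebra_simps)
  have v: "?S = a \<odot> (v \<odot> (u \<odot> w)) + u \<odot> (v \<odot> (a \<odot> w)) + w \<odot> (v \<odot> (a \<odot> u))"
    using jordan_linear[of a u w v] by (simp add: commute algebra_simps)
  have "a \<odot> trip u v w - (trip (a \<odot> u) v w - trip u (a \<odot> v) w + trip u v (a \<odot> w))
    = (a \<odot> (w \<odot> (u \<odot> v)) + u \<odot> (w \<odot> (a \<odot> v)) + v \<odot> (w \<odot> (a \<odot> u)) - ?S)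
     + (a \<odot> (u \<odot> (v \<odot> w)) + v \<odot> (u \<odot> (a \<odot> w)) + w \<odot> (u \<odot> (a \<odot> v)) - ?S)
     - (a \<odot> (v \<odot> (u \<odot> w)) + u \<odot> (v \<odot> (a \<odot> w)) + w \<odot> (v \<odot> (a \<odot> u)) - ?S)"
    by (simp add: trip_def distribs commute algebra_simps)
  also have "\<dots> = 0" unfolding w[symmetric] u[symmetric] v[symmetric] by simp
  finally show ?thesis by simp
qed

text \<open>The main identity of Jordan triple systems. The operator \<open>trip x y\<close> is
  multiplication by \<open>x \<odot> y\<close> plus the commutator of the multiplications by
  \<open>x\<close> and \<open>y\<close>. By \<open>mult_trip\<close> each of these passes through a
  triple product, and the sign in the middle slot turns \<open>trip x y\<close> into
  \<open>- trip y x\<close> there.\<close>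

lemma trip_trip:
  "trip x y (trip u v w) = trip (trip x y u) v w - trip u (trip y x v) w + trip u v (trip x y w)"
proof -
  have "trip x y (trip u v w)
      = (x \<odot> y) \<odot> trip u v w + x \<odot> (y \<odot> trip u v w) - y \<odot> (x \<odot> trip u v w)"
    by (simp add: trip_def)
  also have "\<dots> = trip (trip x y u) v w - trip u (trip y x v) w + trip u v (trip x y w)"
    unfolding trip_def[of x y u] trip_def[of y x v] trip_def[of x y w] commute[of y x]
    by (simp add: mult_trip distribs trip_linear)
  finally show ?thesis .
qed

abbreviation U :: "'v \<Rightarrow> 'v \<Rightarrow> 'v" where "U x y \<equiv> trip x y x"

text \<open>Two instances of the triple identity give A = 2B - C and B = 2A - C, hence 3(A - B) = 0
  and A = B = C.\<close>

lemma trip_U: "trip x y (U x z) = U x (trip y x z)"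
proof -
  let ?A = "trip x y (U x z)" and ?B = "trip x z (U x y)" and ?C = "U x (trip y x z)"
  have A: "?A = 2 *\<^sub>R ?B - ?C"
    using trip_trip[of x y x z x] trip_commute[of "U x y" z x] by (simp add: scaleR_2)
  have B: "?B = 2 *\<^sub>R ?A - ?C"
    using trip_trip[of x z x y x] trip_commute[of "U x z" y x] trip_commute[of z x y] by (simp add: scaleR_2)
  have "?A - ?B = (2 *\<^sub>R ?B - ?C) - (2 *\<^sub>R ?A - ?C)" using A B by simp
  also have "\<dots> = - (2 *\<^sub>R (?A - ?B))" by (simp add: scaleR_diff_right)
  finally have "(?A - ?B) + 2 *\<^sub>R (?A - ?B) = 0"
    by (metis add.left_inverse)
  then have "3 *\<^sub>R (?A - ?B) = 0"
    using scaleR_left_distrib[of 1 2 "?A - ?B"] by simp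
  then have "?A = ?B" by simp
  with A show ?thesis by (simp add: scaleR_2)
qed

lemma trip_U_swap: "trip (U x y) y z = trip x (U y x) z"
  using trip_trip[of x y x y z] by simp

lemma U_U_twice: "2 *\<^sub>R trip y x (trip y x z) = trip (U y x) x z + U y (U x z)"
proof -
  have "trip z x (U y x) = 2 *\<^sub>R trip y x (trip y x z) - U y (U x z)"
    using trip_trip[of z x y x y] trip_commute[of z x y] trip_commute[of x z x]
      trip_commute[of "trip y x z" x y] by (simp add: scaleR_2)
  then show ?thesis using trip_commute[of z x "U y x"] by simp
qed

text \<open>Write the second factor \<open>U x y\<close> as \<open>trip x y x\<close> and expand by
  the triple identity. Then \<open>U x\<close> can be pulled out of every term, and
  \<open>U_U_twice\<close> evaluates the remaining bracket.\<close>

lemma fundamental_formula: "U (U x y) z = U x (U y (U x z))"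
proof -
  have a: "trip (trip (U x y) z x) y x = U x (trip y x (trip y x z))"
    by (metis trip_U trip_commute)
  have "U (U x y) z = 2 *\<^sub>R trip (trip (U x y) z x) y x - U x (trip z (U x y) y)"
    using trip_trip[of "U x y" z x y x] trip_commute[of x y "trip (U x y) z x"] by (simp add: scaleR_2)
  also have "trip z (U x y) y = trip (U y x) x z"
    by (metis trip_U_swap trip_commute)
  also have "2 *\<^sub>R trip (trip (U x y) z x) y x - U x (trip (U y x) x z)
     = U x (2 *\<^sub>R trip y x (trip y x z) - trip (U y x) x z)"
    by (simp add: a trip_linear)
  also have "\<dots> = U x (U y (U x z))" by (simp add: U_U_twice)
  finally show ?thesis .
qed

definition op_commute :: "'v \<Rightarrow> 'v \<Rightarrow> bool" where
  "op_commute x y \<longleftrightarrow> (\<forall>z. x \<odot> (y \<odot> z) = y \<odot> (x \<odot> z))"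

text \<open>The linearized identity solved for multiplication by a triple product of elements, which
  becomes a combination of compositions of multiplications by shorter products.\<close>

lemma mult_mult_left:
  "(b \<odot> (x \<odot> y)) \<odot> z = (x \<odot> y) \<odot> (b \<odot> z) + (x \<odot> b) \<odot> (y \<odot> z) + (y \<odot> b) \<odot> (x \<odot> z)
     - x \<odot> (b \<odot> (y \<odot> z)) - y \<odot> (b \<odot> (x \<odot> z))"
proof -
  have "z \<odot> (b \<odot> (x \<odot> y)) = (x \<odot> y) \<odot> (z \<odot> b) + (y \<odot> z) \<odot> (x \<odot> b) + (z \<odot> x) \<odot> (y \<odot> b)
      - x \<odot> (b \<odot> (y \<odot> z)) - y \<odot> (b \<odot> (z \<odot> x))"
    using jordan_linear[of x y z b] by (simp add: algebra_simps)
  then show ?thesis by (simp add: commute)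
qed

lemma U_alt: "U x z = 2 *\<^sub>R (x \<odot> (x \<odot> z)) - (x \<odot> x) \<odot> z"
  unfolding trip_def using commute[of "x \<odot> z" x] commute[of z x] commute[of z "x \<odot> x"]
  by (simp add: scaleR_2)

text \<open>Multiplication by \<open>H \<odot> H\<close> is computed in two ways, from
  \<open>A \<odot> (g \<odot> g)\<close> and from \<open>H \<odot> (f \<odot> g)\<close>. The
  comparison removes \<open>H \<odot> (H \<odot> z)\<close>; after \<open>Ag\<close> and
  \<open>Bf\<close> the rest cancels because the operators commute.\<close>

lemma U_mult:
  assumes "op_commute f g" "op_commute f (f \<odot> f)" "op_commute f (g \<odot> g)" "op_commute f (f \<odot> g)"
    "op_commute g (f \<odot> f)" "op_commute g (g \<odot> g)" "op_commute g (f \<odot> g)"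
    "op_commute (f \<odot> f) (g \<odot> g)"
  shows "U f (U g z) = U (f \<odot> g) z"
proof -
  define A B H where "A = f \<odot> f" and "B = g \<odot> g" and "H = f \<odot> g"
  have c: "g \<odot> (f \<odot> z) = f \<odot> (g \<odot> z)" "A \<odot> (f \<odot> z) = f \<odot> (A \<odot> z)" "B \<odot> (f \<odot> z) = f \<odot> (B \<odot> z)"
     "H \<odot> (f \<odot> z) = f \<odot> (H \<odot> z)" "A \<odot> (g \<odot> z) = g \<odot> (A \<odot> z)" "B \<odot> (g \<odot> z) = g \<odot> (B \<odot> z)"
     "H \<odot> (g \<odot> z) = g \<odot> (H \<odot> z)" "B \<odot> (A \<odot> z) = A \<odot> (B \<odot> z)" for z
    using assms unfolding op_commute_def A_def B_def H_def by auto
  have Ag: "(A \<odot> g) \<odot> y = A \<odot> (g \<odot> y) + 2 *\<^sub>R (H \<odot> (f \<odot> y)) - 2 *\<^sub>R (f \<odot> (g \<odot> (f \<odot> y)))" for y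
    using mult_mult_left[of g f f y] by (simp add: A_def H_def commute[of g "f \<odot> f"] scaleR_2)
  have Bf: "(B \<odot> f) \<odot> y = B \<odot> (f \<odot> y) + 2 *\<^sub>R (H \<odot> (g \<odot> y)) - 2 *\<^sub>R (g \<odot> (f \<odot> (g \<odot> y)))" for y
    using mult_mult_left[of f g g y] by (simp add: B_def H_def commute[of f "g \<odot> g"] commute[of g f] scaleR_2)
  have AB: "(A \<odot> B) \<odot> z = B \<odot> (A \<odot> z) + 2 *\<^sub>R ((A \<odot> g) \<odot> (g \<odot> z)) - 2 *\<^sub>R (g \<odot> (A \<odot> (g \<odot> z)))"
    using mult_mult_left[of A g g z] by (simp add: B_def scaleR_2 commute[of g A])
  have fH: "f \<odot> H = A \<odot> g" and gH: "g \<odot> H = B \<odot> f"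
    unfolding A_def B_def H_def
    by (metis assms(1) op_commute_def commute)+
  have HH: "H \<odot> H = A \<odot> B"
    unfolding A_def B_def H_def
    by (metis assms op_commute_def commute)
  have "(H \<odot> H) \<odot> z = H \<odot> (H \<odot> z) + (A \<odot> g) \<odot> (g \<odot> z) + (B \<odot> f) \<odot> (f \<odot> z)
     - f \<odot> (H \<odot> (g \<odot> z)) - g \<odot> (H \<odot> (f \<odot> z))"
    using mult_mult_left[of H f g z] by (simp add: H_def[symmetric] fH gH)
  then have *: "H \<odot> (H \<odot> z) = (A \<odot> B) \<odot> z - (A \<odot> g) \<odot> (g \<odot> z) - (B \<odot> f) \<odot> (f \<odot> z)
     + f \<odot> (H \<odot> (g \<odot> z)) + g \<odot> (H \<odot> (f \<odot> z))"
    by (simp add: HH)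
  have "U f (U g z) - U H z = 0"
    unfolding U_alt A_def[symmetric] B_def[symmetric] HH * AB
    by (simp add: Ag Bf distribs c scaleR_2 algebra_simps)
  then show ?thesis by (simp add: H_def)
qed

end

section \<open>Powers of one element\<close>

locale unital_jordan_algebra = jordan_algebra +
  fixes e :: 'a
  assumes unit: "e \<odot> x = x"
begin

primrec jpower :: "'a \<Rightarrow> nat \<Rightarrow> 'a" where
  "jpower a 0 = e"
| "jpower a (Suc n) = a \<odot> jpower a n"

lemma unit_right [simp]: "x \<odot> e = x" using unit commute by metis

text \<open>By \<open>mult_mult_left\<close>, multiplication by the power n + 2 is built from the
  multiplications by \<open>a\<close>, \<open>a \<odot> a\<close> and the two preceding powers. The
  operator \<open>T\<close> is later taken in turn as multiplication by \<open>a\<close>, by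
  \<open>a \<odot> a\<close> and by an arbitrary power.\<close>

lemma op_commute_jpower_aux:
  assumes T: "\<And>x y. T (x - y) = T x - T y" "\<And>x y. T (x + y) = T x + T y"
    and a: "\<And>z. T (a \<odot> z) = a \<odot> T z" "\<And>z. T ((a \<odot> a) \<odot> z) = (a \<odot> a) \<odot> T z"
  shows "T (jpower a n \<odot> z) = jpower a n \<odot> T z"
proof (induction n arbitrary: z rule: induct_nat_012)
  case (ge2 n)
  let ?p = "jpower a n" and ?q = "jpower a (Suc n)"
  have *: "jpower a (Suc (Suc n)) \<odot> z = ?q \<odot> (a \<odot> z) + (a \<odot> a) \<odot> (?p \<odot> z) + ?q \<odot> (a \<odot> z)
      - a \<odot> (a \<odot> (?p \<odot> z)) - ?p \<odot> (a \<odot> (a \<odot> z))" for z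
    using mult_mult_left[of a a ?p z] by (simp add: commute[of ?p a])
  show ?case unfolding * T a ge2.IH ..
qed (use a in \<open>auto simp: unit\<close>)

lemma op_commute_jpower: "op_commute (jpower a m) (jpower a n)"
proof -
  have sq: "a \<odot> ((a \<odot> a) \<odot> z) = (a \<odot> a) \<odot> (a \<odot> z)" for z
    using jordan[of a z] by (metis commute)
  have 1: "a \<odot> (jpower a n \<odot> z) = jpower a n \<odot> (a \<odot> z)" for n z
    by (rule op_commute_jpower_aux) (simp_all add: distribs sq)
  have 2: "(a \<odot> a) \<odot> (jpower a n \<odot> z) = jpower a n \<odot> ((a \<odot> a) \<odot> z)" for n z
    by (rule op_commute_jpower_aux) (simp_all add: distribs sq)
  have "jpower a n \<odot> (jpower a m \<odot> z) = jpower a m \<odot> (jpower a n \<odot> z)" for z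
    by (rule op_commute_jpower_aux) (simp_all add: distribs 1 2)
  then show ?thesis by (simp add: op_commute_def)
qed

lemma jpower_add: "jpower a m \<odot> jpower a n = jpower a (m + n)"
proof (induction m)
  case (Suc m)
  have "jpower a n \<odot> (jpower a 1 \<odot> jpower a m) = jpower a 1 \<odot> (jpower a n \<odot> jpower a m)"
    using op_commute_jpower[of a n 1] by (simp add: op_commute_def del: jpower.simps)
  then show ?case using Suc by (simp add: commute)
qed (simp add: unit)

end

section \<open>The unitization and its commutative subalgebras\<close>

context jb_star_algebra begin

lemma jprod_add_right: "w \<circ>\<^sub>J (x + y) = w \<circ>\<^sub>J x + w \<circ>\<^sub>J y"
  using jprod_add_left jprod_commute by metis

lemma jprod_cscale_right: "y \<circ>\<^sub>J (z *\<^sub>C x) = z *\<^sub>C (y \<circ>\<^sub>J x)"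
  using jprod_cscale_left jprod_commute by metis

lemma jprod_scaleR: "(r *\<^sub>R x) \<circ>\<^sub>J y = r *\<^sub>R (x \<circ>\<^sub>J y)" "y \<circ>\<^sub>J (r *\<^sub>R x) = r *\<^sub>R (y \<circ>\<^sub>J x)"
  using jprod_cscale_left[of "of_real r" x y] jprod_cscale_right[of y "of_real r" x]
  by (simp_all add: cscale_of_real)

lemma jprod_zero [simp]: "0 \<circ>\<^sub>J x = 0" "x \<circ>\<^sub>J 0 = 0"
  using jprod_scaleR(1)[of 0 0 x] jprod_scaleR(2)[of x 0 0] by simp_all

lemma cscale_scaleR: "z *\<^sub>C (r *\<^sub>R x) = r *\<^sub>R (z *\<^sub>C x)" "(r *\<^sub>R z) *\<^sub>C x = r *\<^sub>R (z *\<^sub>C x)"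
  using scale_scale[of z "of_real r" x] scale_scale[of "of_real r" z x]
  unfolding cscale_of_real scaleR_conv_of_real by (simp_all add: mult.commute)

lemma star_scaleR: "star (r *\<^sub>R x) = r *\<^sub>R star x"
  using star_cscale[of "of_real r" x] by (simp add: cscale_of_real)

lemma star_zero [simp]: "star 0 = 0"
  using star_scaleR[of 0 0] by simp

lemma star_minus: "star (- x) = - star x"
  using star_scaleR[of "-1" x] by simp

lemma star_diff: "star (x - y) = star x - star y"
  using star_add[of x "- y"] star_minus by simp

text \<open>The pair \<open>(a, \<gamma>)\<close> stands for a + \<gamma> 1.\<close>

definition umul :: "'a \<times> complex \<Rightarrow> 'a \<times> complex \<Rightarrow> 'a \<times> complex"  (infixl \<open>\<odot>\<close> 70) where
  "x \<odot> y = (fst x \<circ>\<^sub>J fst y + snd x *\<^sub>C fst y + snd y *\<^sub>C fst x, snd x * snd y)"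

lemma fst_umul [simp]: "fst (x \<odot> y) = fst x \<circ>\<^sub>J fst y + snd x *\<^sub>C fst y + snd y *\<^sub>C fst x"
  and snd_umul [simp]: "snd (x \<odot> y) = snd x * snd y"
  by (simp_all add: umul_def)

sublocale ext: unital_jordan_algebra umul "(0, 1)"
proof
  fix x y z :: "'a \<times> complex" and r :: real
  show "x \<odot> y = y \<odot> x"
    by (simp add: umul_def jprod_commute algebra_simps)
  show "(x + y) \<odot> z = x \<odot> z + y \<odot> z"
    by (simp add: umul_def jprod_add_left scale_left_distrib scale_right_distrib algebra_simps)
  show "(r *\<^sub>R x) \<odot> y = r *\<^sub>R (x \<odot> y)"
    by (simp add: umul_def jprod_scaleR cscale_scaleR scaleR_right_distrib)
  show "(0, 1) \<odot> x = x"
    by (simp add: umul_def)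
  show "(x \<odot> y) \<odot> (x \<odot> x) = x \<odot> (y \<odot> (x \<odot> x))"
  proof -
    obtain a \<alpha> b \<beta> where xy: "x = (a, \<alpha>)" "y = (b, \<beta>)" by (metis surj_pair)
    have 1: "(a \<circ>\<^sub>J b) \<circ>\<^sub>J (a \<circ>\<^sub>J a) = a \<circ>\<^sub>J (b \<circ>\<^sub>J (a \<circ>\<^sub>J a))" by (rule jordan_identity)
    have 2: "(a \<circ>\<^sub>J b) \<circ>\<^sub>J a = a \<circ>\<^sub>J (b \<circ>\<^sub>J a)" "(a \<circ>\<^sub>J a) \<circ>\<^sub>J a = a \<circ>\<^sub>J (a \<circ>\<^sub>J a)" "b \<circ>\<^sub>J a = a \<circ>\<^sub>J b"
      using jprod_commute by metis+
    show ?thesis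
      unfolding xy umul_def
      by (simp add: jprod_add_left jprod_add_right jprod_cscale_left jprod_cscale_right
          scale_left_distrib scale_right_distrib 1 2 algebra_simps)
  qed
qed

text \<open>Multiples of the unit; complex scalar multiplication is expressed as a product with
  \<open>cs \<gamma>\<close>.\<close>

definition cs :: "complex \<Rightarrow> 'a \<times> complex" where "cs \<gamma> = (0, \<gamma>)"

definition st :: "'a \<times> complex \<Rightarrow> 'a \<times> complex" where "st x = (star (fst x), cnj (snd x))"

definition nrm :: "'a \<times> complex \<Rightarrow> real" where "nrm x = norm (fst x) + cmod (snd x)"

definition sa :: "('a \<times> complex) set" where "sa = {x. st x = x}"

abbreviation one :: "'a \<times> complex" where "one \<equiv> (0, 1)"

lemma fst_st [simp]: "fst (st x) = star (fst x)" and snd_st [simp]: "snd (st x) = cnj (snd x)"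
  by (simp_all add: st_def)

lemma fst_cs [simp]: "fst (cs \<gamma>) = 0" and snd_cs [simp]: "snd (cs \<gamma>) = \<gamma>"
  by (simp_all add: cs_def)

lemma cs_one: "cs 1 = one" by (simp add: cs_def)

lemma cs_umul: "(cs \<gamma> \<odot> x) \<odot> y = cs \<gamma> \<odot> (x \<odot> y)" "x \<odot> (cs \<gamma> \<odot> y) = cs \<gamma> \<odot> (x \<odot> y)"
  by (simp_all add: prod_eq_iff jprod_cscale_left jprod_cscale_right scale_right_distrib algebra_simps)

lemma cs_of_real: "cs (of_real r) \<odot> x = r *\<^sub>R x"
  by (simp add: prod_eq_iff cscale_of_real scaleR_conv_of_real)

lemma cs_mult: "cs \<gamma> \<odot> cs \<delta> = cs (\<gamma> * \<delta>)"
  by (simp_all add: prod_eq_iff)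

lemma st_add: "st (x + y) = st x + st y"
  and st_diff: "st (x - y) = st x - st y"
  and st_scaleR: "st (r *\<^sub>R x) = r *\<^sub>R st x"
  and st_umul: "st (x \<odot> y) = st x \<odot> st y"
  and st_st: "st (st x) = x"
  and st_cs: "st (cs \<gamma>) = cs (cnj \<gamma>)"
  and st_one: "st one = one"
  by (simp_all add: prod_eq_iff star_add star_diff star_scaleR star_jprod star_cscale star_star)

lemma sa_iff: "x \<in> sa \<longleftrightarrow> star (fst x) = fst x \<and> snd x \<in> \<real>"
  by (simp add: sa_def prod_eq_iff Reals_cnj_iff)

lemma sa_add: "x \<in> sa \<Longrightarrow> y \<in> sa \<Longrightarrow> x + y \<in> sa"
  and sa_diff: "x \<in> sa \<Longrightarrow> y \<in> sa \<Longrightarrow> x - y \<in> sa"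
  and sa_scaleR: "x \<in> sa \<Longrightarrow> r *\<^sub>R x \<in> sa"
  and sa_umul: "x \<in> sa \<Longrightarrow> y \<in> sa \<Longrightarrow> x \<odot> y \<in> sa"
  and sa_one: "one \<in> sa" and sa_0: "0 \<in> sa"
  by (simp_all add: sa_def st_add st_diff st_scaleR st_umul st_one) (simp add: prod_eq_iff)

section \<open>Estimates for the submultiplicative sum norm of the unitization\<close>

lemma nrm_ge_0 [simp]: "0 \<le> nrm x"
  by (simp add: nrm_def)

lemma norm_le_nrm: "norm x \<le> nrm x"
  unfolding nrm_def using norm_Pair_le[of "fst x" "snd x"] by simp

lemma nrm_le_norm: "nrm x \<le> 2 * norm x"
  unfolding nrm_def using norm_fst_le[of "fst x" "snd x"] norm_snd_le[of "snd x" "fst x"] by simp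

lemma nrm_eq_0 [simp]: "nrm x = 0 \<longleftrightarrow> x = 0"
  by (auto simp: nrm_def prod_eq_iff add_nonneg_eq_0_iff)

lemma nrm_add: "nrm (x + y) \<le> nrm x + nrm y"
  unfolding nrm_def using norm_triangle_ineq[of "fst x" "fst y"] norm_triangle_ineq[of "snd x" "snd y"] by simp

lemma nrm_diff: "nrm (x - y) \<le> nrm x + nrm y"
  unfolding nrm_def using norm_triangle_ineq4[of "fst x" "fst y"] norm_triangle_ineq4[of "snd x" "snd y"] by simp

lemma nrm_minus_commute: "nrm (x - y) = nrm (y - x)"
  unfolding nrm_def by (simp add: norm_minus_commute)

lemma nrm_scaleR: "nrm (r *\<^sub>R x) = \<bar>r\<bar> * nrm x"
  by (simp add: nrm_def algebra_simps)

lemma nrm_umul: "nrm (x \<odot> y) \<le> nrm x * nrm y"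
proof -
  have "norm (fst (x \<odot> y)) \<le> norm (fst x \<circ>\<^sub>J fst y) + norm (snd x *\<^sub>C fst y) + norm (snd y *\<^sub>C fst x)"
    unfolding fst_umul by (rule order_trans[OF norm_triangle_ineq]) (simp add: norm_triangle_ineq)
  also have "\<dots> \<le> norm (fst x) * norm (fst y) + cmod (snd x) * norm (fst y) + cmod (snd y) * norm (fst x)"
    by (simp add: norm_cscale norm_jprod_le)
  finally show ?thesis by (simp add: nrm_def norm_mult algebra_simps)
qed

lemma nrm_cs_umul: "nrm (cs \<gamma> \<odot> x) = cmod \<gamma> * nrm x"
  by (simp add: nrm_def norm_cscale norm_mult algebra_simps)

lemma nrm_cs [simp]: "nrm (cs \<gamma>) = cmod \<gamma>" and nrm_one [simp]: "nrm one = 1"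
  by (simp_all add: nrm_def)

lemma nrm_trip: "nrm (ext.trip x y z) \<le> 3 * nrm x * nrm y * nrm z"
proof -
  have a: "nrm (x \<odot> y \<odot> z) \<le> nrm x * nrm y * nrm z"
    by (rule order_trans[OF nrm_umul]) (simp add: mult_right_mono nrm_umul)
  have b: "nrm (x \<odot> (y \<odot> z)) \<le> nrm x * nrm y * nrm z"
    by (rule order_trans[OF nrm_umul]) (simp add: mult_left_mono nrm_umul mult.assoc)
  have c: "nrm (y \<odot> (x \<odot> z)) \<le> nrm x * nrm y * nrm z"
    by (rule order_trans[OF nrm_umul])
      (use mult_left_mono[OF nrm_umul[of x z] nrm_ge_0[of y]] in \<open>simp add: algebra_simps\<close>)
  show ?thesis
    unfolding ext.trip_def
    using nrm_diff[of "x \<odot> y \<odot> z + x \<odot> (y \<odot> z)" "y \<odot> (x \<odot> z)"] nrm_add[of "x \<odot> y \<odot> z" "x \<odot> (y \<odot> z)"] a b c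
    by linarith
qed

lemma bounded_bilinear_umul: "bounded_bilinear umul"
proof
  show "\<exists>K. \<forall>x y. norm (x \<odot> y) \<le> norm x * norm y * K"
  proof (intro exI allI)
    fix x y
    have "norm (x \<odot> y) \<le> nrm x * nrm y"
      using norm_le_nrm nrm_umul order_trans by blast
    also have "\<dots> \<le> (2 * norm x) * (2 * norm y)"
      by (intro mult_mono nrm_le_norm) auto
    finally show "norm (x \<odot> y) \<le> norm x * norm y * 4" by simp
  qed
qed (simp_all add: ext.distribs)

lemmas tendsto_umul [tendsto_intros] = bounded_bilinear.tendsto[OF bounded_bilinear_umul]

lemma U_pair: "ext.U (a, 0) (b, 0) = (jordan_U jprod a b, 0)"
  by (simp add: ext.U_alt jordan_U_def prod_eq_iff jprod_commute)

lemma trip_fst: "snd (ext.trip x y z) = snd x * snd y * snd z"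
  by (simp add: ext.trip_def algebra_simps)

lemma norm_jordan_U_le: "norm (jordan_U jprod a b) \<le> 3 * norm a * norm b * norm a"
  using nrm_trip[of "(a, 0)" "(b, 0)" "(a, 0)"] by (simp add: U_pair nrm_def)

text \<open>The involution is in fact isometric; a crude bound suffices here.\<close>

lemma norm_star_le: "norm (star a) \<le> 3 * norm a"
proof (cases "star a = 0")
  case False
  then have pos: "norm (star a) > 0" by simp
  have "norm (star a) ^ 3 \<le> 3 * norm (star a) * norm a * norm (star a)"
    using norm_jordan_U_star[of "star a"] norm_jordan_U_le[of "star a" a] by (simp add: star_star)
  then have "norm (star a) * norm (star a)^2 \<le> (3 * norm a) * norm (star a)^2"
    by (simp add: power3_eq_cube power2_eq_square algebra_simps)
  then show ?thesis using pos by simp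
qed simp

lemma nrm_st: "nrm (st x) \<le> 3 * nrm x"
proof -
  have "norm (star (fst x)) + cmod (snd x) \<le> 3 * norm (fst x) + 3 * cmod (snd x)"
    by (intro add_mono norm_star_le) simp
  then show ?thesis by (simp add: nrm_def)
qed

lemma bounded_linear_st: "bounded_linear st"
proof (rule bounded_linear_intro)
  fix x
  have "norm (st x) \<le> 3 * nrm x" using norm_le_nrm nrm_st order_trans by blast
  then show "norm (st x) \<le> norm x * 6" using nrm_le_norm[of x] by linarith
qed (simp_all add: st_add st_scaleR)

lemmas tendsto_st [tendsto_intros] = bounded_linear.tendsto[OF bounded_linear_st]

lemma closed_sa: "closed sa"
  unfolding sa_def
  by (rule closed_Collect_eq)
    (auto intro!: linear_continuous_on bounded_linear_st continuous_on_id)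

lemma norm_square:
  assumes "star a = a"
  shows "norm (a \<circ>\<^sub>J a) = norm a ^ 2"
proof (cases "a = 0")
  case False
  have "norm a ^ 3 = norm ((a \<circ>\<^sub>J a) \<circ>\<^sub>J a)"
    using norm_jordan_U_star[of a] by (simp add: jordan_U_def assms scaleR_2)
  also have "\<dots> \<le> norm (a \<circ>\<^sub>J a) * norm a" by (rule norm_jprod_le)
  finally have "norm a ^ 2 \<le> norm (a \<circ>\<^sub>J a)"
    using False by (simp add: power3_eq_cube power2_eq_square)
  with norm_jprod_le[of a a] show ?thesis by (simp add: power2_eq_square)
qed simp

text \<open>Closed unital *-subalgebras in which all multiplication operators commute; they are
  commutative associative C*-algebras and carry the functional calculus.\<close>

definition calg :: "('a \<times> complex) set \<Rightarrow> bool" where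
  "calg C \<longleftrightarrow> closed C \<and> (\<forall>\<gamma>. cs \<gamma> \<in> C) \<and> (\<forall>x\<in>C. st x \<in> C) \<and>
     (\<forall>x\<in>C. \<forall>y\<in>C. x + y \<in> C \<and> x \<odot> y \<in> C \<and> ext.op_commute x y)"

inductive_set polys :: "'a \<times> complex \<Rightarrow> ('a \<times> complex) set" for a where
  mono: "cs \<gamma> \<odot> ext.jpower a n \<in> polys a"
| add: "x \<in> polys a \<Longrightarrow> y \<in> polys a \<Longrightarrow> x + y \<in> polys a"

text \<open>Multiplications by powers of \<open>a\<close> commute by
  \<open>op_commute_jpower\<close>; bilinearity carries this to polynomials, and continuity of the
  product to their closure.\<close>

lemma calg_closure_polys:
  assumes a: "st a = a"
  shows "calg (closure (polys a))"
proof -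
  let ?S = "polys a"
  have st_pow: "st (ext.jpower a n) = ext.jpower a n" for n
    by (induction n) (simp_all add: st_one st_umul a)
  have st_S: "st x \<in> ?S" if "x \<in> ?S" for x
    using that by induction (simp_all add: st_umul st_cs st_pow st_add polys.intros)
  have mono_mult: "(cs \<gamma> \<odot> ext.jpower a m) \<odot> y \<in> ?S" if "y \<in> ?S" for \<gamma> m y
    using that
  proof induction
    case (mono \<delta> n)
    have "(cs \<gamma> \<odot> ext.jpower a m) \<odot> (cs \<delta> \<odot> ext.jpower a n)
        = cs (\<gamma> * \<delta>) \<odot> ext.jpower a (m + n)"
      unfolding cs_mult[symmetric] cs_umul(1) cs_umul(2)[of "ext.jpower a m"] ext.jpower_add ..
    then show ?case using polys.mono by metis
  qed (simp add: ext.distribs polys.add)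
  have mult_S: "x \<odot> y \<in> ?S" if "x \<in> ?S" "y \<in> ?S" for x y
    using that by induction (simp_all add: mono_mult ext.distribs polys.add)
  have mono_comm: "ext.op_commute (cs \<gamma> \<odot> ext.jpower a m) y" if "y \<in> ?S" for \<gamma> m y
    using that
  proof induction
    case (mono \<delta> n)
    let ?p = "ext.jpower a m" and ?q = "ext.jpower a n"
    have "(cs \<gamma> \<odot> ?p) \<odot> ((cs \<delta> \<odot> ?q) \<odot> z) = cs \<gamma> \<odot> (cs \<delta> \<odot> (?p \<odot> (?q \<odot> z)))" for z
      unfolding cs_umul(1) cs_umul(2)[of ?p] ..
    moreover have "(cs \<delta> \<odot> ?q) \<odot> ((cs \<gamma> \<odot> ?p) \<odot> z) = cs \<gamma> \<odot> (cs \<delta> \<odot> (?q \<odot> (?p \<odot> z)))" for z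
      unfolding cs_umul(1) cs_umul(2)[of ?q] by (rule cs_umul(2))
    ultimately show ?case using ext.op_commute_jpower[of a m n]
      unfolding ext.op_commute_def by metis
  qed (simp add: ext.op_commute_def ext.distribs)
  have comm_S: "ext.op_commute x y" if "x \<in> ?S" "y \<in> ?S" for x y
    using that
    by induction (use mono_comm in \<open>auto simp: ext.op_commute_def ext.distribs\<close>)
  have "x + y \<in> closure ?S \<and> x \<odot> y \<in> closure ?S \<and> ext.op_commute x y"
    if xy: "x \<in> closure ?S" "y \<in> closure ?S" for x y
  proof -
    obtain f g where f: "\<And>n. f n \<in> ?S" "f \<longlonglongrightarrow> x" and g: "\<And>n. g n \<in> ?S" "g \<longlonglongrightarrow> y"
      using xy unfolding closure_sequential by blast
    have "x + y \<in> closure ?S"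
      unfolding closure_sequential
      by (rule exI[of _ "\<lambda>n. f n + g n"]) (use f g in \<open>auto intro!: tendsto_intros polys.add\<close>)
    moreover have "x \<odot> y \<in> closure ?S"
      unfolding closure_sequential
      by (rule exI[of _ "\<lambda>n. f n \<odot> g n"]) (use f g in \<open>auto intro!: tendsto_intros mult_S\<close>)
    moreover have "x \<odot> (y \<odot> z) = y \<odot> (x \<odot> z)" for z
    proof (rule LIMSEQ_unique)
      show "(\<lambda>n. f n \<odot> (g n \<odot> z)) \<longlonglongrightarrow> x \<odot> (y \<odot> z)"
        using f g by (auto intro!: tendsto_intros)
      show "(\<lambda>n. f n \<odot> (g n \<odot> z)) \<longlonglongrightarrow> y \<odot> (x \<odot> z)"
      proof -
        have "f n \<odot> (g n \<odot> z) = g n \<odot> (f n \<odot> z)" for n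
          using comm_S[OF f(1) g(1)] unfolding ext.op_commute_def by blast
        then show ?thesis using f g by (auto intro!: tendsto_intros)
      qed
    qed
    ultimately show ?thesis
      unfolding ext.op_commute_def by simp
  qed
  moreover have "st x \<in> closure ?S" if x: "x \<in> closure ?S" for x
  proof -
    obtain f where f: "\<And>n. f n \<in> ?S" "f \<longlonglongrightarrow> x"
      using x unfolding closure_sequential by blast
    have "(\<lambda>n. st (f n)) \<longlonglongrightarrow> st x" using f by (auto intro!: tendsto_intros)
    then show ?thesis
      unfolding closure_sequential using st_S f(1) by (intro exI[of _ "\<lambda>n. st (f n)"]) simp
  qed
  moreover have "cs \<gamma> \<in> closure ?S" for \<gamma>
    using polys.mono[of \<gamma> a 0] closure_subset by auto
  ultimately show ?thesis unfolding calg_def by auto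
qed

lemma ex_calg:
  assumes "x \<in> sa"
  obtains C where "calg C" "x \<in> C"
proof -
  let ?a = "(fst x, 0)"
  have a: "st ?a = ?a" using assms by (simp add: sa_iff prod_eq_iff)
  have "cs 1 \<odot> ext.jpower ?a 1 + cs (snd x) \<odot> ext.jpower ?a 0 \<in> polys ?a"
    by (intro polys.intros)
  also have "cs 1 \<odot> ext.jpower ?a 1 + cs (snd x) \<odot> ext.jpower ?a 0 = x"
    by (simp add: prod_eq_iff)
  finally show ?thesis
    using that[OF calg_closure_polys[OF a]] closure_subset by blast
qed

end

section \<open>Square roots in commutative subalgebras\<close>

primrec sqr :: "nat \<Rightarrow> real" where
  "sqr 0 = 0"
| "sqr (Suc n) = (1 + sqr n * sqr n) / 2"

lemma sqr_bounds: "0 \<le> sqr n" "sqr n \<le> 1"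
proof -
  have "0 \<le> sqr n \<and> sqr n \<le> 1"
  proof (induction n)
    case (Suc n)
    then have "sqr n * sqr n \<le> 1 * 1" by (intro mult_mono) auto
    with Suc show ?case by simp
  qed simp
  then show "0 \<le> sqr n" "sqr n \<le> 1" by auto
qed

lemma sqr_mono: "n \<le> m \<Longrightarrow> sqr n \<le> sqr m"
proof (rule lift_Suc_mono_le)
  fix n
  have "0 \<le> (sqr n - 1)^2" by simp
  then show "sqr n \<le> sqr (Suc n)" by (simp add: power2_eq_square algebra_simps)
qed

lemma sqr_tendsto: "sqr \<longlonglongrightarrow> 1"
proof -
  have "convergent sqr"
    using sqr_bounds sqr_mono by (intro Bseq_monoseq_convergent BseqI'[of _ 1]) (auto simp: monoseq_def)
  then obtain L where L: "sqr \<longlonglongrightarrow> L" by (auto simp: convergent_def)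
  have "(\<lambda>n. sqr (Suc n)) \<longlonglongrightarrow> (1 + L * L) / 2"
    unfolding sqr.simps by (intro tendsto_intros L) simp
  then have "L = (1 + L * L) / 2"
    using LIMSEQ_unique LIMSEQ_Suc[OF L] by blast
  then have "(L - 1)^2 = 0" by (simp add: power2_eq_square field_simps)
  with L show ?thesis by simp
qed

context jb_star_algebra begin

section \<open>Calculus in one commutative subalgebra\<close>

lemma nrm_0 [simp]: "nrm 0 = 0"
  by simp

lemma nrm_pos [simp]: "0 < nrm x \<longleftrightarrow> x \<noteq> 0"
  using nrm_ge_0[of x] nrm_eq_0[of x] by linarith

lemma calg_add: "calg C \<Longrightarrow> x \<in> C \<Longrightarrow> y \<in> C \<Longrightarrow> x + y \<in> C"
  and calg_umul: "calg C \<Longrightarrow> x \<in> C \<Longrightarrow> y \<in> C \<Longrightarrow> x \<odot> y \<in> C"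
  and calg_cs: "calg C \<Longrightarrow> cs \<gamma> \<in> C"
  and calg_st: "calg C \<Longrightarrow> x \<in> C \<Longrightarrow> st x \<in> C"
  and calg_comm: "calg C \<Longrightarrow> x \<in> C \<Longrightarrow> y \<in> C \<Longrightarrow> ext.op_commute x y"
  and calg_closed: "calg C \<Longrightarrow> closed C"
  by (simp_all add: calg_def)

lemma calg_scaleR: "calg C \<Longrightarrow> x \<in> C \<Longrightarrow> r *\<^sub>R x \<in> C"
  using calg_umul[OF _ calg_cs, of C x "of_real r"] by (simp add: cs_of_real)

lemma calg_diff: "calg C \<Longrightarrow> x \<in> C \<Longrightarrow> y \<in> C \<Longrightarrow> x - y \<in> C"
  using calg_add[of C x "(-1) *\<^sub>R y"] calg_scaleR[of C y "-1"] by simp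

lemma calg_one: "calg C \<Longrightarrow> one \<in> C"
  using calg_cs[of C 1] by (simp add: cs_one)

lemma calg_0: "calg C \<Longrightarrow> 0 \<in> C"
  using calg_cs[of C 0] by (simp add: cs_def zero_prod_def)

lemmas calg_intros = calg_add calg_umul calg_cs calg_st calg_scaleR calg_diff calg_one calg_0

lemma calg_swap: "calg C \<Longrightarrow> x \<in> C \<Longrightarrow> y \<in> C \<Longrightarrow> x \<odot> (y \<odot> z) = y \<odot> (x \<odot> z)"
  using calg_comm unfolding ext.op_commute_def by blast

lemma calg_assoc:
  assumes "calg C" "x \<in> C" "y \<in> C" "z \<in> C"
  shows "(x \<odot> y) \<odot> z = x \<odot> (y \<odot> z)"
  using calg_swap[OF assms(1,4,2), of y] by (simp add: ext.commute)

lemma calg_U: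
  assumes "calg C" "f \<in> C" "g \<in> C"
  shows "ext.U f (ext.U g z) = ext.U (f \<odot> g) z"
  by (rule ext.U_mult) (intro calg_comm[OF assms(1)] calg_umul assms)+

lemma calg_jpower: "calg C \<Longrightarrow> x \<in> C \<Longrightarrow> ext.jpower x n \<in> C"
  by (induction n) (auto intro: calg_intros)

text \<open>A bound for multiplication by \<open>x\<close> on the ideal of elements with vanishing scalar part,
  that is, on the commutative C*-algebra whose unitization is \<open>C\<close>.\<close>

definition bdd :: "('a \<times> complex) set \<Rightarrow> real \<Rightarrow> 'a \<times> complex \<Rightarrow> bool" where
  "bdd C r x \<longleftrightarrow> cmod (snd x) \<le> r \<and> (\<forall>g\<in>C. snd g = 0 \<longrightarrow> nrm (x \<odot> g) \<le> r * nrm g)"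

lemma bdd_mono: "bdd C r x \<Longrightarrow> r \<le> s \<Longrightarrow> bdd C s x"
  unfolding bdd_def by (meson mult_right_mono nrm_ge_0 order_trans)

lemma bdd_add: "bdd C r x \<Longrightarrow> bdd C s y \<Longrightarrow> bdd C (r + s) (x + y)"
  unfolding bdd_def
  by (auto simp: ext.distribs algebra_simps intro: order_trans[OF norm_triangle_ineq add_mono]
      order_trans[OF nrm_add add_mono])

lemma bdd_cs: "bdd C r x \<Longrightarrow> bdd C (cmod \<gamma> * r) (cs \<gamma> \<odot> x)"
  unfolding bdd_def cs_umul nrm_cs_umul by (auto simp: norm_mult mult_left_mono mult.assoc)

lemma bdd_scaleR: "bdd C r x \<Longrightarrow> bdd C (\<bar>t\<bar> * r) (t *\<^sub>R x)"
  using bdd_cs[of C r x "of_real t"] by (simp add: cs_of_real)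

lemma bdd_diff: "bdd C r x \<Longrightarrow> bdd C s y \<Longrightarrow> bdd C (r + s) (x - y)"
  using bdd_add[of C r x s "(-1) *\<^sub>R y"] bdd_scaleR[of C s y "-1"] by simp

lemma bdd_ge_0: "bdd C r x \<Longrightarrow> 0 \<le> r"
  unfolding bdd_def using norm_ge_zero order_trans by blast

lemma bdd_umul:
  assumes C: "calg C" "x \<in> C" "y \<in> C" and b: "bdd C r x" "bdd C s y"
  shows "bdd C (r * s) (x \<odot> y)"
  unfolding bdd_def
proof (intro conjI ballI impI)
  show "cmod (snd (x \<odot> y)) \<le> r * s"
    using b unfolding bdd_def snd_umul norm_mult by (intro mult_mono) (auto intro: bdd_ge_0[OF b(1)])
  fix g assume g: "g \<in> C" "snd g = 0"
  have "nrm (x \<odot> (y \<odot> g)) \<le> r * nrm (y \<odot> g)"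
    using b(1) g C by (auto simp: bdd_def calg_umul)
  also have "\<dots> \<le> r * (s * nrm g)"
    using b(2) g by (intro mult_left_mono bdd_ge_0[OF b(1)]) (auto simp: bdd_def)
  finally show "nrm (x \<odot> y \<odot> g) \<le> r * s * nrm g"
    using calg_assoc[OF C g(1)] by simp
qed

lemma bdd_nrm: "bdd C (nrm x) x"
  unfolding bdd_def by (simp add: nrm_umul) (simp add: nrm_def)

lemma bdd_one: "bdd C 1 one"
  using bdd_nrm[of C one] by simp

lemma bdd_jpower:
  assumes "calg C" "x \<in> C" "bdd C r x"
  shows "bdd C (r ^ n) (ext.jpower x n)"
  by (induction n) (use assms in \<open>auto intro: bdd_one bdd_umul calg_jpower\<close>)

lemma tendsto_nrm [tendsto_intros]: "(f \<longlongrightarrow> x) F \<Longrightarrow> ((\<lambda>n. nrm (f n)) \<longlongrightarrow> nrm x) F"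
  unfolding nrm_def by (intro tendsto_intros)

lemma bdd_LIMSEQ:
  assumes "f \<longlonglongrightarrow> x" "\<And>n. n \<ge> N \<Longrightarrow> bdd C r (f n)"
  shows "bdd C r x"
  unfolding bdd_def
proof (intro conjI ballI impI)
  show "cmod (snd x) \<le> r"
    by (rule LIMSEQ_le_const2[OF tendsto_norm[OF tendsto_snd[OF assms(1)]]])
      (use assms(2) in \<open>auto simp: bdd_def\<close>)
  fix g assume g: "g \<in> C" "snd g = 0"
  have "(\<lambda>n. nrm (f n \<odot> g)) \<longlonglongrightarrow> nrm (x \<odot> g)"
    using assms(1) by (intro tendsto_intros) auto
  then show "nrm (x \<odot> g) \<le> r * nrm g"
    by (rule LIMSEQ_le_const2) (use assms(2) g in \<open>auto simp: bdd_def\<close>)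
qed

lemma nrm_cstar:
  assumes C: "calg C" and g: "g \<in> C" "snd g = 0"
  shows "nrm g ^ 2 \<le> nrm (g \<odot> st g)"
proof (cases "g = 0")
  case False
  have "(g \<odot> g) \<odot> st g = g \<odot> (g \<odot> st g)"
    using C g by (intro calg_assoc) (auto intro: calg_intros)
  then have "ext.U g (st g) = g \<odot> (g \<odot> st g)"
    by (simp add: ext.U_alt scaleR_2)
  moreover have "nrm (ext.U g (st g)) = nrm g ^ 3"
  proof -
    obtain a where a: "g = (a, 0)" using g(2) by (metis prod.collapse)
    have "st g = (star a, 0)" by (simp add: a st_def)
    then show ?thesis unfolding a by (simp add: U_pair nrm_def norm_jordan_U_star)
  qed
  ultimately have "nrm g ^ 3 \<le> nrm g * nrm (g \<odot> st g)"
    using nrm_umul by metis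
  then have "nrm g * nrm g ^ 2 \<le> nrm g * nrm (g \<odot> st g)"
    by (simp add: power3_eq_cube power2_eq_square mult.assoc)
  then show ?thesis using False mult_le_cancel_left_pos[of "nrm g"] nrm_pos by blast
qed simp

lemma nrm_st_le:
  assumes C: "calg C" and g: "g \<in> C" "snd g = 0"
  shows "nrm (st g) \<le> nrm g"
proof (cases "st g = 0")
  case False
  have "nrm (st g) * nrm (st g) \<le> nrm (st g) * nrm g"
    using nrm_cstar[OF C calg_st[OF C g(1)]] g(2) nrm_umul[of "st g" g]
    by (simp add: st_st power2_eq_square)
  then show ?thesis using False mult_le_cancel_left_pos[of "nrm (st g)"] nrm_pos by blast
qed simp

text \<open>For unitary \<open>u\<close> the element (ug)(ug)* equals g g*, and the C*-inequality
  applies.\<close>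

lemma bdd_unitary:
  assumes C: "calg C" and u: "u \<in> C" "u \<odot> st u = one"
  shows "bdd C 1 u"
  unfolding bdd_def
proof (intro conjI ballI impI)
  have "snd u * cnj (snd u) = 1" using arg_cong[OF u(2), of snd] by simp
  then show "cmod (snd u) \<le> 1"
    by (metis complex_mod_mult_cnj norm_one power2_eq_square power_mono_iff norm_ge_zero
        zero_less_numeral order_refl power_one zero_le_one)
  fix g assume g: "g \<in> C" "snd g = 0"
  have "(u \<odot> g) \<odot> (st u \<odot> st g) = u \<odot> (g \<odot> (st u \<odot> st g))"
    using C u g by (intro calg_assoc calg_intros)
  also have "g \<odot> (st u \<odot> st g) = st u \<odot> (g \<odot> st g)"
    using C u g by (intro calg_swap calg_intros)
  also have "u \<odot> (st u \<odot> (g \<odot> st g)) = (u \<odot> st u) \<odot> (g \<odot> st g)"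
    using C u g by (intro calg_assoc[symmetric] calg_intros)
  finally have "(u \<odot> g) \<odot> (st u \<odot> st g) = (u \<odot> st u) \<odot> (g \<odot> st g)" .
  then have "nrm (u \<odot> g) ^ 2 \<le> nrm (g \<odot> st g)"
    using nrm_cstar[OF C calg_umul[OF C u(1) g(1)]] g(2) u(2) by (simp add: st_umul ext.unit)
  also have "\<dots> \<le> nrm g * nrm g"
    by (rule order_trans[OF nrm_umul]) (intro mult_left_mono nrm_st_le[OF C g] nrm_ge_0)
  finally show "nrm (u \<odot> g) \<le> 1 * nrm g"
    by (simp add: power2_eq_square flip: abs_le_square_iff)
      (metis abs_le_square_iff abs_of_nonneg nrm_ge_0 power2_eq_square)
qed

text \<open>Recovers the norm from the operator bound. With \<gamma> the scalar part of
  \<open>x\<close> and y = x - \<gamma>1, the equation y^2 = xy - \<gamma>y gives |y|^2 \<le> 2r|y|;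
  the scalar part adds one more \<open>r\<close>.\<close>

lemma nrm_le_bdd:
  assumes C: "calg C" and x: "x \<in> C" "x \<in> sa" and b: "bdd C r x"
  shows "nrm x \<le> 3 * r"
proof -
  define y where "y = x - cs (snd x)"
  have y: "y \<in> C" "snd y = 0" "star (fst y) = fst y"
    using C x by (auto simp: y_def sa_iff intro: calg_intros)
  have "y \<odot> y = x \<odot> y - cs (snd x) \<odot> y"
    by (simp add: y_def ext.distribs)
  then have "nrm (y \<odot> y) \<le> r * nrm y + cmod (snd x) * nrm y"
    using nrm_diff[of "x \<odot> y" "cs (snd x) \<odot> y"] b y by (auto simp: bdd_def nrm_cs_umul)
  also have "\<dots> \<le> r * nrm y + r * nrm y"
    using b by (intro add_mono mult_right_mono) (auto simp: bdd_def)
  finally have "nrm y ^ 2 \<le> 2 * r * nrm y"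
    using norm_square[OF y(3)] y(2) by (simp add: nrm_def)
  then have "nrm y * nrm y \<le> nrm y * (2 * r)"
    by (simp add: power2_eq_square mult.commute)
  then have "nrm y \<le> 2 * r"
    using bdd_ge_0[OF b] mult_le_cancel_left_pos[of "nrm y" "nrm y" "2 * r"] nrm_pos[of y]
    by (cases "y = 0") auto
  moreover have "nrm x = nrm y + cmod (snd x)" by (simp add: y_def nrm_def)
  ultimately show ?thesis using b by (auto simp: bdd_def)
qed

text \<open>Newton-type iteration for \<open>1 - sqrt (1 - v)\<close>; its increments are dominated by those of the
  scalar iteration \<open>sqr\<close>, which converges even in the boundary case \<open>v = 1\<close>.\<close>

primrec sq :: "nat \<Rightarrow> 'a \<times> complex \<Rightarrow> 'a \<times> complex" where
  "sq 0 v = 0"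
| "sq (Suc n) v = (1/2) *\<^sub>R (v + sq n v \<odot> sq n v)"

definition rt :: "'a \<times> complex \<Rightarrow> 'a \<times> complex" where "rt v = lim (\<lambda>n. sq n v)"

lemma sq_in:
  assumes "calg C" "v \<in> C" "v \<in> sa"
  shows "sq n v \<in> C" "sq n v \<in> sa"
  by (induction n) (use assms in \<open>auto intro!: calg_intros sa_0 sa_add sa_scaleR sa_umul\<close>)

lemma bdd_sq:
  assumes "calg C" "v \<in> C" "v \<in> sa" "bdd C 1 v"
  shows "bdd C (sqr n) (sq n v)"
proof (induction n)
  case (Suc n)
  have "bdd C (\<bar>1/2\<bar> * (1 + sqr n * sqr n)) (sq (Suc n) v)"
    unfolding sq.simps by (intro bdd_scaleR bdd_add bdd_umul assms Suc sq_in)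
  then show ?case by simp
qed (simp add: bdd_def)

lemma bdd_sq_kappa:
  assumes "calg C" "v \<in> C" "v \<in> sa" "bdd C \<kappa> v" "\<kappa> \<le> 1"
  shows "bdd C \<kappa> (sq n v)"
proof (induction n)
  case 0
  show ?case using bdd_ge_0[OF assms(4)] by (simp add: bdd_def)
next
  case (Suc n)
  have "bdd C (\<bar>1/2\<bar> * (\<kappa> + \<kappa> * \<kappa>)) (sq (Suc n) v)"
    unfolding sq.simps by (intro bdd_scaleR bdd_add bdd_umul assms Suc sq_in)
  moreover have "\<bar>1/2\<bar> * (\<kappa> + \<kappa> * \<kappa>) \<le> \<kappa>"
    using mult_left_mono[OF assms(5) bdd_ge_0[OF assms(4)]] by simp
  ultimately show ?case by (rule bdd_mono)
qed

text \<open>In both iterations the next increment is half the product of the last increment with the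
  sum of the last two iterates, so bounds by \<open>sqr\<close> propagate.\<close>

lemma bdd_sq_Suc:
  assumes "calg C" "v \<in> C" "v \<in> sa" "bdd C 1 v"
  shows "bdd C (sqr (Suc n) - sqr n) (sq (Suc n) v - sq n v)"
proof (induction n)
  case 0
  show ?case using bdd_scaleR[OF assms(4), of "1/2"] by simp
next
  case (Suc n)
  let ?a = "sq (Suc n) v" and ?b = "sq n v"
  have eq: "sq (Suc (Suc n)) v - ?a = (1/2) *\<^sub>R ((?a - ?b) \<odot> (?a + ?b))"
  proof -
    have "(?a - ?b) \<odot> (?a + ?b) = ?a \<odot> ?a - ?b \<odot> ?b"
      by (simp only: ext.distribs ext.commute[of ?b ?a]) simp
    moreover have "sq (Suc (Suc n)) v - ?a = (1/2) *\<^sub>R (v + ?a \<odot> ?a) - (1/2) *\<^sub>R (v + ?b \<odot> ?b)"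
      by (simp only: sq.simps)
    ultimately show ?thesis by (simp only: scaleR_add_right scaleR_diff_right) simp
  qed
  have "bdd C (\<bar>1/2\<bar> * ((sqr (Suc n) - sqr n) * (sqr (Suc n) + sqr n))) (sq (Suc (Suc n)) v - ?a)"
    unfolding eq by (intro bdd_scaleR bdd_umul bdd_add Suc bdd_sq assms calg_diff calg_add sq_in)
  moreover have "\<bar>1/2\<bar> * ((sqr (Suc n) - sqr n) * (sqr (Suc n) + sqr n)) = sqr (Suc (Suc n)) - sqr (Suc n)"
    by (simp add: field_simps)
  ultimately show ?case by metis
qed

lemma bdd_sq_diff:
  assumes "calg C" "v \<in> C" "v \<in> sa" "bdd C 1 v"
  shows "bdd C (sqr (n + k) - sqr n) (sq (n + k) v - sq n v)"
proof (induction k)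
  case (Suc k)
  have "bdd C ((sqr (Suc (n + k)) - sqr (n + k)) + (sqr (n + k) - sqr n))
      ((sq (Suc (n + k)) v - sq (n + k) v) + (sq (n + k) v - sq n v))"
    by (rule bdd_add[OF bdd_sq_Suc[OF assms] Suc])
  then show ?case by (simp del: sqr.simps sq.simps)
qed (simp add: bdd_def)

lemma rt_tendsto:
  assumes "calg C" "v \<in> C" "v \<in> sa" "bdd C 1 v"
  shows "(\<lambda>n. sq n v) \<longlonglongrightarrow> rt v"
proof -
  have *: "norm (sq (n + k) v - sq n v) \<le> 3 * (1 - sqr n)" for n k
  proof -
    have "nrm (sq (n + k) v - sq n v) \<le> 3 * (sqr (n + k) - sqr n)"
      by (intro nrm_le_bdd[OF assms(1)] bdd_sq_diff calg_diff[OF assms(1)] sa_diff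
          sq_in[OF assms(1-3)] assms)
    then show ?thesis using norm_le_nrm[of "sq (n + k) v - sq n v"] sqr_bounds(2)[of "n + k"] by argo
  qed
  have "Cauchy (\<lambda>n. sq n v)"
  proof (rule CauchyI')
    fix e :: real assume "0 < e"
    then have "eventually (\<lambda>n. dist (sqr n) 1 < e / 3) sequentially"
      using sqr_tendsto[unfolded tendsto_iff, rule_format, of "e / 3"] by simp
    then obtain M where M: "\<And>n. n \<ge> M \<Longrightarrow> dist (sqr n) 1 < e / 3"
      by (auto simp: eventually_sequentially)
    have "norm (sq m v - sq n v) < e" if "m \<ge> M" "n > m" for m n
    proof -
      have "3 * (1 - sqr m) < e"
        using M[OF that(1)] sqr_bounds(2)[of m] by (simp add: dist_real_def abs_if split: if_splits)
      then have "norm (sq (m + (n - m)) v - sq m v) < e" using *[of m "n - m"] by linarith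
      then show ?thesis using that by (simp add: norm_minus_commute)
    qed
    then show "\<exists>M. \<forall>m\<ge>M. \<forall>n>m. dist (sq m v) (sq n v) < e"
      unfolding dist_norm by blast
  qed
  then show ?thesis unfolding rt_def by (simp add: Cauchy_convergent_iff convergent_LIMSEQ_iff)
qed

text \<open>The rate in \<open>bdd_rt_sq\<close> does not depend on \<open>v\<close>, which later
  gives uniform continuity. By \<open>bdd_rt\<close> a bound below 1 is inherited by the root, so
  that \<open>one - rt v\<close> is invertible by a Neumann series.\<close>

lemma rt_props:
  assumes "calg C" "v \<in> C" "v \<in> sa" "bdd C 1 v"
  shows rt_in: "rt v \<in> C" "rt v \<in> sa"
    and rt_eq: "(one - rt v) \<odot> (one - rt v) = one - v"
    and bdd_rt_sq: "bdd C (1 - sqr n) (rt v - sq n v)"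
    and bdd_rt: "bdd C \<kappa> v \<Longrightarrow> \<kappa> \<le> 1 \<Longrightarrow> bdd C \<kappa> (rt v)"
proof -
  note l = rt_tendsto[OF assms]
  show "rt v \<in> C" "rt v \<in> sa"
    using closed_sequentially[OF calg_closed[OF assms(1)] _ l] closed_sequentially[OF closed_sa _ l]
      sq_in[OF assms(1-3)] by auto
  have "(\<lambda>n. sq (Suc n) v) \<longlonglongrightarrow> (1/2) *\<^sub>R (v + rt v \<odot> rt v)"
    unfolding sq.simps by (intro tendsto_intros l)
  then have *: "rt v = (1/2) *\<^sub>R (v + rt v \<odot> rt v)"
    using LIMSEQ_unique LIMSEQ_Suc[OF l] by blast
  have "2 *\<^sub>R rt v = v + rt v \<odot> rt v" by (subst *) simp
  then show "(one - rt v) \<odot> (one - rt v) = one - v"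
    by (simp add: ext.distribs ext.unit scaleR_2 algebra_simps)
  have "bdd C (1 - sqr n) (sq m v - sq n v)" if "m \<ge> n" for m
    using bdd_sq_diff[OF assms, of n "m - n"] that sqr_bounds(2)[of m]
    by (auto elim!: bdd_mono)
  then show "bdd C (1 - sqr n) (rt v - sq n v)"
    by (intro bdd_LIMSEQ[OF tendsto_diff[OF l tendsto_const]])
  show "bdd C \<kappa> (rt v)" if "bdd C \<kappa> v" "\<kappa> \<le> 1"
    using bdd_LIMSEQ[OF l bdd_sq_kappa[OF assms(1-3) that]] .
qed

text \<open>The element y + i m is unitary; \<open>y\<close> is its real part, and
  \<open>y \<odot> y - m \<odot> m\<close> is the real part of its square.\<close>

lemma bdd_unit_circle:
  assumes C: "calg C" and y: "y \<in> C" "y \<in> sa" and m: "m \<in> C" "m \<in> sa"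
    and eq: "y \<odot> y + m \<odot> m = one"
  shows "bdd C 1 y" "bdd C 1 (y \<odot> y - m \<odot> m)"
proof -
  define u where "u = y + cs \<i> \<odot> m"
  have u: "u \<in> C" using C y m by (auto simp: u_def intro: calg_intros)
  have stu: "st u = y - cs \<i> \<odot> m"
  proof -
    have "st u = y + cs (- \<i>) \<odot> m"
      using y m by (simp add: u_def st_add st_umul st_cs sa_def)
    also have "cs (- \<i>) = - cs \<i>" by (simp add: cs_def)
    finally show ?thesis by (simp add: ext.distribs)
  qed
  have ii: "(cs \<i> \<odot> m) \<odot> (cs \<i> \<odot> m) = - (m \<odot> m)"
  proof -
    have "(cs \<i> \<odot> m) \<odot> (cs \<i> \<odot> m) = cs \<i> \<odot> (cs \<i> \<odot> (m \<odot> m))"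
      unfolding cs_umul(1) cs_umul(2)[of m] ..
    also have "\<dots> = cs (\<i> * \<i>) \<odot> (m \<odot> m)"
      unfolding cs_mult[symmetric] cs_umul(1) ..
    also have "\<dots> = - (m \<odot> m)" using cs_of_real[of "-1"] by simp
    finally show ?thesis .
  qed
  have uu: "u \<odot> st u = one"
    unfolding stu unfolding u_def using eq by (simp add: ext.distribs ii ext.commute[of "cs \<i> \<odot> m" y])
  have b: "bdd C 1 u" "bdd C 1 (st u)"
    using bdd_unitary[OF C] u uu calg_st[OF C u] by (auto simp: st_st ext.commute)
  have "bdd C (\<bar>1/2\<bar> * (1 + 1)) ((1/2) *\<^sub>R (u + st u))" by (intro bdd_scaleR bdd_add b)
  also have "(1/2) *\<^sub>R (u + st u) = y" by (simp add: stu) (simp add: u_def flip: scaleR_2)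
  finally show "bdd C 1 y" by simp
  have "bdd C (\<bar>1/2\<bar> * (1 * 1 + 1 * 1)) ((1/2) *\<^sub>R (u \<odot> u + st u \<odot> st u))"
    by (intro bdd_scaleR bdd_add bdd_umul b u calg_st C)
  also have "(1/2) *\<^sub>R (u \<odot> u + st u \<odot> st u) = y \<odot> y - m \<odot> m"
    unfolding stu unfolding u_def by (simp add: ext.distribs ii ext.commute[of "cs \<i> \<odot> m" y] flip: scaleR_2)
  finally show "bdd C 1 (y \<odot> y - m \<odot> m)" by simp
qed

text \<open>With \<open>c\<close> a root of \<open>one - k \<odot> k\<close> the pair
  \<open>c\<close>, \<open>k\<close> lies on the unit circle, and
  \<open>one - 2 *\<^sub>R (k \<odot> k)\<close> is c^2 - k^2.\<close>

lemma bdd_one_minus_square: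
  assumes C: "calg C" and k: "k \<in> C" "k \<in> sa" and b: "bdd C 1 k"
  shows "bdd C 1 (one - k \<odot> k)" "bdd C 1 (one - 2 *\<^sub>R (k \<odot> k))"
proof -
  have v: "k \<odot> k \<in> C" "k \<odot> k \<in> sa" "bdd C 1 (k \<odot> k)"
    using C k sa_umul bdd_umul[OF C k(1) k(1) b b] by (auto intro: calg_intros)
  define c where "c = one - rt (k \<odot> k)"
  have c: "c \<in> C" "c \<in> sa" "c \<odot> c = one - k \<odot> k"
    using rt_props[OF C v] C by (auto simp: c_def intro!: calg_intros sa_diff sa_one)
  have "bdd C 1 c" using bdd_unit_circle(1)[OF C c(1,2) k] c(3) by simp
  then show "bdd C 1 (one - k \<odot> k)" using bdd_umul[OF C c(1) c(1)] c(3) by fastforce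
  show "bdd C 1 (one - 2 *\<^sub>R (k \<odot> k))"
    using bdd_unit_circle(2)[OF C c(1,2) k] c(3) by (simp add: scaleR_2 algebra_simps)
qed

end

section \<open>Squares form a closed convex cone\<close>

lemma sum_cis_powers:
  assumes "0 < k" "k < N"
  shows "(\<Sum>j<N. (cis (2 * pi * real j / real N)) ^ k) = 0"
proof -
  define z where "z = cis (2 * pi * real k / real N)"
  have e: "(cis (2 * pi * real j / real N)) ^ k = z ^ j" for j
    unfolding z_def Complex.DeMoivre by (rule arg_cong[of _ _ cis]) (simp add: mult_ac)
  have "z ^ N = 1"
    using assms by (simp add: z_def Complex.DeMoivre cis_multiple_2pi)
  moreover have "z \<noteq> 1"
  proof
    assume "z = 1"
    then have "cos (2 * pi * real k / real N) = 1" by (simp add: z_def complex_eq_iff)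
    then obtain n :: int where "2 * pi * real k / real N = real_of_int n * 2 * pi"
      unfolding cos_one_2pi_int by auto
    then have "real k = real_of_int n * real N" using assms by (simp add: field_simps)
    then have kn: "int k = n * int N" by (metis of_int_eq_iff of_int_mult of_int_of_nat_eq)
    then have "0 < n" using assms by (metis of_nat_0_less_iff zero_less_mult_pos2 order_less_trans)
    then have "int N \<le> n * int N" using mult_right_mono[of 1 n "int N"] by simp
    then show False using kn assms(2) by linarith
  qed
  ultimately show ?thesis unfolding e by (simp add: geometric_sum)
qed

context jb_star_algebra begin

section \<open>Quadratic operators of almost unitary elements\<close>

lemma st_trip: "st (ext.trip x y z) = ext.trip (st x) (st y) (st z)"
  by (simp add: ext.trip_def st_add st_diff st_umul)

lemma nrm_U_cube: "snd x = 0 \<Longrightarrow> nrm (ext.U x (st x)) = nrm x ^ 3"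
proof -
  assume "snd x = 0"
  then obtain a where a: "x = (a, 0)" by (metis prod.collapse)
  have "st x = (star a, 0)" by (simp add: a st_def)
  then show ?thesis unfolding a by (simp add: U_pair nrm_def norm_jordan_U_star)
qed

text \<open>By the norm axiom and the fundamental formula, |U_u x|^3 is the norm of U_u U_x U_u
  U_{u*} x*. Here U_u U_{u*} = U_{u u*} is close to the identity, so the norm is at most \<tau> K
  |x|^3, where \<tau> is the norm of U_u on the ideal. Hence \<tau>^3 \<le> \<tau> K. The factor 9
  in K collects the crude bounds 3 for the triple product and for the involution.\<close>

lemma U_near_isometry:
  assumes C: "calg C" and u: "u \<in> C" and \<delta>: "0 \<le> \<delta>"
    and near: "\<And>x. snd x = 0 \<Longrightarrow> nrm (ext.U (u \<odot> st u) x - x) \<le> \<delta> * nrm x"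
    and x: "snd x = 0"
  shows "nrm (ext.U u x) ^ 2 \<le> (1 + 9 * \<delta>) * nrm x ^ 2"
proof -
  define f where "f a = fst (ext.U u (a, 0))" for a
  have Uf: "ext.U u (a, 0) = (f a, 0)" for a
    by (simp add: f_def prod_eq_iff trip_fst)
  define K where "K = 1 + 9 * \<delta>"
  have K: "K \<ge> 1" using \<delta> by (simp add: K_def)
  have bl: "bounded_linear f"
  proof (rule bounded_linear_intro)
    show "f (a + b) = f a + f b" for a b
      using ext.trip_linear(2)[of u "(a, 0)" "(b, 0)" u] by (simp add: f_def)
    show "f (r *\<^sub>R a) = r *\<^sub>R f a" for r a
      using ext.trip_linear(8)[of u r "(a, 0)" u] by (simp add: f_def)
    show "norm (f a) \<le> norm a * (3 * nrm u * nrm u)" for a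
      using nrm_trip[of u "(a, 0)" u] by (simp add: Uf) (simp add: nrm_def algebra_simps)
  qed
  define \<tau> where "\<tau> = onorm f"
  have \<tau>: "norm (f a) \<le> \<tau> * norm a" "0 \<le> \<tau>" for a
    using onorm[OF bl] onorm_pos_le[OF bl] by (auto simp: \<tau>_def)
  have cube: "norm (f a) ^ 3 \<le> (\<tau> * K) * norm a ^ 3" for a
  proof -
    let ?x = "(a, 0) :: 'a \<times> complex"
    let ?y = "ext.U u ?x"
    define e where "e = ext.U (u \<odot> st u) (st ?x) - st ?x"
    have e: "nrm e \<le> 3 * \<delta> * norm a"
    proof -
      have "nrm e \<le> \<delta> * nrm (st ?x)" unfolding e_def by (rule near) simp
      also have "\<dots> \<le> \<delta> * (3 * nrm ?x)" by (rule mult_left_mono[OF nrm_st \<delta>])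
      finally show ?thesis by (simp add: nrm_def)
    qed
    define p where "p = ext.U ?x (st ?x + e)"
    have "ext.U ?y (st ?y) = ext.U u (ext.U ?x (ext.U u (ext.U (st u) (st ?x))))"
      by (simp add: ext.fundamental_formula st_trip)
    also have "ext.U u (ext.U (st u) (st ?x)) = st ?x + e"
      by (simp add: calg_U[OF C u calg_st[OF C u]] e_def)
    finally have "nrm ?y ^ 3 = nrm (ext.U u p)"
      using nrm_U_cube[of ?y] by (simp add: p_def trip_fst)
    moreover have "p = (fst p, 0)" by (simp add: p_def prod_eq_iff trip_fst)
    ultimately have "norm (f a) ^ 3 = norm (f (fst p))"
      using Uf by (metis Uf add_0_right fst_conv nrm_def norm_zero snd_conv)
    also have "\<dots> \<le> \<tau> * nrm p"
      using \<tau>(1)[of "fst p"] \<open>p = (fst p, 0)\<close> by (metis add_0_right nrm_def norm_zero snd_conv)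
    finally have 1: "norm (f a) ^ 3 \<le> \<tau> * nrm p" .
    have "nrm p \<le> nrm (ext.U ?x (st ?x)) + nrm (ext.U ?x e)"
      unfolding p_def ext.trip_linear by (rule nrm_add)
    also have "nrm (ext.U ?x (st ?x)) = norm a ^ 3" using nrm_U_cube[of ?x] by (simp add: nrm_def)
    also have "nrm (ext.U ?x e) \<le> 3 * norm a * nrm e * norm a"
      using nrm_trip[of ?x e ?x] by (simp add: nrm_def)
    also have "3 * norm a * nrm e * norm a \<le> 3 * norm a * (3 * \<delta> * norm a) * norm a"
      by (intro mult_right_mono mult_left_mono e) auto
    also have "norm a ^ 3 + 3 * norm a * (3 * \<delta> * norm a) * norm a = K * norm a ^ 3"
      by (simp add: K_def power3_eq_cube algebra_simps)
    finally have "\<tau> * nrm p \<le> \<tau> * (K * norm a ^ 3)" using \<tau>(2) by (simp add: mult_left_mono)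
    with 1 show ?thesis by (simp add: mult.assoc)
  qed
  \<comment> \<open>\<open>cube\<close> bounds the operator norm in terms of itself; the cube root
    turns it into a bound linear in \<open>norm a\<close>.\<close>
  have "\<tau> \<le> root 3 (\<tau> * K)"
    unfolding \<tau>_def
  proof (rule onorm_bound)
    show "0 \<le> root 3 (onorm f * K)" using \<tau>(2) K by (simp add: \<tau>_def)
    show "norm (f a) \<le> root 3 (onorm f * K) * norm a" for a
    proof -
      have "root 3 (norm (f a) ^ 3) \<le> root 3 ((\<tau> * K) * norm a ^ 3)"
        using cube by simp
      then show ?thesis by (simp add: real_root_power_cancel real_root_mult \<tau>_def)
    qed
  qed
  then have "\<tau> ^ 3 \<le> root 3 (\<tau> * K) ^ 3" using \<tau>(2) by (rule power_mono)
  also have "\<dots> = \<tau> * K" using \<tau>(2) K by (simp add: real_root_pow_pos2)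
  finally have "\<tau> * \<tau>^2 \<le> \<tau> * K" by (simp add: power3_eq_cube power2_eq_square)
  then have \<tau>2: "\<tau>^2 \<le> K" using \<tau>(2) K by (cases "\<tau> = 0") auto
  obtain a where a: "x = (a, 0)" using x by (metis prod.collapse)
  have "norm (f a) ^ 2 \<le> (\<tau> * norm a) ^ 2" by (intro power_mono \<tau>) auto
  also have "\<dots> \<le> K * norm a ^ 2" unfolding power_mult_distrib by (intro mult_right_mono \<tau>2) auto
  finally show ?thesis unfolding a Uf by (simp add: nrm_def K_def)
qed

section \<open>Polynomials with coefficients in the unitization and their mean value\<close>

inductive pol :: "(complex \<Rightarrow> 'a \<times> complex) \<Rightarrow> bool" where
  const: "pol (\<lambda>w. v)"
| shift: "pol f \<Longrightarrow> pol (\<lambda>w. cs w \<odot> f w)"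
| add: "pol f \<Longrightarrow> pol g \<Longrightarrow> pol (\<lambda>w. f w + g w)"

lemma pol_umul:
  assumes "pol f" "pol g"
  shows "pol (\<lambda>w. f w \<odot> g w)"
  using assms(1)
proof induction
  case (const v)
  from assms(2) show ?case
  proof induction
    case (shift g)
    then show ?case using pol.shift[OF shift.IH] by (simp add: cs_umul(2)[of v])
  qed (auto simp: ext.distribs intro: pol.intros)
next
  case (shift f)
  then show ?case using pol.shift[OF shift.IH] by (simp add: cs_umul(1))
next
  case (add f h)
  then show ?case using pol.add[OF add.IH] by (simp add: ext.distribs)
qed

lemma pol_diff: "pol f \<Longrightarrow> pol g \<Longrightarrow> pol (\<lambda>w. f w - g w)"
  using pol.add[OF _ pol_umul[OF pol.const[of "cs (-1)"]], of f g] cs_of_real[of "-1"] by simp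

text \<open>Every sufficiently large degree is allowed, so that two summands can be padded to a
  common degree.\<close>

lemma pol_coeffs:
  assumes "pol f"
  shows "\<exists>d0. \<forall>d\<ge>d0. \<exists>v. \<forall>w. f w = (\<Sum>k\<le>d. cs (w ^ k) \<odot> v k)"
  using assms
proof induction
  case (const c)
  have "\<exists>v. \<forall>w. c = (\<Sum>k\<le>d. cs (w ^ k) \<odot> v k)" for d
  proof (intro exI allI)
    fix w
    have "(\<Sum>k\<le>d. cs (w ^ k) \<odot> (if k = 0 then c else 0)) = (\<Sum>k\<le>d. if k = 0 then c else 0)"
      by (rule sum.cong) (auto simp: cs_one ext.unit)
    then show "c = (\<Sum>k\<le>d. cs (w ^ k) \<odot> (if k = 0 then c else 0))" by simp
  qed
  then show ?case by blast
next
  case (shift f)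
  then obtain d0 where d0: "\<And>d. d \<ge> d0 \<Longrightarrow> \<exists>v. \<forall>w. f w = (\<Sum>k\<le>d. cs (w ^ k) \<odot> v k)" by blast
  have "\<exists>v. \<forall>w. cs w \<odot> f w = (\<Sum>k\<le>d. cs (w ^ k) \<odot> v k)" if d: "d \<ge> Suc d0" for d
  proof -
    obtain d' where d': "d = Suc d'" using d by (cases d) auto
    then obtain v where v: "\<And>w. f w = (\<Sum>k\<le>d'. cs (w ^ k) \<odot> v k)" using d0 d by fastforce
    have "cs w \<odot> f w = (\<Sum>k\<le>d. cs (w ^ k) \<odot> (case k of 0 \<Rightarrow> 0 | Suc j \<Rightarrow> v j))" for w
      unfolding d' sum.atMost_Suc_shift v
      by (simp add: sum_distrib_left bounded_bilinear.sum_right[OF bounded_bilinear_umul]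
          cs_umul(1) flip: cs_mult)
    then show ?thesis by blast
  qed
  then show ?case by blast
next
  case (add f g)
  then obtain d1 d2 where
    1: "\<And>d. d \<ge> d1 \<Longrightarrow> \<exists>v. \<forall>w. f w = (\<Sum>k\<le>d. cs (w ^ k) \<odot> v k)" and
    2: "\<And>d. d \<ge> d2 \<Longrightarrow> \<exists>v. \<forall>w. g w = (\<Sum>k\<le>d. cs (w ^ k) \<odot> v k)" by blast
  have "\<exists>v. \<forall>w. f w + g w = (\<Sum>k\<le>d. cs (w ^ k) \<odot> v k)" if d: "d \<ge> max d1 d2" for d
  proof -
    obtain v v' where "\<And>w. f w = (\<Sum>k\<le>d. cs (w ^ k) \<odot> v k)" "\<And>w. g w = (\<Sum>k\<le>d. cs (w ^ k) \<odot> v' k)"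
      using 1[of d] 2[of d] d by auto
    then have "\<forall>w. f w + g w = (\<Sum>k\<le>d. cs (w ^ k) \<odot> (v k + v' k))"
      by (simp add: ext.distribs sum.distrib)
    then show ?thesis by (rule exI[of _ "\<lambda>k. v k + v' k"])
  qed
  then show ?case by blast
qed

lemma nrm_sum: "nrm (sum f A) \<le> (\<Sum>i\<in>A. nrm (f i))"
  by (induction A rule: infinite_finite_induct) (auto intro: order_trans[OF nrm_add])

text \<open>The average over the N-th roots of unity, with N above the degree, kills every
  nonconstant coefficient; it replaces an integral over the circle.\<close>

lemma pol_mean_value:
  assumes "pol f" and bound: "\<And>w. cmod w = 1 \<Longrightarrow> nrm (f w) \<le> r"
  shows "nrm (f 0) \<le> r"
proof -
  obtain d v where v: "\<And>w. f w = (\<Sum>k\<le>d. cs (w ^ k) \<odot> v k)"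
    using pol_coeffs[OF assms(1)] by blast
  define N where "N = Suc d"
  define \<omega> where "\<omega> j = cis (2 * pi * real j / real N)" for j :: nat
  have f0: "f 0 = v 0"
  proof -
    have "f 0 = (\<Sum>k\<le>d. if k = 0 then v 0 else 0)"
      unfolding v by (rule sum.cong) (auto simp: cs_one ext.unit cs_def power_0_left zero_prod_def[symmetric])
    then show ?thesis by simp
  qed
  have cs_sum: "(\<Sum>j<N. cs (g j) \<odot> y) = cs (\<Sum>j<N. g j) \<odot> y" for g y
    by (induction N) (simp_all add: cs_def ext.add_left[symmetric] zero_prod_def[symmetric])
  have "(\<Sum>j<N. f (\<omega> j)) = (\<Sum>k\<le>d. cs (\<Sum>j<N. \<omega> j ^ k) \<odot> v k)"
    unfolding v sum.swap[of _ "{..<N}"] cs_sum[symmetric] ..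
  also have "\<dots> = (\<Sum>k\<le>d. if k = 0 then real N *\<^sub>R v 0 else 0)"
  proof (rule sum.cong)
    fix k assume k: "k \<in> {..d}"
    show "cs (\<Sum>j<N. \<omega> j ^ k) \<odot> v k = (if k = 0 then real N *\<^sub>R v 0 else 0)"
    proof (cases "k = 0")
      case True
      then show ?thesis using cs_of_real[of "real N"] by simp
    next
      case False
      then have "(\<Sum>j<N. \<omega> j ^ k) = 0"
        unfolding \<omega>_def using k by (intro sum_cis_powers) (auto simp: N_def)
      then show ?thesis using False by (simp add: cs_def zero_prod_def[symmetric])
    qed
  qed simp
  finally have "real N *\<^sub>R f 0 = (\<Sum>j<N. f (\<omega> j))" by (simp add: f0)
  then have "real N * nrm (f 0) \<le> (\<Sum>j<N. nrm (f (\<omega> j)))"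
    using nrm_sum[of "\<lambda>j. f (\<omega> j)" "{..<N}"] nrm_scaleR[of "real N" "f 0"] by simp
  also have "\<dots> \<le> (\<Sum>j<N. r)" by (intro sum_mono bound) (simp add: \<omega>_def)
  finally show ?thesis by (simp add: N_def)
qed

section \<open>Blaschke factors and contractivity of quadratic operators\<close>

lemma calg_mult4:
  assumes "calg C" "a \<in> C" "b \<in> C" "c \<in> C" "d \<in> C"
  shows "(a \<odot> b) \<odot> (c \<odot> d) = (a \<odot> c) \<odot> (b \<odot> d)"
proof -
  have "(a \<odot> b) \<odot> (c \<odot> d) = a \<odot> (b \<odot> (c \<odot> d))"
    using assms by (intro calg_assoc calg_intros)
  also have "b \<odot> (c \<odot> d) = c \<odot> (b \<odot> d)" using assms by (intro calg_swap)
  also have "a \<odot> (c \<odot> (b \<odot> d)) = (a \<odot> c) \<odot> (b \<odot> d)"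
    using assms by (intro calg_assoc[symmetric] calg_intros)
  finally show ?thesis .
qed

text \<open>Partial sums of the geometric series for the inverse of 1 - q w. Truncation keeps
  everything polynomial in \<open>w\<close>, as the mean value property requires.\<close>

primrec geo :: "nat \<Rightarrow> 'a \<times> complex \<Rightarrow> complex \<Rightarrow> 'a \<times> complex" where
  "geo 0 q w = 0"
| "geo (Suc n) q w = one + cs w \<odot> (q \<odot> geo n q w)"

text \<open>A truncation of the Blaschke factor \<open>(w - q) / (1 - q w)\<close>, which is unitary for \<open>|w| = 1\<close>.\<close>

definition blaschke :: "nat \<Rightarrow> 'a \<times> complex \<Rightarrow> complex \<Rightarrow> 'a \<times> complex" where
  "blaschke n q w = (cs w - q) \<odot> geo n q w"

lemma pol_blaschke: "pol (blaschke n q)"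
proof -
  have "pol (geo n q)"
    by (induction n) (auto intro!: pol.intros pol_umul)
  moreover have "pol cs" using pol.shift[OF pol.const[of one]] by simp
  ultimately show ?thesis
    unfolding blaschke_def by (intro pol_umul pol_diff pol.const)
qed

lemma geo_in: "calg C \<Longrightarrow> q \<in> C \<Longrightarrow> geo n q w \<in> C"
  by (induction n) (auto intro!: calg_intros)

lemma geo_eq:
  assumes "calg C" "q \<in> C"
  shows "(one - cs w \<odot> q) \<odot> geo n q w = one - cs (w ^ n) \<odot> ext.jpower q n"
proof (induction n)
  case 0
  show ?case by (simp add: cs_one ext.unit)
next
  case (Suc n)
  let ?P = "cs (w ^ n) \<odot> ext.jpower q n" and ?g = "geo n q w"
  have sw: "(one - cs w \<odot> q) \<odot> (q \<odot> ?g) = q \<odot> ((one - cs w \<odot> q) \<odot> ?g)"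
    using assms by (intro calg_swap calg_intros geo_in)
  have "(one - cs w \<odot> q) \<odot> geo (Suc n) q w
      = (one - cs w \<odot> q) + cs w \<odot> ((one - cs w \<odot> q) \<odot> (q \<odot> ?g))"
    unfolding geo.simps ext.add_right cs_umul(2)[of "one - cs w \<odot> q"] by simp
  also have "\<dots> = one - cs w \<odot> q + cs w \<odot> (q \<odot> (one - ?P))"
    unfolding sw Suc ..
  also have "\<dots> = one - cs w \<odot> (cs (w ^ n) \<odot> (q \<odot> ext.jpower q n))"
    by (simp add: ext.distribs cs_umul(2)[of q])
  also have "\<dots> = one - cs (w ^ Suc n) \<odot> ext.jpower q (Suc n)"
    by (simp add: cs_umul(1) flip: cs_mult)
  finally show ?case .
qed

lemma st_geo: "st q = q \<Longrightarrow> st (geo n q w) = geo n q (cnj w)"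
  by (induction n) (simp_all add: st_add st_umul st_cs st_one, simp add: prod_eq_iff)

text \<open>On the circle \<open>w * cnj w = 1\<close> makes the two numerators multiply to the same
  product as the two denominators; the truncated series then leave the unit up to n-th powers of
  \<open>q\<close>.\<close>

lemma blaschke_unitary:
  assumes C: "calg C" "q \<in> C" "q \<in> sa" and w: "cmod w = 1"
  shows "blaschke n q w \<odot> st (blaschke n q w)
    = (one - cs (w ^ n) \<odot> ext.jpower q n) \<odot> (one - cs (cnj w ^ n) \<odot> ext.jpower q n)"
proof -
  have q: "st q = q" using C by (simp add: sa_def)
  have ww: "w * cnj w = 1" using w by (simp add: complex_norm_square[symmetric])
  have inC: "cs w - q \<in> C" "cs (cnj w) - q \<in> C" "geo n q w \<in> C" "geo n q (cnj w) \<in> C"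
    "one - cs w \<odot> q \<in> C" "one - cs (cnj w) \<odot> q \<in> C"
    using C by (auto intro!: calg_intros geo_in)
  have "(cs w - q) \<odot> (cs (cnj w) - q) = cs (w * cnj w) - cs w \<odot> q - cs (cnj w) \<odot> q + q \<odot> q"
    by (simp add: ext.distribs cs_mult ext.commute[of q "cs (cnj w)"])
  moreover have "(one - cs w \<odot> q) \<odot> (one - cs (cnj w) \<odot> q)
      = one - cs w \<odot> q - cs (cnj w) \<odot> q + cs (w * cnj w) \<odot> (q \<odot> q)"
    unfolding ext.distribs cs_umul(1) cs_umul(2)[of q] cs_mult[symmetric]
    by (simp add: ext.unit)
  ultimately have e: "(cs w - q) \<odot> (cs (cnj w) - q) = (one - cs w \<odot> q) \<odot> (one - cs (cnj w) \<odot> q)"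
    by (simp add: ww cs_one ext.unit)
  have "blaschke n q w \<odot> st (blaschke n q w)
     = ((cs w - q) \<odot> geo n q w) \<odot> ((cs (cnj w) - q) \<odot> geo n q (cnj w))"
    by (simp add: blaschke_def st_umul st_diff st_cs q st_geo)
  also have "\<dots> = ((cs w - q) \<odot> (cs (cnj w) - q)) \<odot> (geo n q w \<odot> geo n q (cnj w))"
    by (rule calg_mult4[OF C(1)]) (intro inC)+
  also have "\<dots> = ((one - cs w \<odot> q) \<odot> geo n q w) \<odot> ((one - cs (cnj w) \<odot> q) \<odot> geo n q (cnj w))"
    unfolding e by (rule calg_mult4[OF C(1)]) (intro inC)+
  finally show ?thesis by (simp add: geo_eq[OF C(1,2)])
qed

lemma U_one_plus: "ext.U (one + s) x = x + 2 *\<^sub>R (s \<odot> x) + ext.U s x"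
  by (simp add: ext.U_alt ext.distribs ext.unit scaleR_2 scaleR_add_right algebra_simps)

lemma nrm_U_one_plus:
  assumes "nrm s \<le> \<sigma>"
  shows "nrm (ext.U (one + s) x - x) \<le> (2 * \<sigma> + 3 * \<sigma> * \<sigma>) * nrm x"
proof -
  have 0: "0 \<le> \<sigma>" using assms nrm_ge_0 order_trans by blast
  have "nrm (ext.U (one + s) x - x) \<le> nrm (2 *\<^sub>R (s \<odot> x)) + nrm (ext.U s x)"
    using nrm_add[of "2 *\<^sub>R (s \<odot> x)" "ext.U s x"] by (simp add: U_one_plus)
  also have "\<dots> \<le> 2 * (nrm s * nrm x) + 3 * nrm s * nrm x * nrm s"
    using nrm_umul[of s x] nrm_trip[of s x s] by (simp add: nrm_scaleR)
  also have "\<dots> \<le> 2 * (\<sigma> * nrm x) + 3 * \<sigma> * nrm x * \<sigma>"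
    by (intro add_mono mult_mono assms order_refl) (auto simp: 0)
  finally show ?thesis by (simp add: algebra_simps)
qed

text \<open>By the mean value property in \<open>w\<close>, the operator \<open>U\<close> at \<open>q = - blaschke n q 0\<close> is an average
  of almost isometric operators.\<close>

lemma U_contraction:
  assumes C: "calg C" and c: "c \<in> C" "c \<in> sa" and b: "bdd C 1 c" and x: "snd x = 0"
  shows "nrm (ext.U c x) \<le> nrm x"
proof -
  \<comment> \<open>Shrinking \<open>c\<close> by \<rho> < 1 makes the powers of \<open>q\<close>,
    and hence the truncation error, tend to 0.\<close>
  have *: "(\<rho>^2 * nrm (ext.U c x))^2 \<le> nrm x ^ 2" if \<rho>: "0 < \<rho>" "\<rho> < 1" for \<rho> :: real
  proof -
    define q where "q = \<rho> *\<^sub>R c"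
    have q: "q \<in> C" "q \<in> sa" using C c by (auto simp: q_def intro: calg_intros sa_scaleR)
    have bq: "bdd C \<rho> q" using bdd_scaleR[OF b, of \<rho>] \<rho> by (simp add: q_def)
    have sa_pow: "ext.jpower q n \<in> sa" for n
      by (induction n) (auto intro: sa_one sa_umul q)
    have nq: "nrm (ext.jpower q n) \<le> 3 * \<rho> ^ n" for n
      by (rule nrm_le_bdd[OF C calg_jpower[OF C q(1)] sa_pow bdd_jpower[OF C q(1) bq]])
    \<comment> \<open>\<open>\<sigma> n\<close> bounds \<open>?a \<odot> ?b - ?a - ?b\<close> below,
      where both factors have norm at most 3 \<rho>^n; \<open>\<delta> n\<close> is what
      \<open>nrm_U_one_plus\<close> makes of it.\<close>
    define \<sigma> where "\<sigma> n = 6 * \<rho>^n + 9 * \<rho>^n * \<rho>^n" for n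
    define \<delta> where "\<delta> n = 2 * \<sigma> n + 3 * \<sigma> n * \<sigma> n" for n
    have \<delta>0: "0 \<le> \<delta> n" for n using \<rho> by (auto simp: \<delta>_def \<sigma>_def)
    have \<rho>0: "(\<lambda>n. \<rho> ^ n) \<longlonglongrightarrow> 0" using \<rho> by (intro LIMSEQ_realpow_zero) auto
    have "\<sigma> \<longlonglongrightarrow> 6 * 0 + 9 * 0 * 0" unfolding \<sigma>_def by (intro tendsto_intros \<rho>0)
    then have "\<sigma> \<longlonglongrightarrow> 0" by simp
    then have "(\<lambda>n. (1 + 9 * \<delta> n) * nrm x ^ 2) \<longlonglongrightarrow> (1 + 9 * (2 * 0 + 3 * 0 * 0)) * nrm x ^ 2"
      unfolding \<delta>_def by (intro tendsto_intros)
    then have lim: "(\<lambda>n. (1 + 9 * \<delta> n) * nrm x ^ 2) \<longlonglongrightarrow> nrm x ^ 2" by simp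
    have le: "(\<rho>^2 * nrm (ext.U c x))^2 \<le> (1 + 9 * \<delta> n) * nrm x ^ 2" if n: "n \<ge> 1" for n
    proof -
      have near: "nrm (ext.U (blaschke n q w) x) \<le> sqrt ((1 + 9 * \<delta> n) * nrm x ^ 2)"
        if w: "cmod w = 1" for w
      proof -
        let ?Q = "ext.jpower q n"
        let ?a = "cs (w ^ n) \<odot> ?Q" and ?b = "cs (cnj w ^ n) \<odot> ?Q"
        define s where "s = ?a \<odot> ?b - ?a - ?b"
        have ab: "nrm ?a \<le> 3 * \<rho> ^ n" "nrm ?b \<le> 3 * \<rho> ^ n"
          using nq[of n] w by (simp_all add: nrm_cs_umul norm_power)
        have "nrm s \<le> nrm (?a \<odot> ?b) + nrm ?a + nrm ?b"
          unfolding s_def using nrm_diff[of "?a \<odot> ?b - ?a" ?b] nrm_diff[of "?a \<odot> ?b" ?a] by linarith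
        also have "nrm (?a \<odot> ?b) \<le> (3 * \<rho> ^ n) * (3 * \<rho> ^ n)"
          by (rule order_trans[OF nrm_umul]) (use ab \<rho> in \<open>intro mult_mono; simp\<close>)
        finally have "nrm s \<le> (3 * \<rho> ^ n) * (3 * \<rho> ^ n) + 3 * \<rho> ^ n + 3 * \<rho> ^ n" using ab by linarith
        then have s: "nrm s \<le> \<sigma> n" by (simp add: \<sigma>_def algebra_simps)
        have eq: "blaschke n q w \<odot> st (blaschke n q w) = one + s"
          unfolding blaschke_unitary[OF C q w] s_def by (simp add: ext.distribs ext.unit algebra_simps)
        have "nrm (ext.U (blaschke n q w) x) ^ 2 \<le> (1 + 9 * \<delta> n) * nrm x ^ 2"
        proof (rule U_near_isometry[OF C _ \<delta>0 _ x])
          show "blaschke n q w \<in> C" unfolding blaschke_def using C q by (intro calg_intros geo_in)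
          show "nrm (ext.U (blaschke n q w \<odot> st (blaschke n q w)) y - y) \<le> \<delta> n * nrm y" for y
            unfolding eq \<delta>_def by (rule nrm_U_one_plus[OF s])
        qed
        then show ?thesis by (rule real_le_rsqrt)
      qed
      have "pol (\<lambda>w. ext.U (blaschke n q w) x)"
        unfolding ext.trip_def by (intro pol_umul pol.const pol_blaschke pol_diff pol.add)
      then have 1: "nrm (ext.U (blaschke n q 0) x) \<le> sqrt ((1 + 9 * \<delta> n) * nrm x ^ 2)"
        by (rule pol_mean_value) (rule near)
      \<comment> \<open>For n \<ge> 1 the geometric sum at w = 0 is \<open>one\<close>, so the
        factor takes the value - q at the origin.\<close>
      obtain m where m: "n = Suc m" using n by (cases n) auto
      have "cs 0 \<odot> y = 0" for y by (simp add: prod_eq_iff)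
      moreover have "cs 0 = 0" by (simp add: prod_eq_iff)
      ultimately have "blaschke n q 0 = (- \<rho>) *\<^sub>R c"
        by (simp add: m blaschke_def q_def ext.unit)
      then have "ext.U (blaschke n q 0) x = \<rho>^2 *\<^sub>R ext.U c x"
        by (simp add: ext.trip_linear power2_eq_square del: scaleR_minus_left)
      then have "\<rho>^2 * nrm (ext.U c x) \<le> sqrt ((1 + 9 * \<delta> n) * nrm x ^ 2)"
        using 1 by (simp add: nrm_scaleR)
      then have "(\<rho>^2 * nrm (ext.U c x))^2 \<le> (sqrt ((1 + 9 * \<delta> n) * nrm x ^ 2))^2"
        by (intro power_mono) auto
      then show ?thesis using \<delta>0 by simp
    qed
    show ?thesis
      by (rule LIMSEQ_le_const[OF lim]) (use le in blast)
  qed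
  have "(\<lambda>n. ((1 - inverse (real (Suc (Suc n))))^2 * nrm (ext.U c x))^2)
      \<longlonglongrightarrow> ((1 - 0)^2 * nrm (ext.U c x))^2"
    by (intro tendsto_intros LIMSEQ_Suc[OF LIMSEQ_inverse_real_of_nat])
  then have "((1 - 0)^2 * nrm (ext.U c x))^2 \<le> nrm x ^ 2"
  proof (rule LIMSEQ_le_const2, intro exI allI impI)
    fix n
    show "((1 - inverse (real (Suc (Suc n))))^2 * nrm (ext.U c x))^2 \<le> nrm x ^ 2"
      by (rule *) (simp_all add: field_simps)
  qed
  then show ?thesis by (simp add: power2_le_iff_abs_le)
qed

text \<open>With L the multiplication by \<open>x\<close> on the ideal of scalar part 0, the norm of
  1 - tL has nonpositive right derivative at t = 0. The form with \<epsilon> absorbs errors of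
  second order in \<open>t\<close>.\<close>

definition dissipative :: "'a \<times> complex \<Rightarrow> bool" where
  "dissipative x \<longleftrightarrow> (\<forall>\<epsilon>>0. \<exists>t0>0. \<forall>t. 0 < t \<and> t < t0 \<longrightarrow>
     (\<forall>g. snd g = 0 \<longrightarrow> nrm (g - t *\<^sub>R (x \<odot> g)) \<le> (1 + \<epsilon> * t) * nrm g))"

lemma dissipativeE:
  assumes "dissipative x" "0 < \<epsilon>"
  obtains t0 where "0 < t0" "\<And>t g. 0 < t \<Longrightarrow> t < t0 \<Longrightarrow> snd g = 0 \<Longrightarrow>
    nrm (g - t *\<^sub>R (x \<odot> g)) \<le> (1 + \<epsilon> * t) * nrm g"
proof -
  obtain t0 where t0: "0 < t0" and t: "\<forall>t. 0 < t \<and> t < t0 \<longrightarrow>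
     (\<forall>g. snd g = 0 \<longrightarrow> nrm (g - t *\<^sub>R (x \<odot> g)) \<le> (1 + \<epsilon> * t) * nrm g)"
    using assms(1)[unfolded dissipative_def, rule_format, OF assms(2)] by (elim exE conjE)
  show thesis
    by (rule that[OF t0]) (rule t[rule_format], simp_all)
qed

definition pos :: "('a \<times> complex) set" where
  "pos = {k \<odot> k |k. k \<in> sa}"

text \<open>Squares turn out to be exactly the self-adjoint elements whose multiplication operator
  generates a contraction semigroup on the algebra. The latter condition is visibly stable under
  sums and limits.\<close>

definition dcone :: "('a \<times> complex) set" where
  "dcone = {x \<in> sa. 0 \<le> Re (snd x) \<and> dissipative x}"

text \<open>For h = sqrt (t/2) k, \<open>U\<close> of \<open>one - h \<odot> h\<close> is a
  contraction. It sends \<open>g\<close> to g - t k^2 g plus a term of order t^2; the factor 1/2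
  under the root makes the linear coefficient exactly \<open>t\<close>.\<close>

lemma square_dissipative:
  assumes k: "k \<in> sa"
  shows "dissipative (k \<odot> k)"
  unfolding dissipative_def
proof (intro allI impI)
  fix \<epsilon> :: real assume \<epsilon>: "0 < \<epsilon>"
  obtain C where C: "calg C" "k \<in> C" using ex_calg[OF k] .
  define r where "r = nrm k"
  have r0: "0 \<le> r" by (simp add: r_def)
  \<comment> \<open>The first bound keeps \<open>h\<close> in the unit ball, the second makes the
    quadratic remainder at most \<open>\<epsilon> * t * nrm g\<close>.\<close>
  define t0 where "t0 = min (1 / (r^2 + 1)) (\<epsilon> / (r^4 + 1))"
  have pos: "0 < r^2 + 1" "0 < r^4 + 1"
    by (auto intro: add_nonneg_pos)
  show "\<exists>t0>0. \<forall>t. 0 < t \<and> t < t0 \<longrightarrow>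
     (\<forall>g. snd g = 0 \<longrightarrow> nrm (g - t *\<^sub>R (k \<odot> k \<odot> g)) \<le> (1 + \<epsilon> * t) * nrm g)"
  proof (intro exI[of _ t0] conjI allI impI)
    show "0 < t0" using \<epsilon> pos by (simp add: t0_def)
    fix t and g :: "'a \<times> complex" assume t: "0 < t \<and> t < t0" and g: "snd g = 0"
    have t1: "t * (r^2 + 1) < 1" "t * (r^4 + 1) < \<epsilon>"
      using t pos by (auto simp: t0_def pos_less_divide_eq)
    define h where "h = sqrt (t/2) *\<^sub>R k"
    have h: "h \<in> C" "h \<in> sa" using C k by (auto simp: h_def intro: calg_intros sa_scaleR)
    have "t / 2 * r^2 \<le> 1" using t1(1) t by (simp add: algebra_simps)
    then have "sqrt (t / 2 * r^2) \<le> 1" unfolding real_sqrt_le_1_iff .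
    then have "\<bar>sqrt (t/2)\<bar> * r \<le> 1"
      unfolding real_sqrt_mult using t r0 by (simp only: real_sqrt_abs abs_of_nonneg real_sqrt_ge_zero) auto
    then have "bdd C 1 h"
      using bdd_mono[OF bdd_scaleR[OF bdd_nrm]] by (simp add: h_def r_def)
    then have b: "bdd C 1 (one - h \<odot> h)" using bdd_one_minus_square(1)[OF C(1) h] by simp
    have hh: "h \<odot> h = (t/2) *\<^sub>R (k \<odot> k)"
      using t by (simp add: h_def ext.distribs)
    have "nrm (ext.U (one - h \<odot> h) g) \<le> nrm g"
      using C h by (intro U_contraction[OF C(1) _ _ b g] calg_diff calg_one calg_umul sa_diff sa_one sa_umul)
    also have "ext.U (one - h \<odot> h) g = (g - t *\<^sub>R (k \<odot> k \<odot> g)) + (t/2)^2 *\<^sub>R ext.U (k \<odot> k) g"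
      using U_one_plus[of "- (h \<odot> h)" g]
      by (simp add: hh ext.distribs ext.U_alt power2_eq_square scaleR_diff_right)
    finally have 1: "nrm ((g - t *\<^sub>R (k \<odot> k \<odot> g)) + (t/2)^2 *\<^sub>R ext.U (k \<odot> k) g) \<le> nrm g" .
    have "nrm (ext.U (k \<odot> k) g) \<le> 3 * nrm (k \<odot> k) * nrm g * nrm (k \<odot> k)" by (rule nrm_trip)
    also have "\<dots> \<le> 3 * (r * r) * nrm g * (r * r)"
      using nrm_umul[of k k] by (intro mult_mono) (auto simp: r_def)
    finally have "nrm (ext.U (k \<odot> k) g) \<le> 3 * r^4 * nrm g"
      by (simp add: power4_eq_xxxx algebra_simps)
    then have "(t/2)^2 * nrm (ext.U (k \<odot> k) g) \<le> (t/2)^2 * (3 * r^4 * nrm g)"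
      by (intro mult_left_mono) auto
    also have "\<dots> \<le> \<epsilon> * t * nrm g"
    proof -
      have "(t/2)^2 * (3 * r^4) = (3/4) * t * (t * r^4)" by (simp add: power2_eq_square field_simps)
      also have "\<dots> \<le> 1 * t * \<epsilon>"
        using t t1(2) by (intro mult_mono) (auto simp: algebra_simps)
      finally have "(t/2)^2 * (3 * r^4) * nrm g \<le> (1 * t * \<epsilon>) * nrm g" by (rule mult_right_mono) simp
      then show ?thesis by (simp add: algebra_simps)
    qed
    finally have 2: "nrm ((t/2)^2 *\<^sub>R ext.U (k \<odot> k) g) \<le> \<epsilon> * t * nrm g" by (simp add: nrm_scaleR)
    have "nrm (g - t *\<^sub>R (k \<odot> k \<odot> g)) \<le>
        nrm ((g - t *\<^sub>R (k \<odot> k \<odot> g)) + (t/2)^2 *\<^sub>R ext.U (k \<odot> k) g) + nrm ((t/2)^2 *\<^sub>R ext.U (k \<odot> k) g)"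
      using nrm_diff[of "(g - t *\<^sub>R (k \<odot> k \<odot> g)) + (t/2)^2 *\<^sub>R ext.U (k \<odot> k) g" "(t/2)^2 *\<^sub>R ext.U (k \<odot> k) g"]
      by simp
    then show "nrm (g - t *\<^sub>R (k \<odot> k \<odot> g)) \<le> (1 + \<epsilon> * t) * nrm g"
      using 1 2 by (simp add: algebra_simps)
  qed
qed

lemma pos_subset_dcone: "pos \<subseteq> dcone"
proof
  fix x assume "x \<in> pos"
  then obtain k where k: "x = k \<odot> k" "k \<in> sa" by (auto simp: pos_def)
  then have "snd k \<in> \<real>" by (simp add: sa_iff)
  then have "0 \<le> Re (snd x)" using k by (auto elim!: Reals_cases)
  with k show "x \<in> dcone" by (simp add: dcone_def sa_umul square_dissipative)
qed

text \<open>The identity 1 - 2\<tau>y = (1 - \<tau>y)^2 - (\<tau>y)^2 = R^2 (c^2 - d^2) holds with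
  \<open>c\<close>, \<open>d\<close> in the unit ball. Since c^2 - d^2 is half the difference of 1 -
  2d^2 and 1 - 2c^2, both bounded by 1, no additive loss occurs, unlike in the triangle
  inequality.\<close>

lemma bdd_doubling:
  assumes C: "calg C" and y: "y \<in> C" "y \<in> sa" "bdd C 1 y"
    and R: "1 \<le> R" and \<tau>: "0 \<le> \<tau>" "\<tau> \<le> 1" and b: "bdd C R (one - \<tau> *\<^sub>R y)"
  shows "bdd C (R^2) (one - (2 * \<tau>) *\<^sub>R y)"
proof -
  define c d where "c = (1/R) *\<^sub>R (one - \<tau> *\<^sub>R y)" and "d = (\<tau>/R) *\<^sub>R y"
  have in': "c \<in> C" "c \<in> sa" "d \<in> C" "d \<in> sa"
    using C y by (auto simp: c_def d_def intro!: calg_intros sa_scaleR sa_diff sa_one)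
  have "bdd C 1 c" using bdd_scaleR[OF b, of "1/R"] R by (simp add: c_def)
  moreover have "bdd C 1 d"
    using bdd_mono[OF bdd_scaleR[OF y(3), of "\<tau>/R"], of 1] R \<tau> by (simp add: d_def divide_le_eq)
  ultimately have "bdd C (1 + 1) ((one - 2 *\<^sub>R (d \<odot> d)) - (one - 2 *\<^sub>R (c \<odot> c)))"
    by (intro bdd_diff bdd_one_minus_square[OF C] in')
  from bdd_scaleR[OF this, of "R^2/2"]
  have 1: "bdd C (R^2) ((R^2/2) *\<^sub>R ((one - 2 *\<^sub>R (d \<odot> d)) - (one - 2 *\<^sub>R (c \<odot> c))))" by simp
  have "R^2 *\<^sub>R (c \<odot> c) = (one - \<tau> *\<^sub>R y) \<odot> (one - \<tau> *\<^sub>R y)" "R^2 *\<^sub>R (d \<odot> d) = \<tau>^2 *\<^sub>R (y \<odot> y)"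
    using R by (simp_all add: c_def d_def ext.scaleR_left ext.scaleR_right power2_eq_square)
  then have "(R^2/2) *\<^sub>R ((one - 2 *\<^sub>R (d \<odot> d)) - (one - 2 *\<^sub>R (c \<odot> c)))
      = (one - \<tau> *\<^sub>R y) \<odot> (one - \<tau> *\<^sub>R y) - \<tau>^2 *\<^sub>R (y \<odot> y)"
    by (simp add: scaleR_diff_right)
  also have "\<dots> = one - (2 * \<tau>) *\<^sub>R y"
  proof -
    have "(2 * \<tau>) *\<^sub>R y = \<tau> *\<^sub>R y + \<tau> *\<^sub>R y" by (simp flip: scaleR_left_distrib)
    then show ?thesis by (simp add: ext.distribs ext.unit power2_eq_square scaleR_diff_right)
  qed
  finally show ?thesis using 1 by simp
qed

text \<open>Dissipativity gives the bound 1 + \<epsilon>\<tau> for 1 - \<tau>y at a small \<tau> =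
  2^(-m). After m doublings \<tau> has become 1, with bound (1 + \<epsilon>\<tau>)^(2^m) \<le>
  e^\<epsilon>; finally \<epsilon> tends to 0.\<close>

lemma bdd_dcone:
  assumes x: "x \<in> dcone" and r: "nrm x \<le> r" "0 < r" and C: "calg C" "x \<in> C"
  shows "bdd C 1 (one - (1/r) *\<^sub>R x)"
proof -
  define y where "y = (1/r) *\<^sub>R x"
  have y: "y \<in> C" "y \<in> sa" using C x by (auto simp: y_def dcone_def intro: calg_intros sa_scaleR)
  have y1: "bdd C 1 y"
    by (rule bdd_mono[OF bdd_nrm]) (use r in \<open>simp add: y_def nrm_scaleR\<close>)
  have main: "bdd C (exp \<epsilon>) (one - y)" if \<epsilon>: "0 < \<epsilon>" for \<epsilon>
  proof -
    have "0 < r * \<epsilon>" using r \<epsilon> by simp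
    moreover have "dissipative x" using x by (simp add: dcone_def)
    ultimately obtain t0 where t0: "0 < t0" and
      dis: "\<And>t g. 0 < t \<Longrightarrow> t < t0 \<Longrightarrow> snd g = 0 \<Longrightarrow> nrm (g - t *\<^sub>R (x \<odot> g)) \<le> (1 + r * \<epsilon> * t) * nrm g"
      using dissipativeE by metis
    have "0 < t0 * r" using t0 r by simp
    then obtain m where m: "(1/2::real) ^ m < t0 * r"
      using real_arch_pow_inv[of "t0 * r" "1/2"] by auto
    define \<tau> where "\<tau> = (1/2::real) ^ m"
    have \<tau>: "0 < \<tau>" "\<tau> \<le> 1" by (auto simp: \<tau>_def power_le_one)
    define R where "R = 1 + \<epsilon> * \<tau>"
    have R: "1 \<le> R" using \<epsilon> \<tau> by (simp add: R_def)
    have base: "bdd C R (one - \<tau> *\<^sub>R y)"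
      unfolding bdd_def
    proof (intro conjI ballI impI)
      have "snd y \<in> \<real>" using y by (simp add: sa_iff)
      then obtain l where l: "snd y = of_real l" by (auto elim: Reals_cases)
      have "0 \<le> l" using x r arg_cong[OF l, of Re] by (auto simp: dcone_def y_def)
      moreover have "l \<le> 1" using y1 l by (auto simp: bdd_def)
      ultimately have "0 \<le> \<tau> * l" "\<tau> * l \<le> 1" using \<tau> mult_mono[of \<tau> 1 l 1] by auto
      then have "\<bar>1 - \<tau> * l\<bar> \<le> 1" by simp
      moreover have "snd (one - \<tau> *\<^sub>R y) = of_real (1 - \<tau> * l)"
        by (simp add: l scaleR_conv_of_real)
      ultimately show "cmod (snd (one - \<tau> *\<^sub>R y)) \<le> R"
        using R by (simp only: norm_of_real)
      fix g assume g: "g \<in> C" "snd g = 0"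
      have "nrm (g - (\<tau>/r) *\<^sub>R (x \<odot> g)) \<le> (1 + r * \<epsilon> * (\<tau>/r)) * nrm g"
        using \<tau> r m g by (intro dis) (auto simp: \<tau>_def pos_divide_less_eq)
      then show "nrm ((one - \<tau> *\<^sub>R y) \<odot> g) \<le> R * nrm g"
        using r by (simp add: ext.distribs ext.unit y_def R_def)
    qed
    have step: "bdd C (R ^ (2 ^ j)) (one - (2 ^ j * \<tau>) *\<^sub>R y)" if "j \<le> m" for j
      using that
    proof (induction j)
      case 0
      show ?case using base by simp
    next
      case (Suc j)
      have "2 ^ j * \<tau> \<le> 2 ^ m * \<tau>" using Suc.prems \<tau> by (intro mult_right_mono power_increasing) auto
      also have "\<dots> = 1" by (simp add: \<tau>_def power_one_over)
      finally have "bdd C ((R ^ (2 ^ j))\<^sup>2) (one - (2 * (2 ^ j * \<tau>)) *\<^sub>R y)"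
        using Suc R \<tau> by (intro bdd_doubling[OF C(1) y y1]) auto
      then show ?case by (simp add: power_mult[symmetric] mult.commute[of _ 2] mult.assoc)
    qed
    have "bdd C (R ^ (2 ^ m)) (one - y)"
      using step[of m] by (simp add: \<tau>_def power_one_over)
    moreover have "R ^ (2 ^ m) \<le> exp \<epsilon>"
    proof -
      have "R ^ (2 ^ m) \<le> exp (\<epsilon> * \<tau>) ^ (2 ^ m)"
        unfolding R_def using \<epsilon> \<tau> by (intro power_mono exp_ge_add_one_self) auto
      also have "\<dots> = exp (real (2 ^ m) * (\<epsilon> * \<tau>))" by (rule exp_of_nat_mult[symmetric])
      also have "real (2 ^ m) * (\<epsilon> * \<tau>) = \<epsilon>" by (simp add: \<tau>_def power_one_over)
      finally show ?thesis .
    qed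
    ultimately show ?thesis by (rule bdd_mono)
  qed
  have lim: "(\<lambda>n. exp (inverse (real (Suc n))) * z) \<longlonglongrightarrow> 1 * z" for z
    using tendsto_mult[OF tendsto_exp[OF LIMSEQ_inverse_real_of_nat] tendsto_const] by simp
  have main': "bdd C (exp (inverse (real (Suc n)))) (one - y)" for n by (rule main) simp
  have "bdd C 1 (one - y)"
    unfolding bdd_def
  proof (intro conjI ballI impI)
    show "cmod (snd (one - y)) \<le> 1"
      using LIMSEQ_le_const[OF lim[of 1]] main' by (auto simp: bdd_def)
    fix g assume g: "g \<in> C" "snd g = 0"
    show "nrm ((one - y) \<odot> g) \<le> 1 * nrm g"
      by (rule LIMSEQ_le_const[OF lim[of "nrm g"]]) (use main' g in \<open>auto simp: bdd_def\<close>)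
  qed
  then show ?thesis by (simp add: y_def)
qed

lemma dcone_root:
  assumes x: "x \<in> dcone" and C: "calg C" "x \<in> C"
  shows "\<exists>y\<in>C \<inter> sa. y \<odot> y = x"
proof -
  define r where "r = nrm x + 1"
  have r: "nrm x \<le> r" "0 < r" by (auto simp: r_def add_nonneg_pos)
  define v where "v = one - (1/r) *\<^sub>R x"
  have v: "v \<in> C" "v \<in> sa" "bdd C 1 v"
    using C x bdd_dcone[OF x r C] by (auto simp: v_def dcone_def intro!: calg_intros sa_diff sa_one sa_scaleR)
  define y where "y = sqrt r *\<^sub>R (one - rt v)"
  have "y \<in> C" "y \<in> sa"
    using rt_props[OF C(1) v] C(1) by (auto simp: y_def intro!: calg_intros sa_diff sa_one sa_scaleR)
  moreover have "y \<odot> y = x"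
    using rt_eq[OF C(1) v] r by (simp add: y_def ext.scaleR_left ext.scaleR_right v_def)
  ultimately show ?thesis by blast
qed

lemma pos_eq_dcone: "pos = dcone"
proof
  show "dcone \<subseteq> pos"
  proof
    fix x assume x: "x \<in> dcone"
    then obtain C where "calg C" "x \<in> C" using ex_calg[of x] by (auto simp: dcone_def)
    then show "x \<in> pos" using dcone_root[OF x] unfolding pos_def by blast
  qed
qed (rule pos_subset_dcone)

section \<open>Stability properties of the cone of squares\<close>

lemma pos_sa: "x \<in> pos \<Longrightarrow> x \<in> sa"
  by (simp add: pos_eq_dcone dcone_def)

lemma pos_root: "x \<in> pos \<Longrightarrow> calg C \<Longrightarrow> x \<in> C \<Longrightarrow> \<exists>y\<in>C \<inter> sa. y \<odot> y = x"
  using dcone_root by (simp add: pos_eq_dcone)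

lemma square_pos: "k \<in> sa \<Longrightarrow> k \<odot> k \<in> pos"
  unfolding pos_def by blast

lemma pos_scaleR:
  assumes "x \<in> pos" "0 \<le> r"
  shows "r *\<^sub>R x \<in> pos"
proof -
  obtain k where k: "x = k \<odot> k" "k \<in> sa" using assms unfolding pos_def by blast
  have "(sqrt r *\<^sub>R k) \<odot> (sqrt r *\<^sub>R k) = r *\<^sub>R x"
    using assms by (simp add: k ext.scaleR_left ext.scaleR_right)
  then show ?thesis using square_pos[OF sa_scaleR[OF k(2)], of "sqrt r"] by simp
qed

lemma pos_add:
  assumes "x \<in> pos" "y \<in> pos"
  shows "x + y \<in> pos"
proof -
  have "dissipative (x + y)"
    unfolding dissipative_def
  proof (intro allI impI)
    fix \<epsilon> :: real assume "0 < \<epsilon>"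
    then have e2: "0 < \<epsilon>/2" by simp
    have "dissipative x" "dissipative y" using assms by (simp_all add: pos_eq_dcone dcone_def)
    then obtain s t where s: "0 < s" "\<And>u g. 0 < u \<Longrightarrow> u < s \<Longrightarrow> snd g = 0 \<Longrightarrow> nrm (g - u *\<^sub>R (x \<odot> g)) \<le> (1 + \<epsilon>/2 * u) * nrm g"
      and t: "0 < t" "\<And>u g. 0 < u \<Longrightarrow> u < t \<Longrightarrow> snd g = 0 \<Longrightarrow> nrm (g - u *\<^sub>R (y \<odot> g)) \<le> (1 + \<epsilon>/2 * u) * nrm g"
      using dissipativeE[OF _ e2] by metis
    show "\<exists>t0>0. \<forall>u. 0 < u \<and> u < t0 \<longrightarrow>
       (\<forall>g. snd g = 0 \<longrightarrow> nrm (g - u *\<^sub>R ((x + y) \<odot> g)) \<le> (1 + \<epsilon> * u) * nrm g)"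
    proof (intro exI[of _ "min s t / 2"] conjI allI impI)
      show "0 < min s t / 2" using s t by simp
      fix u and g :: "'a \<times> complex" assume u: "0 < u \<and> u < min s t / 2" and g: "snd g = 0"
      \<comment> \<open>The step for the sum is the average of the two separate steps of doubled
        length, which is why \<open>u\<close> stays below half of both thresholds.\<close>
      have e: "g - u *\<^sub>R ((x + y) \<odot> g) = (1/2) *\<^sub>R ((g - (2 * u) *\<^sub>R (x \<odot> g)) + (g - (2 * u) *\<^sub>R (y \<odot> g)))"
        by (simp add: ext.distribs scaleR_add_right scaleR_diff_right flip: scaleR_add_left) 
      have "nrm ((g - (2 * u) *\<^sub>R (x \<odot> g)) + (g - (2 * u) *\<^sub>R (y \<odot> g)))
          \<le> (1 + \<epsilon>/2 * (2 * u)) * nrm g + (1 + \<epsilon>/2 * (2 * u)) * nrm g"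
        by (rule order_trans[OF nrm_add]) (use u g in \<open>intro add_mono s(2) t(2); simp\<close>)
      then show "nrm (g - u *\<^sub>R ((x + y) \<odot> g)) \<le> (1 + \<epsilon> * u) * nrm g"
        unfolding e nrm_scaleR by (simp add: algebra_simps)
    qed
  qed
  with assms show ?thesis by (simp add: pos_eq_dcone dcone_def sa_add)
qed

lemma dissipative_closed:
  assumes "\<And>\<epsilon>. 0 < \<epsilon> \<Longrightarrow> \<exists>y. dissipative y \<and> nrm (x - y) < \<epsilon>"
  shows "dissipative x"
  unfolding dissipative_def
proof (intro allI impI)
  fix \<epsilon> :: real assume "0 < \<epsilon>"
  then have e: "0 < \<epsilon>/2" by simp
  obtain y where y: "dissipative y" "nrm (x - y) < \<epsilon>/2" using assms[OF e] by blast
  then obtain t where t: "0 < t" "\<And>u g. 0 < u \<Longrightarrow> u < t \<Longrightarrow> snd g = 0 \<Longrightarrow> nrm (g - u *\<^sub>R (y \<odot> g)) \<le> (1 + \<epsilon>/2 * u) * nrm g"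
    using dissipativeE[OF _ e] by metis
  show "\<exists>t0>0. \<forall>u. 0 < u \<and> u < t0 \<longrightarrow>
       (\<forall>g. snd g = 0 \<longrightarrow> nrm (g - u *\<^sub>R (x \<odot> g)) \<le> (1 + \<epsilon> * u) * nrm g)"
  proof (intro exI[of _ t] conjI allI impI)
    fix u and g :: "'a \<times> complex" assume u: "0 < u \<and> u < t" and g: "snd g = 0"
    have "nrm (g - u *\<^sub>R (x \<odot> g)) = nrm ((g - u *\<^sub>R (y \<odot> g)) - u *\<^sub>R ((x - y) \<odot> g))"
      by (simp add: ext.distribs scaleR_diff_right)
    also have "\<dots> \<le> (1 + \<epsilon>/2 * u) * nrm g + u * (\<epsilon>/2 * nrm g)"
    proof (rule order_trans[OF nrm_diff], rule add_mono)
      show "nrm (g - u *\<^sub>R (y \<odot> g)) \<le> (1 + \<epsilon>/2 * u) * nrm g" using t u g by blast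
      have "nrm ((x - y) \<odot> g) \<le> nrm (x - y) * nrm g" by (rule nrm_umul)
      also have "\<dots> \<le> \<epsilon>/2 * nrm g" using y(2) by (intro mult_right_mono) auto
      finally show "nrm (u *\<^sub>R ((x - y) \<odot> g)) \<le> u * (\<epsilon>/2 * nrm g)"
        using u by (simp add: nrm_scaleR mult_left_mono)
    qed
    finally show "nrm (g - u *\<^sub>R (x \<odot> g)) \<le> (1 + \<epsilon> * u) * nrm g" by (simp add: algebra_simps)
  qed (rule t(1))
qed

lemma closed_pos: "closed pos"
  unfolding closed_sequential_limits
proof (intro allI impI, elim conjE)
  fix f x assume f: "\<forall>n. f n \<in> pos" and l: "f \<longlonglongrightarrow> x"
  have "x \<in> sa" using closed_sequentially[OF closed_sa _ l] f pos_sa by blast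
  moreover have "0 \<le> Re (snd x)"
    by (rule LIMSEQ_le_const[OF tendsto_Re[OF tendsto_snd[OF l]]])
      (use f in \<open>auto simp: pos_eq_dcone dcone_def\<close>)
  moreover have "dissipative x"
  proof (rule dissipative_closed)
    fix \<epsilon> :: real assume \<epsilon>: "0 < \<epsilon>"
    have "(\<lambda>n. nrm (x - f n)) \<longlonglongrightarrow> nrm (x - x)" by (intro tendsto_intros l)
    then have "eventually (\<lambda>n. nrm (x - f n) < \<epsilon>) sequentially"
      using \<epsilon> by (intro order_tendstoD) auto
    then obtain n where "nrm (x - f n) < \<epsilon>" by (auto dest: eventually_happens)
    moreover have "dissipative (f n)" using f by (simp add: pos_eq_dcone dcone_def)
    ultimately show "\<exists>y. dissipative y \<and> nrm (x - y) < \<epsilon>" by blast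
  qed
  ultimately show "x \<in> pos" by (simp add: pos_eq_dcone dcone_def)
qed

end

section \<open>Positivity of quadratic operators\<close>

declare scaleR_Pair [simp del] split_paired_Ex [simp del] split_paired_All [simp del]

context jb_star_algebra begin

section \<open>The unit as order unit, and norm bounds from order bounds\<close>

lemma one_minus_pos:
  assumes "calg C" "v \<in> C" "v \<in> sa" "bdd C 1 v"
  shows "one - v \<in> pos"
proof -
  have "one - rt v \<in> sa" using rt_props[OF assms] by (intro sa_diff sa_one)
  then show ?thesis using square_pos rt_eq[OF assms] by metis
qed

lemma zero_pos: "0 \<in> pos"
  using square_pos[OF sa_0] by simp

lemma one_pos: "one \<in> pos"
  using square_pos[OF sa_one] by simp

lemma order_unit:
  assumes x: "x \<in> sa" and r: "nrm x \<le> r"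
  shows "r *\<^sub>R one - x \<in> pos"
proof (cases "r = 0")
  case True
  then show ?thesis using r zero_pos nrm_ge_0[of x] nrm_eq_0[of x] by auto
next
  case False
  then have r0: "0 < r" using r nrm_ge_0[of x] by linarith
  obtain C where C: "calg C" "x \<in> C" using ex_calg[OF x] .
  have "bdd C 1 ((1/r) *\<^sub>R x)"
    by (rule bdd_mono[OF bdd_nrm]) (use r r0 in \<open>simp add: nrm_scaleR\<close>)
  then have "one - (1/r) *\<^sub>R x \<in> pos"
    using C x by (intro one_minus_pos[OF C(1)]) (auto intro: calg_intros sa_scaleR)
  from pos_scaleR[OF this, of r] show ?thesis using r0 by (simp add: scaleR_diff_right)
qed

text \<open>Roots of \<open>z\<close> and \<open>one - z\<close> in a common subalgebra lie on the
  unit circle, so \<open>z\<close> has operator bound 1; the 3 is the price of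
  \<open>nrm_le_bdd\<close>.\<close>

lemma nrm_between_0_1:
  assumes "z \<in> pos" "one - z \<in> pos"
  shows "nrm z \<le> 3"
proof -
  obtain C where C: "calg C" "z \<in> C" using ex_calg[OF pos_sa[OF assms(1)]] .
  obtain y where y: "y \<in> C" "y \<in> sa" "y \<odot> y = z" using pos_root[OF assms(1) C] by blast
  obtain m where m: "m \<in> C" "m \<in> sa" "m \<odot> m = one - z"
    using pos_root[OF assms(2) C(1) calg_diff[OF C(1) calg_one[OF C(1)] C(2)]] by blast
  have "bdd C 1 y" using bdd_unit_circle(1)[OF C(1) y(1,2) m(1,2)] y m by simp
  then have "bdd C 1 z" using bdd_umul[OF C(1) y(1) y(1)] y(3) by fastforce
  then show ?thesis using nrm_le_bdd[OF C pos_sa[OF assms(1)]] by fastforce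
qed

lemma nrm_between:
  assumes "z \<in> pos" "r *\<^sub>R one - z \<in> pos" "0 < r"
  shows "nrm z \<le> 3 * r"
proof -
  have "nrm ((1/r) *\<^sub>R z) \<le> 3"
    using pos_scaleR[OF assms(1), of "1/r"] pos_scaleR[OF assms(2), of "1/r"] assms(3)
    by (intro nrm_between_0_1) (auto simp: scaleR_diff_right)
  then show ?thesis using assms(3) by (simp add: nrm_scaleR field_simps)
qed

lemma nrm_mono:
  assumes "a \<in> pos" "b - a \<in> pos" "nrm b \<le> r" "0 < r"
  shows "nrm a \<le> 3 * r"
proof (rule nrm_between[OF assms(1) _ assms(4)])
  have "b \<in> sa" using sa_add[OF pos_sa[OF assms(2)] pos_sa[OF assms(1)]] by simp
  from pos_add[OF order_unit[OF this assms(3)] assms(2)]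
  show "r *\<^sub>R one - a \<in> pos" by simp
qed

lemma pos_antisym:
  assumes "a \<in> pos" "- a \<in> pos"
  shows "a = 0"
proof -
  have "nrm a \<le> 3 * \<epsilon>" if "0 < \<epsilon>" for \<epsilon> :: real
    using pos_add[OF pos_scaleR[OF one_pos, of \<epsilon>] assms(2)] that assms(1)
    by (intro nrm_between) auto
  from this[of "nrm a / 4"] show ?thesis
    by (cases "a = 0") (auto simp del: nrm_eq_0)
qed

lemma pos_umul:
  assumes C: "calg C" and a: "a \<in> C" "a \<in> pos" and b: "b \<in> C" "b \<in> pos"
  shows "a \<odot> b \<in> pos"
proof -
  obtain y where y: "y \<in> C" "y \<in> sa" "y \<odot> y = a" using pos_root[OF a(2) C a(1)] by blast
  obtain m where m: "m \<in> C" "m \<in> sa" "m \<odot> m = b" using pos_root[OF b(2) C b(1)] by blast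
  have "(y \<odot> m) \<odot> (y \<odot> m) = a \<odot> b"
    using calg_mult4[OF C y(1) m(1) y(1) m(1)] by (simp add: y m)
  then show ?thesis using square_pos[OF sa_umul[OF y(2) m(2)]] by simp
qed

lemma square_le:
  assumes x: "x \<in> pos" and r: "nrm x \<le> r"
  shows "r *\<^sub>R x - x \<odot> x \<in> pos"
proof -
  obtain C where C: "calg C" "x \<in> C" using ex_calg[OF pos_sa[OF x]] .
  have "x \<odot> (r *\<^sub>R one - x) \<in> pos"
    using C x r by (intro pos_umul[OF C(1)] order_unit pos_sa calg_diff calg_scaleR calg_one)
  then show ?thesis by (simp add: ext.distribs)
qed

text \<open>The element \<open>x + 2 w x + r w\<^sup>2\<close> is positive since \<open>x \<ge> x\<^sup>2 / r\<close>; it agrees with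
  \<open>U (1 + w) x\<close> up to second order in \<open>w\<close>.\<close>

lemma U_one_plus_near_pos:
  assumes x: "x \<in> pos" and w: "w \<in> sa"
  shows "\<exists>p\<in>pos. nrm (ext.U (one + w) x - p) \<le> 4 * (nrm w)^2 * nrm x"
proof (cases "x = 0")
  case True
  then show ?thesis using zero_pos by (intro bexI[of _ 0]) (simp_all add: ext.trip_def)
next
  case False
  define r where "r = nrm x"
  have r: "0 < r" using False by (simp add: r_def)
  define p where "p = x + 2 *\<^sub>R (w \<odot> x) + r *\<^sub>R (w \<odot> w)"
  \<comment> \<open>Completes the square in \<open>p\<close>, up to the positive remainder x - x^2 /
    r.\<close>
  let ?k = "(1 / sqrt r) *\<^sub>R x + sqrt r *\<^sub>R w"
  have "?k \<odot> ?k = (1/r) *\<^sub>R (x \<odot> x) + 2 *\<^sub>R (w \<odot> x) + r *\<^sub>R (w \<odot> w)"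
  proof -
    have ab: "1 / sqrt r * (1 / sqrt r) = 1 / r" "1 / sqrt r * sqrt r = 1" "sqrt r * (1 / sqrt r) = 1"
      "sqrt r * sqrt r = r" using r by simp_all
    show ?thesis
      by (simp only: ext.distribs ext.commute[of x w] scaleR_add_right scaleR_scaleR ab scaleR_2 scaleR_one add_ac)
  qed
  moreover have "p = (1/r) *\<^sub>R (r *\<^sub>R x - x \<odot> x) + ((1/r) *\<^sub>R (x \<odot> x) + 2 *\<^sub>R (w \<odot> x) + r *\<^sub>R (w \<odot> w))"
    using r by (simp add: p_def scaleR_diff_right)
  ultimately have "p = (1/r) *\<^sub>R (r *\<^sub>R x - x \<odot> x) + ?k \<odot> ?k" by simp
  moreover have "?k \<in> sa" using pos_sa[OF x] w by (intro sa_add sa_scaleR)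
  ultimately have "p \<in> pos"
    using r square_le[OF x, of r] by (simp only:) (intro pos_add pos_scaleR square_pos; simp add: r_def)
  moreover have "nrm (ext.U (one + w) x - p) \<le> 4 * (nrm w)^2 * nrm x"
  proof -
    have "ext.U (one + w) x - p = ext.U w x - r *\<^sub>R (w \<odot> w)"
      by (simp add: U_one_plus p_def)
    then have "nrm (ext.U (one + w) x - p) \<le> nrm (ext.U w x) + r * nrm (w \<odot> w)"
      using nrm_diff[of "ext.U w x" "r *\<^sub>R (w \<odot> w)"] r by (simp add: nrm_scaleR)
    also have "\<dots> \<le> 3 * nrm w * nrm x * nrm w + r * (nrm w * nrm w)"
      using r by (intro add_mono nrm_trip mult_left_mono nrm_umul) auto
    finally show ?thesis by (simp add: r_def power2_eq_square algebra_simps)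
  qed
  ultimately show ?thesis by blast
qed

lemma nrm_U_one_plus_le:
  assumes "nrm w \<le> n"
  shows "nrm (ext.U (one + w) x) \<le> (1 + 2 * n + 3 * n * n) * nrm x"
  using nrm_U_one_plus[OF assms, of x] nrm_add[of "ext.U (one + w) x - x" x]
  by (simp add: algebra_simps)

text \<open>The errors of \<open>N\<close> factors, each of order \<open>1 / N\<^sup>2\<close>, add up to \<open>O(1 / N)\<close>.\<close>

lemma U_pos_product:
  assumes x: "x \<in> pos" and C: "calg C" and W: "0 \<le> W"
    and f: "\<And>N. 0 < N \<Longrightarrow> f N 0 = one" "\<And>N j. f N j \<in> C" "\<And>N. 0 < N \<Longrightarrow> f N N = p"
    and step: "\<And>N j. j < N \<Longrightarrow> \<exists>w\<in>C \<inter> sa. nrm w \<le> W / real N \<and> f N (Suc j) = (one + w) \<odot> f N j"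
  shows "ext.U p x \<in> pos"
proof -
  define K where "K = exp (2 * W + 7 * W * W) * nrm x"
  have bound: "\<exists>y\<in>pos. nrm (ext.U p x - y) \<le> 4 * W * W * K / real N" if N: "0 < N" for N :: nat
  proof -
    define n where "n = W / real N"
    \<comment> \<open>The 7 is 3 + 4: the quadratic growth of \<open>U\<close> at
      \<open>one + w\<close> together with the new error from \<open>U_one_plus_near_pos\<close>.
      Thus \<Gamma>^j dominates both the norms and the accumulated errors, and \<Gamma>^N stays
      bounded as N grows.\<close>
    define \<Gamma> where "\<Gamma> = 1 + 2 * n + 7 * n * n"
    have n: "0 \<le> n" using W by (simp add: n_def)
    have \<Gamma>: "1 \<le> \<Gamma>" "1 + 2 * n + 3 * n * n + 4 * n * n \<le> \<Gamma>" "1 + 2 * n + 3 * n * n \<le> \<Gamma>"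
      using n by (auto simp: \<Gamma>_def)
    have main: "nrm (ext.U (f N j) x) \<le> \<Gamma> ^ j * nrm x \<and>
      (\<exists>y\<in>pos. nrm (ext.U (f N j) x - y) \<le> 4 * n * n * real j * \<Gamma> ^ j * nrm x)" if "j \<le> N" for j
      using that
    proof (induction j)
      case 0
      have "ext.U one x = x" by (simp add: ext.U_alt ext.unit scaleR_2)
      then show ?case using f(1)[OF N] x by (auto intro!: bexI[of _ x])
    next
      case (Suc j)
      let ?a = "ext.U (f N j) x" and ?b = "ext.U (f N (Suc j)) x"
      obtain y where y: "y \<in> pos" "nrm (?a - y) \<le> 4 * n * n * real j * \<Gamma> ^ j * nrm x"
        and a: "nrm ?a \<le> \<Gamma> ^ j * nrm x" using Suc by auto
      define e where "e = 4 * n * n * real j * \<Gamma> ^ j * nrm x"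
      have e0: "0 \<le> e" using n \<Gamma>(1) by (simp add: e_def)
      obtain w where w: "w \<in> C" "w \<in> sa" "nrm w \<le> n" "f N (Suc j) = (one + w) \<odot> f N j"
        using step[of j N] Suc.prems by (auto simp: n_def)
      have b: "?b = ext.U (one + w) ?a"
        using calg_U[OF C, of "one + w" "f N j" x] C w f(2) by (auto simp: calg_intros)
      have "nrm ?b \<le> (1 + 2 * n + 3 * n * n) * nrm ?a"
        unfolding b by (rule nrm_U_one_plus_le[OF w(3)])
      also have "\<dots> \<le> \<Gamma> * (\<Gamma> ^ j * nrm x)" using a \<Gamma> n by (intro mult_mono) auto
      finally have 1: "nrm ?b \<le> \<Gamma> ^ Suc j * nrm x" by simp
      obtain z where z: "z \<in> pos" "nrm (ext.U (one + w) y - z) \<le> 4 * (nrm w)^2 * nrm y"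
        using U_one_plus_near_pos[OF y(1) w(2)] by blast
      have "nrm y \<le> nrm ?a + nrm (?a - y)" using nrm_diff[of ?a "?a - y"] by simp
      then have ny: "nrm y \<le> \<Gamma> ^ j * nrm x + e" using a y(2) by (simp add: e_def)
      have "4 * (nrm w)^2 * nrm y \<le> 4 * n^2 * (\<Gamma> ^ j * nrm x + e)"
        using ny w(3) n by (intro mult_mono power_mono) auto
      then have z2: "nrm (ext.U (one + w) y - z) \<le> 4 * n * n * (\<Gamma> ^ j * nrm x + e)"
        using z(2) by (simp add: power2_eq_square mult.assoc)
      have eq: "?b - z = ext.U (one + w) (?a - y) + (ext.U (one + w) y - z)"
        by (simp add: b ext.trip_linear)
      have "nrm (ext.U (one + w) (?a - y)) \<le> (1 + 2 * n + 3 * n * n) * e"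
        by (rule order_trans[OF nrm_U_one_plus_le[OF w(3)]])
          (use y(2) n in \<open>intro mult_left_mono; simp add: e_def\<close>)
      then have "nrm (?b - z) \<le> (1 + 2 * n + 3 * n * n) * e + 4 * n * n * (\<Gamma> ^ j * nrm x + e)"
        unfolding eq using nrm_add z2 by (meson add_mono order_trans)
      also have "\<dots> = (1 + 2 * n + 3 * n * n + 4 * n * n) * e + 4 * n * n * (\<Gamma> ^ j * nrm x)"
        by (simp add: algebra_simps)
      also have "\<dots> \<le> \<Gamma> * e + 4 * n * n * (\<Gamma> * \<Gamma> ^ j * nrm x)"
      proof (intro add_mono mult_right_mono mult_left_mono)
        show "\<Gamma> ^ j \<le> \<Gamma> * \<Gamma> ^ j" using \<Gamma>(1) by simp
      qed (use \<Gamma> e0 n in auto)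
      also have "\<dots> = 4 * n * n * real (Suc j) * \<Gamma> ^ Suc j * nrm x"
        by (simp add: e_def algebra_simps)
      finally show ?case using 1 z(1) by blast
    qed
    have n1: "n \<le> W" using N W by (simp add: n_def divide_le_eq mult_le_cancel_left1)
    have "\<Gamma> ^ N \<le> exp (2 * n + 7 * n * n) ^ N"
      using exp_ge_add_one_self[of "2 * n + 7 * n * n"] \<Gamma>(1)
      by (intro power_mono) (auto simp: \<Gamma>_def add.assoc)
    also have "\<dots> = exp (real N * (2 * n + 7 * n * n))" by (rule exp_of_nat_mult[symmetric])
    also have "real N * (2 * n + 7 * n * n) = 2 * W + 7 * W * n"
      using N by (simp add: n_def field_simps)
    also have "exp (2 * W + 7 * W * n) \<le> exp (2 * W + 7 * W * W)"
      using n1 W by (simp add: mult_left_mono)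
    finally have \<Gamma>N: "\<Gamma> ^ N * nrm x \<le> K" unfolding K_def by (rule mult_right_mono) simp
    obtain y where y: "y \<in> pos" "nrm (ext.U p x - y) \<le> 4 * n * n * real N * (\<Gamma> ^ N * nrm x)"
      using main[of N] f(3)[OF N] by (auto simp: mult.assoc)
    note y(2)
    also have "4 * n * n * real N * (\<Gamma> ^ N * nrm x) \<le> 4 * n * n * real N * K"
      using n by (intro mult_left_mono \<Gamma>N) auto
    also have "\<dots> = 4 * W * W * K / real N" using N by (simp add: n_def field_simps)
    finally show ?thesis using y(1) by blast
  qed
  have "\<exists>y. \<forall>N. y N \<in> pos \<and> nrm (ext.U p x - y N) \<le> 4 * W * W * K * inverse (real (Suc N))"
    using bound[OF zero_less_Suc] by (intro choice allI) (metis divide_inverse)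
  then obtain y where y: "\<And>N. y N \<in> pos" "\<And>N. nrm (ext.U p x - y N) \<le> 4 * W * W * K * inverse (real (Suc N))"
    by blast
  have l: "(\<lambda>N. 4 * W * W * K * inverse (real (Suc N))) \<longlonglongrightarrow> 0"
    using tendsto_mult_left[OF LIMSEQ_inverse_real_of_nat, of "4 * W * W * K"] by simp
  have "y \<longlonglongrightarrow> ext.U p x"
  proof (rule LIM_zero_cancel, rule Lim_null_comparison[OF _ l], rule always_eventually, rule allI)
    fix N
    show "norm (y N - ext.U p x) \<le> 4 * W * W * K * inverse (real (Suc N))"
      using norm_le_nrm[of "y N - ext.U p x"] y(2)[of N] by (simp add: nrm_minus_commute)
  qed
  then show ?thesis using closed_sequentially[OF closed_pos] y(1) by blast
qed

section \<open>Inverses and order automorphisms\<close>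

lemma geometric_inverse:
  assumes C: "calg C" and v: "v \<in> C" "v \<in> sa" and b: "bdd C \<kappa> v" "\<kappa> < 1"
  shows "\<exists>q\<in>C \<inter> sa. (one - v) \<odot> q = one \<and> nrm q \<le> 3 / (1 - \<kappa>)"
proof -
  have \<kappa>: "0 \<le> \<kappa>" using bdd_ge_0[OF b(1)] .
  let ?p = "ext.jpower v"
  have p_sa: "?p n \<in> sa" for n by (induction n) (auto intro: sa_one sa_umul v)
  have np: "nrm (?p n) \<le> 3 * \<kappa> ^ n" for n
    by (rule nrm_le_bdd[OF C calg_jpower[OF C v(1)] p_sa bdd_jpower[OF C v(1) b(1)]])
  have geo: "(\<lambda>n. 3 * \<kappa> ^ n) sums (3 * (1 / (1 - \<kappa>)))"
    using \<kappa> b(2) by (intro sums_mult geometric_sums) auto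
  have sm: "summable ?p"
    by (rule summable_comparison_test'[OF sums_summable[OF geo]])
      (use np norm_le_nrm order_trans in blast)
  define q where "q = suminf ?p"
  define S where "S N = sum ?p {..<N}" for N
  have S: "S \<longlonglongrightarrow> q"
    using summable_LIMSEQ[OF sm] unfolding S_def q_def .
  have S_in: "S N \<in> C" "S N \<in> sa" for N
    unfolding S_def using C v p_sa
    by (induction N) (auto intro: calg_intros calg_jpower sa_0 sa_add)
  have q: "q \<in> C" "q \<in> sa"
    using closed_sequentially[OF calg_closed[OF C] _ S] closed_sequentially[OF closed_sa _ S] S_in
    by auto
  have tel: "(one - v) \<odot> S N = one - ?p N" for N
    unfolding S_def by (induction N) (simp_all add: ext.distribs ext.unit)
  have "(\<lambda>N. (one - v) \<odot> S N) \<longlonglongrightarrow> (one - v) \<odot> q" by (intro tendsto_intros S)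
  moreover have "(\<lambda>N. (one - v) \<odot> S N) \<longlonglongrightarrow> one - 0"
    unfolding tel by (intro tendsto_intros summable_LIMSEQ_zero[OF sm])
  ultimately have "(one - v) \<odot> q = one" using LIMSEQ_unique by fastforce
  moreover have "nrm q \<le> 3 / (1 - \<kappa>)"
  proof (rule LIMSEQ_le_const2[OF tendsto_nrm[OF S]], intro exI allI impI)
    fix N
    have "nrm (S N) \<le> (\<Sum>n<N. 3 * \<kappa> ^ n)"
      unfolding S_def using nrm_sum[of ?p "{..<N}"] sum_mono[of "{..<N}" "\<lambda>n. nrm (?p n)", OF np]
      by (rule order_trans)
    also have "\<dots> \<le> (\<Sum>n. 3 * \<kappa> ^ n)"
      using \<kappa> by (intro sum_le_suminf sums_summable[OF geo]) auto
    also have "\<dots> = 3 / (1 - \<kappa>)" using sums_unique[OF geo] by simp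
    finally show "nrm (S N) \<le> 3 / (1 - \<kappa>)" .
  qed
  ultimately show ?thesis using q by blast
qed

text \<open>The paths are 1 - s v and its inverse \<open>Q s\<close> for s in [0, 1]. Consecutive
  points of a partition into N parts differ by a factor 1 - vQ/N or 1 + vQ/N respectively, and the
  Neumann series bounds \<open>Q\<close> uniformly in \<open>s\<close>, as
  \<open>U_pos_product\<close> needs.\<close>

lemma U_order_automorphism:
  assumes C: "calg C" and v: "v \<in> C" "v \<in> sa" and b: "bdd C \<kappa> v" "\<kappa> < 1"
  shows "\<exists>q\<in>C \<inter> sa. (one - v) \<odot> q = one \<and> (\<forall>x\<in>pos. ext.U (one - v) x \<in> pos \<and> ext.U q x \<in> pos)"
proof -
  have \<kappa>: "0 \<le> \<kappa>" using bdd_ge_0[OF b(1)] .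
  define B where "B = 3 / (1 - \<kappa>)"
  have B: "0 \<le> B" using b(2) by (simp add: B_def)
  define W where "W = nrm v * B"
  have W: "0 \<le> W" using B by (simp add: W_def)
  have "\<exists>q\<in>C \<inter> sa. (one - s *\<^sub>R v) \<odot> q = one \<and> nrm q \<le> B" if s: "0 \<le> s" "s \<le> 1" for s :: real
    unfolding B_def
  proof (rule geometric_inverse[OF C calg_scaleR[OF C v(1)] sa_scaleR[OF v(2)] _ b(2)])
    have "s * \<kappa> \<le> 1 * \<kappa>" using s \<kappa> by (intro mult_right_mono) auto
    then show "bdd C \<kappa> (s *\<^sub>R v)"
      using bdd_mono[OF bdd_scaleR[OF b(1), of s]] s by simp
  qed
  then have "\<forall>s. \<exists>q. 0 \<le> s \<and> s \<le> 1 \<longrightarrow> q \<in> C \<inter> sa \<and> (one - s *\<^sub>R v) \<odot> q = one \<and> nrm q \<le> B"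
    by blast
  then obtain Q where Q: "\<And>s. 0 \<le> s \<Longrightarrow> s \<le> 1 \<Longrightarrow> Q s \<in> C \<and> Q s \<in> sa \<and> (one - s *\<^sub>R v) \<odot> Q s = one \<and> nrm (Q s) \<le> B"
    using choice by (metis (no_types, lifting) Int_iff)
  have w_bound: "nrm ((t / real N) *\<^sub>R (v \<odot> Q s)) \<le> W / real N"
    if "0 \<le> s" "s \<le> 1" "\<bar>t\<bar> = 1" for s t N
  proof -
    have "nrm (v \<odot> Q s) \<le> W"
      unfolding W_def by (rule order_trans[OF nrm_umul]) (use Q that in \<open>simp add: mult_left_mono\<close>)
    then show ?thesis using that by (simp add: nrm_scaleR divide_right_mono)
  qed
  have w_in: "(t / real N) *\<^sub>R (v \<odot> Q s) \<in> C \<inter> sa" if "0 \<le> s" "s \<le> 1" for s t N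
    using C v Q[OF that] by (auto intro: calg_intros sa_scaleR sa_umul)
  have down: "ext.U (one - v) x \<in> pos" if x: "x \<in> pos" for x
  proof (rule U_pos_product[OF x C W, of "\<lambda>N j. one - (real j / real N) *\<^sub>R v"])
    let ?f = "\<lambda>(N::nat) (j::nat). one - (real j / real N) *\<^sub>R v"
    show "?f N 0 = one" "?f N j \<in> C" for N j using C v by (auto intro!: calg_intros)
    show "0 < N \<Longrightarrow> ?f N N = one - v" for N by simp
    fix N j :: nat assume j: "j < N"
    define s where "s = real j / real N"
    have s: "0 \<le> s" "s \<le> 1" using j by (auto simp: s_def)
    let ?w = "(- 1 / real N) *\<^sub>R (v \<odot> Q s)"
    have "(v \<odot> Q s) \<odot> (one - s *\<^sub>R v) = v \<odot> (Q s \<odot> (one - s *\<^sub>R v))"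
      using C v Q[OF s] by (intro calg_assoc) (auto intro!: calg_intros)
    also have "\<dots> = v" using Q[OF s] by (simp add: ext.commute)
    finally have "(one + ?w) \<odot> (one - s *\<^sub>R v) = one - s *\<^sub>R v - (1 / real N) *\<^sub>R v"
      by (simp only: ext.add_left ext.scaleR_left ext.unit) simp
    also have "\<dots> = ?f N (Suc j)"
      by (simp add: s_def add_divide_distrib scaleR_add_left diff_diff_add add.commute)
    finally show "\<exists>w\<in>C \<inter> sa. nrm w \<le> W / real N \<and> ?f N (Suc j) = (one + w) \<odot> ?f N j"
      using w_in[OF s, of "-1" N] w_bound[OF s, of "-1" N] unfolding s_def
      by (intro bexI[of _ "(- 1 / real N) *\<^sub>R (v \<odot> Q (real j / real N))"]) simp_all
  qed
  have up: "ext.U (Q 1) x \<in> pos" if x: "x \<in> pos" for x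
  proof (rule U_pos_product[OF x C W, of "\<lambda>N j. if j \<le> N then Q (real j / real N) else one"])
    \<comment> \<open>The value \<open>one\<close> beyond the end of the partition keeps every
      \<open>?f N j\<close> in \<open>C\<close>.\<close>
    let ?f = "\<lambda>(N::nat) (j::nat). if j \<le> N then Q (real j / real N) else one"
    show "?f N 0 = one" for N using Q[of 0] by (simp add: ext.unit)
    show "?f N j \<in> C" for N j using Q[of "real j / real N"] C by (auto intro: calg_intros simp: divide_le_eq_1)
    show "0 < N \<Longrightarrow> ?f N N = Q 1" for N by simp
    fix N j :: nat assume j: "j < N"
    define s s' where "s = real j / real N" and "s' = real (Suc j) / real N"
    have s: "0 \<le> s" "s \<le> 1" and s': "0 \<le> s'" "s' \<le> 1" using j by (auto simp: s_def s'_def)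
    let ?w = "(1 / real N) *\<^sub>R (v \<odot> Q s')"
    have e: "one + ?w = Q s' \<odot> (one - s *\<^sub>R v)"
    proof -
      have "Q s' \<odot> (one - s *\<^sub>R v) = Q s' \<odot> (one - s' *\<^sub>R v) + (s' - s) *\<^sub>R (v \<odot> Q s')"
        by (simp add: ext.distribs ext.commute[of "Q s'" v] scaleR_diff_left)
      also have "Q s' \<odot> (one - s' *\<^sub>R v) = one" using Q[OF s'] by (simp add: ext.commute)
      also have "s' - s = 1 / real N" by (simp add: s_def s'_def add_divide_distrib)
      finally show ?thesis by simp
    qed
    have "(one + ?w) \<odot> Q s = Q s' \<odot> ((one - s *\<^sub>R v) \<odot> Q s)"
      unfolding e using C v Q[OF s] Q[OF s'] by (intro calg_assoc) (auto intro!: calg_intros)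
    also have "\<dots> = Q s'" using Q[OF s] by simp
    finally show "\<exists>w\<in>C \<inter> sa. nrm w \<le> W / real N \<and> ?f N (Suc j) = (one + w) \<odot> ?f N j"
      using w_in[OF s', of 1 N] w_bound[OF s', of 1 N] j unfolding s_def s'_def by auto
  qed
  show ?thesis using Q[of 1] down up by auto
qed

text \<open>\<open>psqrt \<Lambda> x\<close> is the square root of \<open>x\<close> for \<open>0 \<le> x \<le> \<Lambda>\<close>.\<close>

definition psqrt :: "real \<Rightarrow> 'a \<times> complex \<Rightarrow> 'a \<times> complex" where
  "psqrt \<Lambda> x = sqrt \<Lambda> *\<^sub>R (one - rt (one - (1/\<Lambda>) *\<^sub>R x))"

text \<open>The subalgebra is existentially bound, so that roots of elements from different
  subalgebras can be compared.\<close>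

definition unit_bounded :: "'a \<times> complex \<Rightarrow> bool" where
  "unit_bounded v \<longleftrightarrow> (\<exists>C. calg C \<and> v \<in> C \<and> v \<in> sa \<and> bdd C 1 v)"

text \<open>The element factors as 1 - \<eta>/\<Lambda> times 1 - z/(\<Lambda> - \<eta>), and the
  latter is bounded by 1. For \<eta> > 0 the bound is below 1, hence the root becomes
  invertible.\<close>

lemma bdd_shifted:
  assumes z: "z \<in> pos" "calg C" "z \<in> C" and \<eta>: "0 \<le> \<eta>" "\<eta> < \<Lambda>" "\<eta> + nrm z \<le> \<Lambda>"
  shows "bdd C (1 - \<eta> / \<Lambda>) (one - (1/\<Lambda>) *\<^sub>R (\<eta> *\<^sub>R one + z))"
proof -
  have "bdd C 1 (one - (1 / (\<Lambda> - \<eta>)) *\<^sub>R z)"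
    using z \<eta> by (intro bdd_dcone) (auto simp: pos_eq_dcone[symmetric])
  from bdd_scaleR[OF this, of "1 - \<eta> / \<Lambda>"]
  have "bdd C (1 - \<eta> / \<Lambda>) ((1 - \<eta> / \<Lambda>) *\<^sub>R (one - (1 / (\<Lambda> - \<eta>)) *\<^sub>R z))"
    using \<eta> by simp
  also have "(1 - \<eta> / \<Lambda>) *\<^sub>R (one - (1 / (\<Lambda> - \<eta>)) *\<^sub>R z) = one - (1/\<Lambda>) *\<^sub>R (\<eta> *\<^sub>R one + z)"
  proof -
    have "(1 - \<eta> / \<Lambda>) * (1 / (\<Lambda> - \<eta>)) = 1 / \<Lambda>" using \<eta> by (simp add: field_simps)
    then show ?thesis by (simp add: scaleR_diff_right scaleR_add_right scaleR_diff_left)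
  qed
  finally show ?thesis .
qed

lemma psqrt_automorphism:
  assumes z: "z \<in> pos" and \<eta>: "0 < \<eta>" "\<eta> < \<Lambda>" "\<eta> + nrm z \<le> \<Lambda>"
  defines "p \<equiv> psqrt \<Lambda> (\<eta> *\<^sub>R one + z)"
  shows "unit_bounded (one - (1/\<Lambda>) *\<^sub>R (\<eta> *\<^sub>R one + z))"
    and "p \<in> sa" and "p \<odot> p = \<eta> *\<^sub>R one + z" and "\<And>x. x \<in> pos \<Longrightarrow> ext.U p x \<in> pos"
    and "\<exists>q\<in>sa. (\<forall>x\<in>pos. ext.U q x \<in> pos) \<and> (\<forall>x. ext.U p (ext.U q x) = x \<and> ext.U q (ext.U p x) = x)"
proof -
  obtain C where C: "calg C" "z \<in> C" using ex_calg[OF pos_sa[OF z]] .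
  define \<kappa> where "\<kappa> = 1 - \<eta> / \<Lambda>"
  have \<kappa>: "\<kappa> < 1" using \<eta> by (simp add: \<kappa>_def)
  define v where "v = one - (1/\<Lambda>) *\<^sub>R (\<eta> *\<^sub>R one + z)"
  have v: "v \<in> C" "v \<in> sa"
    unfolding v_def using C z
    by (intro calg_diff calg_scaleR calg_add calg_one sa_diff sa_one sa_scaleR sa_add pos_sa; simp)+
  have b: "bdd C \<kappa> v" unfolding v_def \<kappa>_def using z C \<eta> by (intro bdd_shifted) auto
  then have b1: "bdd C 1 v" using bdd_mono \<kappa> by fastforce
  then show "unit_bounded (one - (1/\<Lambda>) *\<^sub>R (\<eta> *\<^sub>R one + z))"
    using C v unfolding unit_bounded_def v_def by blast
  note r = rt_props[OF C(1) v b1]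
  have brt: "bdd C \<kappa> (rt v)" using r(5) b \<kappa> by simp
  have \<Lambda>: "0 < \<Lambda>" using \<eta> by simp
  have p: "p = sqrt \<Lambda> *\<^sub>R (one - rt v)" by (simp add: p_def psqrt_def v_def)
  have pC: "p \<in> C" using C r by (auto simp: p intro!: calg_intros)
  show "p \<in> sa" using r by (auto simp: p intro!: sa_scaleR sa_diff sa_one)
  show "p \<odot> p = \<eta> *\<^sub>R one + z"
    using r(3) \<Lambda> by (simp add: p ext.scaleR_left ext.scaleR_right v_def)
  obtain q' where q': "q' \<in> C" "q' \<in> sa" "(one - rt v) \<odot> q' = one"
    "\<And>x. x \<in> pos \<Longrightarrow> ext.U (one - rt v) x \<in> pos" "\<And>x. x \<in> pos \<Longrightarrow> ext.U q' x \<in> pos"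
    using U_order_automorphism[OF C(1) r(1,2) brt \<kappa>] by blast
  show "ext.U p x \<in> pos" if "x \<in> pos" for x
    using q'(4)[OF that] \<Lambda> by (simp add: p ext.trip_linear(7,9) pos_scaleR)
  define q where "q = (1 / sqrt \<Lambda>) *\<^sub>R q'"
  have q: "q \<in> C" "q \<in> sa" using C q' by (auto simp: q_def intro: calg_intros sa_scaleR)
  have pq: "p \<odot> q = one" using q'(3) \<Lambda> by (simp add: p q_def ext.scaleR_left ext.scaleR_right)
  have U1: "ext.U one x = x" for x by (simp add: ext.U_alt ext.unit scaleR_2)
  have "ext.U p (ext.U q x) = x \<and> ext.U q (ext.U p x) = x" for x
    using calg_U[OF C(1) pC q(1), of x] calg_U[OF C(1) q(1) pC, of x] pq
    by (simp add: U1 ext.commute[of q p])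
  moreover have "ext.U q x \<in> pos" if "x \<in> pos" for x
    using q'(5)[OF that] \<Lambda> by (simp add: q_def ext.trip_linear(7,9) pos_scaleR)
  ultimately show "\<exists>q\<in>sa. (\<forall>x\<in>pos. ext.U q x \<in> pos) \<and> (\<forall>x. ext.U p (ext.U q x) = x \<and> ext.U q (ext.U p x) = x)"
    using q(2) by blast
qed

section \<open>Uniform continuity of the square root\<close>

lemma unit_bounded_rt:
  assumes "unit_bounded v"
  shows "nrm (sq n v) \<le> 3" "nrm (rt v) \<le> 3" "nrm (rt v - sq n v) \<le> 3 * (1 - sqr n)"
    "(\<lambda>n. sq n v) \<longlonglongrightarrow> rt v"
proof -
  obtain C where C: "calg C" "v \<in> C" "v \<in> sa" "bdd C 1 v" using assms by (auto simp: unit_bounded_def)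
  note s = sq_in[OF C(1-3), of n] and r = rt_props[OF C]
  show "nrm (sq n v) \<le> 3"
    using nrm_le_bdd[OF C(1) s bdd_mono[OF bdd_sq[OF C] sqr_bounds(2)]] by simp
  show "nrm (rt v) \<le> 3"
    using nrm_le_bdd[OF C(1) r(1,2) r(5)[OF C(4)]] by simp
  show "nrm (rt v - sq n v) \<le> 3 * (1 - sqr n)"
    by (rule nrm_le_bdd[OF C(1) calg_diff[OF C(1) r(1) s(1)] sa_diff[OF r(2) s(2)] r(4)])
  show "(\<lambda>n. sq n v) \<longlonglongrightarrow> rt v" by (rule rt_tendsto[OF C])
qed

text \<open>The factorization a^2 - b^2 = (a - b)(a + b) needs only a commutative bilinear product,
  so \<open>v\<close> and \<open>v'\<close> may lie in different subalgebras. The constant depends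
  on \<open>n\<close>.\<close>

lemma sq_lipschitz:
  "\<exists>K\<ge>0. \<forall>v v'. unit_bounded v \<longrightarrow> unit_bounded v' \<longrightarrow> nrm (sq n v - sq n v') \<le> K * nrm (v - v')"
proof (induction n)
  case (Suc n)
  then obtain K where K: "0 \<le> K" "\<And>v v'. unit_bounded v \<Longrightarrow> unit_bounded v' \<Longrightarrow> nrm (sq n v - sq n v') \<le> K * nrm (v - v')"
    by blast
  have "nrm (sq (Suc n) v - sq (Suc n) v') \<le> (1 + 6 * K) * nrm (v - v')"
    if u: "unit_bounded v" "unit_bounded v'" for v v'
  proof -
    let ?a = "sq n v" and ?b = "sq n v'"
    have "?a \<odot> ?a - ?b \<odot> ?b = (?a - ?b) \<odot> (?a + ?b)"
      by (simp only: ext.distribs ext.commute[of ?b ?a]) simp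
    then have e: "sq (Suc n) v - sq (Suc n) v' = (1/2) *\<^sub>R ((v - v') + (?a - ?b) \<odot> (?a + ?b))"
      by (simp only: sq.simps scaleR_diff_right[symmetric]) (simp add: algebra_simps)
    have "nrm ((?a - ?b) \<odot> (?a + ?b)) \<le> (K * nrm (v - v')) * 6"
    proof (rule order_trans[OF nrm_umul], rule mult_mono)
      show "nrm (?a + ?b) \<le> 6"
        using nrm_add[of ?a ?b] unit_bounded_rt(1)[OF u(1), of n] unit_bounded_rt(1)[OF u(2), of n] by linarith
    qed (use K u in auto)
    then have "nrm ((v - v') + (?a - ?b) \<odot> (?a + ?b)) \<le> (1 + 6 * K) * nrm (v - v')"
      using nrm_add[of "v - v'" "(?a - ?b) \<odot> (?a + ?b)"] by (simp add: algebra_simps)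
    moreover have "nrm (sq (Suc n) v - sq (Suc n) v') = 1/2 * nrm ((v - v') + (?a - ?b) \<odot> (?a + ?b))"
      unfolding e nrm_scaleR by simp
    ultimately show ?thesis using nrm_ge_0[of "(v - v') + (?a - ?b) \<odot> (?a + ?b)"] by linarith
  qed
  then show ?case using K(1) by (intro exI[of _ "1 + 6 * K"]) auto
qed (auto intro: exI[of _ 0])

text \<open>The iterates are Lipschitz and converge at the rate of \<open>sqr\<close>, uniformly in
  \<open>v\<close>. A third of \<epsilon> goes to each of the two approximation errors and to the
  Lipschitz estimate.\<close>

lemma rt_uniformly_continuous:
  assumes "0 < \<epsilon>"
  shows "\<exists>\<delta>>0. \<forall>v v'. unit_bounded v \<longrightarrow> unit_bounded v' \<longrightarrow> nrm (v - v') < \<delta> \<longrightarrow> nrm (rt v - rt v') < \<epsilon>"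
proof -
  have "eventually (\<lambda>n. sqr n > 1 - \<epsilon> / 9) sequentially"
    using order_tendstoD(1)[OF sqr_tendsto] assms by simp
  then obtain n where "1 - \<epsilon> / 9 < sqr n" by (auto dest!: eventually_happens)
  then have n: "3 * (1 - sqr n) < \<epsilon> / 3" by argo
  obtain K where K: "0 \<le> K" "\<And>v v'. unit_bounded v \<Longrightarrow> unit_bounded v' \<Longrightarrow> nrm (sq n v - sq n v') \<le> K * nrm (v - v')"
    using sq_lipschitz[of n] by blast
  have "nrm (rt v - rt v') < \<epsilon>"
    if u: "unit_bounded v" "unit_bounded v'" and d: "nrm (v - v') < \<epsilon> / 3 / (K + 1)" for v v'
  proof -
    have "K * nrm (v - v') \<le> (K + 1) * nrm (v - v')" by (simp add: mult_right_mono)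
    also have "\<dots> < \<epsilon> / 3" using d K(1) by (simp add: pos_less_divide_eq algebra_simps)
    finally have 1: "nrm (sq n v - sq n v') < \<epsilon> / 3" using K(2)[OF u] by linarith
    have "rt v - rt v' = ((rt v - sq n v) + (sq n v - sq n v')) - (rt v' - sq n v')" by simp
    then have "nrm (rt v - rt v') \<le> nrm (rt v - sq n v) + nrm (sq n v - sq n v') + nrm (rt v' - sq n v')"
      using nrm_add[of "rt v - sq n v" "sq n v - sq n v'"]
        nrm_diff[of "(rt v - sq n v) + (sq n v - sq n v')" "rt v' - sq n v'"] by simp
    then show ?thesis
      using 1 n unit_bounded_rt(3)[OF u(1), of n] unit_bounded_rt(3)[OF u(2), of n] by argo
  qed
  then show ?thesis using K(1) assms by (intro exI[of _ "\<epsilon> / 3 / (K + 1)"]) auto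
qed

end

section \<open>Lifting along an epimorphism\<close>

context jb_star_algebra begin

lemma umul_self_eq_0:
  assumes "x \<in> sa" "x \<odot> x = 0"
  shows "x = 0"
proof -
  have s: "snd x = 0" using arg_cong[OF assms(2), of snd] by simp
  then have "fst x \<circ>\<^sub>J fst x = 0" using arg_cong[OF assms(2), of fst] by simp
  then show ?thesis using norm_square[of "fst x"] assms(1) s by (simp add: sa_iff prod_eq_iff)
qed

lemma sq_pos:
  assumes "v \<in> pos" "v \<in> sa"
  shows "sq n v \<in> pos"
proof (induction n)
  case (Suc n)
  then show ?case
    unfolding sq.simps by (intro pos_scaleR pos_add assms square_pos pos_sa) auto
qed (simp add: zero_pos)

text \<open>The element \<open>m\<close> is the absolute value of \<open>e\<close>.\<close>

lemma abs_value:
  assumes C: "calg C" and e: "e \<in> C" "e \<in> sa" "bdd C 1 e"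
  defines "m \<equiv> one - rt (one - e \<odot> e)"
  shows "m \<in> C" "m \<odot> m = e \<odot> e" "m - e \<in> pos" "m + e \<in> pos"
    and "(\<lambda>n. sq n (one - e \<odot> e)) \<longlonglongrightarrow> rt (one - e \<odot> e)"
proof -
  let ?v = "one - e \<odot> e"
  have v: "?v \<in> C" "?v \<in> sa" "bdd C 1 ?v"
    using C e bdd_one_minus_square(1)[OF C e] by (auto intro!: calg_intros sa_diff sa_one sa_umul)
  note r = rt_props[OF C v]
  show "m \<in> C" using C r by (auto simp: m_def intro: calg_intros)
  show "m \<odot> m = e \<odot> e" using r(3) by (simp add: m_def)
  show l: "(\<lambda>n. sq n ?v) \<longlonglongrightarrow> rt ?v" by (rule rt_tendsto[OF C v])
  have vp: "?v \<in> pos"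
    using bdd_umul[OF C e(1,1,3,3)] C e by (intro one_minus_pos[OF C]) (auto intro: calg_intros sa_umul)
  \<comment> \<open>Used for f = e and f = -e, which have the same square. The iterates w stay below
    1 - f: the product (1 - f - w)(1 - f + w) is positive, and half of it is 1 - f minus the next
    iterate.\<close>
  have main: "one - rt (one - f \<odot> f) - f \<in> pos"
    if f: "f \<in> C" "f \<in> sa" "bdd C 1 f" "f \<odot> f = e \<odot> e" for f
  proof -
    let ?w = "\<lambda>n. sq n ?v"
    have "one - f - ?w n \<in> pos" for n
    proof (induction n)
      case 0
      show ?case using one_minus_pos[OF C f(1-3)] by simp
    next
      case (Suc n)
      have in': "one - f \<in> C" "?w n \<in> C" using C f(1) sq_in(1)[OF C v(1,2)] by (auto intro: calg_intros)
      have "(one - f - ?w n) \<odot> (one - f + ?w n) \<in> pos"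
        by (rule pos_umul[OF C calg_diff[OF C in'] Suc calg_add[OF C in']])
          (rule pos_add[OF one_minus_pos[OF C f(1-3)] sq_pos[OF vp v(2)]])
      moreover have "(one - f - ?w n) \<odot> (one - f + ?w n) = (one - f) \<odot> (one - f) - ?w n \<odot> ?w n"
        by (simp only: ext.add_right ext.diff_left ext.commute[of "?w n" "one - f"]) simp
      moreover have "(one - f) \<odot> (one - f) = 2 *\<^sub>R (one - f) - ?v"
        by (simp add: ext.distribs ext.unit f(4) scaleR_2)
      ultimately have "(1/2) *\<^sub>R (2 *\<^sub>R (one - f) - ?v - ?w n \<odot> ?w n) \<in> pos"
        by (intro pos_scaleR) auto
      then show ?case by (simp add: scaleR_diff_right scaleR_add_right diff_diff_add add_ac)
    qed
    moreover have "(\<lambda>n. one - f - ?w n) \<longlonglongrightarrow> one - f - rt ?v" by (intro tendsto_intros l)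
    ultimately have "one - f - rt ?v \<in> pos" by (rule closed_sequentially[OF closed_pos])
    then show ?thesis by (simp add: f(4) algebra_simps)
  qed
  show "m - e \<in> pos" unfolding m_def using main[OF e] by simp
  have "(-1) *\<^sub>R e \<in> C" "(-1) *\<^sub>R e \<in> sa" "bdd C 1 ((-1) *\<^sub>R e)"
    using calg_scaleR[OF C e(1), of "-1"] bdd_scaleR[OF e(3), of "-1"] sa_scaleR[OF e(2), of "-1"]
    by simp_all
  from main[OF this] show "m + e \<in> pos" unfolding m_def by (simp add: ext.distribs)
qed

lemma pos_iff: "(a, 0) \<in> pos \<longleftrightarrow> jb_positive jprod star a"
proof
  assume "(a, 0) \<in> pos"
  then obtain k where k: "(a, 0) = k \<odot> k" "k \<in> sa" unfolding pos_def by blast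
  have "snd k = 0" using arg_cong[OF k(1), of snd] by simp
  then have "a = fst k \<circ>\<^sub>J fst k" using arg_cong[OF k(1), of fst] by simp
  then show "jb_positive jprod star a"
    using k(2) unfolding jb_positive_def self_adjoint_def sa_iff by blast
next
  assume "jb_positive jprod star a"
  then obtain h where h: "star h = h" "a = h \<circ>\<^sub>J h" by (auto simp: jb_positive_def self_adjoint_def)
  then have "(h, 0) \<in> sa" by (simp add: sa_iff)
  moreover have "(a, 0) = (h, 0) \<odot> (h, 0)" by (simp add: prod_eq_iff h)
  ultimately show "(a, 0) \<in> pos" unfolding pos_def by blast
qed

lemma jb_le_iff: "jb_le jprod star x y \<longleftrightarrow> star x = x \<and> (y - x, 0) \<in> pos"
proof -
  have "star y = y" if "star x = x" "(y - x, 0) \<in> pos"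
    using pos_sa[OF that(2)] that(1) by (simp add: sa_iff star_diff)
  then show ?thesis by (auto simp: jb_le_def pos_iff self_adjoint_def)
qed

end

context jordan_star_epimorphism begin

section \<open>The epimorphism extended to the unitizations, and its continuity\<close>

definition \<Psi> :: "'a \<times> complex \<Rightarrow> 'b \<times> complex" where "\<Psi> x = (\<Phi> (fst x), snd x)"

lemma Phi_add: "\<Phi> (x + y) = \<Phi> x + \<Phi> y" and Phi_scale: "\<Phi> (csA z x) = csB z (\<Phi> x)"
proof -
  interpret L: Vector_Spaces.linear csA csB \<Phi> by (rule linear)
  show "\<Phi> (x + y) = \<Phi> x + \<Phi> y" by (rule L.add)
  show "\<Phi> (csA z x) = csB z (\<Phi> x)" by (rule L.scale)
qed

lemma Phi_scaleR: "\<Phi> (r *\<^sub>R x) = r *\<^sub>R \<Phi> x"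
  using Phi_scale[of "of_real r" x] by (simp add: dom.cscale_of_real cod.cscale_of_real)

lemma fst_Psi [simp]: "fst (\<Psi> x) = \<Phi> (fst x)" and snd_Psi [simp]: "snd (\<Psi> x) = snd x"
  by (simp_all add: \<Psi>_def)

lemma Psi_add: "\<Psi> (x + y) = \<Psi> x + \<Psi> y"
  and Psi_scaleR: "\<Psi> (r *\<^sub>R x) = r *\<^sub>R \<Psi> x"
  and Psi_umul: "\<Psi> (dom.umul x y) = cod.umul (\<Psi> x) (\<Psi> y)"
  and Psi_st: "\<Psi> (dom.st x) = cod.st (\<Psi> x)"
  by (simp_all add: prod_eq_iff Phi_add Phi_scaleR Phi_scale map_jprod map_star)

lemma Psi_0: "\<Psi> 0 = 0"
  using Psi_scaleR[of 0 0] by simp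

lemma Psi_diff: "\<Psi> (x - y) = \<Psi> x - \<Psi> y"
  using Psi_add[of x "(-1) *\<^sub>R y"] Psi_scaleR[of "-1" y] by simp

lemma Psi_one: "\<Psi> (0, 1) = (0, 1)"
  using arg_cong[OF Psi_0, of fst] by (simp add: prod_eq_iff)

lemmas Psi_simps = Psi_add Psi_scaleR Psi_umul Psi_st Psi_0 Psi_diff Psi_one

lemma Psi_trip: "\<Psi> (dom.ext.trip x y z) = cod.ext.trip (\<Psi> x) (\<Psi> y) (\<Psi> z)"
  by (simp add: dom.ext.trip_def cod.ext.trip_def Psi_simps)

lemma Psi_sq: "\<Psi> (dom.sq n v) = cod.sq n (\<Psi> v)"
  by (induction n) (simp_all add: Psi_simps)

lemma Psi_sa: "x \<in> dom.sa \<Longrightarrow> \<Psi> x \<in> cod.sa"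
  unfolding dom.sa_def cod.sa_def by (simp flip: Psi_st)

lemma Psi_pos: "x \<in> dom.pos \<Longrightarrow> \<Psi> x \<in> cod.pos"
  unfolding dom.pos_def cod.pos_def using Psi_sa Psi_umul by blast

text \<open>Continuity is not assumed but follows from positivity: y^2 \<le> |y|^2 1 is preserved by
  \<open>\<Psi>\<close>, so the square of the image has norm at most 3 |y|^2. The 2 is a bound for
  the root of 3.\<close>

lemma nrm_Psi:
  assumes x: "x \<in> dom.sa"
  shows "cod.nrm (\<Psi> x) \<le> 2 * dom.nrm x"
proof -
  define y where "y = (fst x, 0 :: complex)"
  have y: "y \<in> dom.sa" using x by (simp add: y_def dom.sa_iff)
  have "cod.nrm (\<Psi> y) \<le> 2 * dom.nrm y"
  proof (cases "y = 0")
    case False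
    define r where "r = dom.nrm y"
    have r: "0 < r" using False by (simp add: r_def)
    have "dom.nrm (dom.umul y y) \<le> r^2"
      using dom.nrm_umul[of y y] by (simp add: r_def power2_eq_square)
    then have "r^2 *\<^sub>R (0, 1) - dom.umul y y \<in> dom.pos"
      by (intro dom.order_unit dom.sa_umul y)
    from Psi_pos[OF this]
    have "r^2 *\<^sub>R (0, 1) - cod.umul (\<Psi> y) (\<Psi> y) \<in> cod.pos" by (simp add: Psi_simps)
    then have "cod.nrm (cod.umul (\<Psi> y) (\<Psi> y)) \<le> 3 * r^2"
      using r by (intro cod.nrm_between cod.square_pos Psi_sa y) auto
    moreover have "cod.nrm (cod.umul (\<Psi> y) (\<Psi> y)) = cod.nrm (\<Psi> y) ^ 2"
      using cod.norm_square[of "fst (\<Psi> y)"] Psi_sa[OF y] by (simp add: cod.nrm_def cod.sa_iff y_def)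
    ultimately have "cod.nrm (\<Psi> y) ^ 2 \<le> (2 * r)^2" by (simp add: power_mult_distrib) (smt (verit) zero_le_power2)
    then have "cod.nrm (\<Psi> y) \<le> 2 * r" by (rule power2_le_imp_le) (use r in simp)
    then show ?thesis by (simp add: r_def)
  qed (simp add: Psi_0)
  moreover have "cod.nrm (\<Psi> x) = cod.nrm (\<Psi> y) + cmod (snd x)" "dom.nrm x = dom.nrm y + cmod (snd x)"
    by (simp_all add: y_def cod.nrm_def dom.nrm_def)
  ultimately show ?thesis using norm_ge_zero[of "snd x"] by argo
qed

lemma Psi_LIMSEQ:
  assumes "f \<longlonglongrightarrow> x" "\<And>n. f n \<in> dom.sa"
  shows "(\<lambda>n. \<Psi> (f n)) \<longlonglongrightarrow> \<Psi> x"
proof -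
  have x: "x \<in> dom.sa" using closed_sequentially[OF dom.closed_sa _ assms(1)] assms(2) by blast
  have "(\<lambda>n. 2 * dom.nrm (f n - x)) \<longlonglongrightarrow> 2 * dom.nrm (x - x)"
    by (intro tendsto_intros dom.tendsto_nrm assms)
  then have l: "(\<lambda>n. 2 * dom.nrm (f n - x)) \<longlonglongrightarrow> 0" by simp
  show ?thesis
  proof (rule LIM_zero_cancel, rule Lim_null_comparison[OF _ l], rule always_eventually, rule allI)
    fix n
    have "norm (\<Psi> (f n) - \<Psi> x) \<le> cod.nrm (\<Psi> (f n - x))"
      using cod.norm_le_nrm by (simp add: Psi_diff)
    also have "\<dots> \<le> 2 * dom.nrm (f n - x)"
      by (intro nrm_Psi dom.sa_diff assms x)
    finally show "norm (\<Psi> (f n) - \<Psi> x) \<le> 2 * dom.nrm (f n - x)" .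
  qed
qed

text \<open>Both images are limits of the iterates \<open>cod.sq n\<close> at the common image of
  \<open>v\<close> and \<open>v'\<close>.\<close>

lemma Psi_rt_cong:
  assumes "dom.unit_bounded v" "dom.unit_bounded v'" "\<Psi> v = \<Psi> v'"
  shows "\<Psi> (dom.rt v) = \<Psi> (dom.rt v')"
proof -
  have "(\<lambda>n. \<Psi> (dom.sq n u)) \<longlonglongrightarrow> \<Psi> (dom.rt u)" if u: "dom.unit_bounded u" for u
    by (rule Psi_LIMSEQ[OF dom.unit_bounded_rt(4)[OF u]])
      (use u in \<open>unfold dom.unit_bounded_def, blast intro: dom.sq_in(2)\<close>)
  from this[OF assms(1)] this[OF assms(2)] show ?thesis
    unfolding Psi_sq assms(3) by (rule LIMSEQ_unique)
qed

text \<open>Take y = (|e| + e)/2 and y' = (|e| - e)/2, so that y y' = 0 and y^2 = y e \<le> \<theta>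
  y; this bounds the norm of \<open>y\<close>. In the image, |e| and -e become positive elements
  with equal squares. Their equality, uniqueness of the positive root, puts \<open>y\<close> into
  the kernel.\<close>

lemma positive_part:
  assumes e: "e \<in> dom.sa" "snd e = 0" and neg: "- \<Psi> e \<in> cod.pos"
    and \<theta>: "0 < \<theta>" "\<theta> *\<^sub>R (0, 1) - e \<in> dom.pos"
  shows "\<exists>y\<in>dom.pos. \<Psi> y = 0 \<and> y - e \<in> dom.pos \<and> dom.nrm y \<le> 3 * \<theta>"
proof -
  obtain C where C: "dom.calg C" "e \<in> C" using dom.ex_calg[OF e(1)] .
  define r where "r = dom.nrm e + 1"
  have r: "0 < r" "dom.nrm e \<le> r" by (auto simp: r_def add_nonneg_pos)
  define e1 where "e1 = (1/r) *\<^sub>R e"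
  have e1: "e1 \<in> C" "e1 \<in> dom.sa" using C e by (auto simp: e1_def intro: dom.calg_scaleR dom.sa_scaleR)
  have e1e: "e = r *\<^sub>R e1" using r by (simp add: e1_def)
  have b: "dom.bdd C 1 e1"
    by (rule dom.bdd_mono[OF dom.bdd_nrm]) (use r in \<open>simp add: e1_def dom.nrm_scaleR\<close>)
  define v where "v = (0, 1) - dom.umul e1 e1"
  define m where "m = (0, 1) - dom.rt v"
  note m = dom.abs_value[OF C(1) e1 b, folded v_def, folded m_def]
  have v: "v \<in> dom.sa" "v \<in> C"
    using C e1 by (auto simp: v_def intro!: dom.sa_diff dom.sa_one dom.sa_umul dom.calg_intros)
  have snd_m: "snd m = 0" using arg_cong[OF m(2), of snd] e by (simp add: e1_def)
  define y where "y = (r/2) *\<^sub>R (m + e1)"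
  define y' where "y' = (r/2) *\<^sub>R (m - e1)"
  have y: "y \<in> dom.pos" "y' \<in> dom.pos" "y - e = y'"
  proof -
    show "y \<in> dom.pos" "y' \<in> dom.pos" unfolding y_def y'_def using m r by (auto intro!: dom.pos_scaleR)
    have "e = (r/2) *\<^sub>R e1 + (r/2) *\<^sub>R e1" unfolding e1e by (simp flip: scaleR_add_left)
    then show "y - e = y'" by (simp add: y_def y'_def scaleR_add_right scaleR_diff_right)
  qed
  have yC: "y \<in> C" using C m(1) e1 by (auto simp: y_def intro: dom.calg_intros)
  have "dom.umul y y' = 0"
    using m(2) by (simp add: y_def y'_def dom.ext.distribs dom.ext.commute[of m e1])
  then have ye: "dom.umul y e = dom.umul y y" using y(3) by (metis add_diff_cancel_left' diff_add_cancel dom.ext.diff_right diff_zero eq_iff_diff_eq_0)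
  have small: "dom.nrm y \<le> 3 * \<theta>"
  proof (cases "y = 0")
    case False
    have "dom.umul y (\<theta> *\<^sub>R (0, 1) - e) \<in> dom.pos"
      by (rule dom.pos_umul[OF C(1) yC y(1) dom.calg_diff[OF C(1) dom.calg_scaleR[OF C(1) dom.calg_one[OF C(1)]] C(2)] \<theta>(2)])
    then have "\<theta> *\<^sub>R y - dom.umul y y \<in> dom.pos" by (simp add: dom.ext.distribs ye)
    then have "dom.nrm (dom.umul y y) \<le> 3 * (\<theta> * dom.nrm y)"
      by (rule dom.nrm_mono[rotated])
        (use \<theta> False y in \<open>auto simp: dom.nrm_scaleR intro: dom.square_pos dom.pos_sa\<close>)
    moreover have "dom.nrm (dom.umul y y) = dom.nrm y * dom.nrm y"
      using dom.norm_square[of "fst y"] dom.pos_sa[OF y(1)] snd_m e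
      by (simp add: dom.nrm_def dom.sa_iff y_def e1_def power2_eq_square)
    ultimately have "dom.nrm y * dom.nrm y \<le> dom.nrm y * (3 * \<theta>)" by (simp add: algebra_simps)
    then show ?thesis using False mult_le_cancel_left_pos[of "dom.nrm y"] dom.nrm_pos by blast
  qed (use \<theta> in simp)
  define n where "n = - \<Psi> e1"
  have n: "n \<in> cod.pos"
    using cod.pos_scaleR[OF neg, of "1/r"] r by (simp add: n_def e1_def Psi_scaleR)
  obtain D where D: "cod.calg D" "n \<in> D" using cod.ex_calg[OF cod.pos_sa[OF n]] .
  have nn: "cod.umul n n = \<Psi> (dom.umul e1 e1)" by (simp add: n_def Psi_umul cod.ext.distribs)
  \<comment> \<open>The iterates for the absolute value are polynomials in the square of
    \<open>n\<close>. Hence \<open>\<Psi> m\<close> and \<open>n\<close> share a subalgebra, where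
    products of positive elements are positive.\<close>
  have MD: "\<Psi> m \<in> D"
  proof -
    have l: "(\<lambda>k. \<Psi> (dom.sq k v)) \<longlonglongrightarrow> \<Psi> (dom.rt v)"
      by (rule Psi_LIMSEQ[OF m(5) dom.sq_in(2)[OF C(1) v(2,1)]])
    have "\<Psi> (dom.sq k v) \<in> D" for k
    proof -
      have vD: "\<Psi> v \<in> D" using D by (auto simp: v_def Psi_simps nn[unfolded Psi_umul, symmetric] intro!: cod.calg_intros)
      show ?thesis unfolding Psi_sq
        by (induction k) (use D vD in \<open>auto intro!: cod.calg_intros\<close>)
    qed
    then have "\<Psi> (dom.rt v) \<in> D" using l by (rule closed_sequentially[OF cod.calg_closed[OF D(1)]])
    then show ?thesis using D by (auto simp: m_def Psi_simps intro!: cod.calg_intros)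
  qed
  define t where "t = \<Psi> m - n"
  have t: "t \<in> cod.pos" using Psi_pos[OF m(4)] by (simp add: t_def n_def Psi_add)
  have tD: "t \<in> D" using D MD by (auto simp: t_def intro: cod.calg_intros)
  \<comment> \<open>Both summands are positive and their sum vanishes, so each is 0.\<close>
  have "cod.umul t t + 2 *\<^sub>R cod.umul t n = cod.umul (\<Psi> m) (\<Psi> m) - cod.umul n n"
    by (simp add: t_def cod.ext.distribs cod.ext.commute[of n "\<Psi> m"] scaleR_2)
  also have "\<dots> = 0" using m(2) by (simp add: nn flip: Psi_umul)
  finally have "- cod.umul t t = 2 *\<^sub>R cod.umul t n" by (rule minus_unique)
  moreover have "2 *\<^sub>R cod.umul t n \<in> cod.pos"
    using D tD t n by (intro cod.pos_scaleR cod.pos_umul[OF D(1)]) auto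
  ultimately have "cod.umul t t = 0"
    by (intro cod.pos_antisym cod.square_pos cod.pos_sa[OF t]) metis
  then have "t = 0" by (rule cod.umul_self_eq_0[OF cod.pos_sa[OF t]])
  then have "\<Psi> y = 0" by (simp add: y_def Psi_simps t_def n_def)
  then show ?thesis using y small by blast
qed

text \<open>The order automorphism carrying \<open>\<eta> + c + y\<close> to \<open>\<eta> + c\<close> becomes the identity modulo the
  kernel, which contains \<open>y\<close>, and is close to the identity if \<open>y\<close> is small.\<close>

lemma compress:
  assumes c: "c \<in> dom.pos" and x: "x \<in> dom.pos" "snd x = 0"
    and y: "y \<in> dom.pos" "\<Psi> y = 0" and xy: "c + y - x \<in> dom.pos"
    and \<eta>: "0 < \<eta>" "\<eta> < \<Lambda>" "\<eta> + dom.nrm c + dom.nrm y \<le> \<Lambda>"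
  shows "\<exists>x'\<in>dom.pos. snd x' = 0 \<and> \<Psi> x' = \<Psi> x \<and> \<eta> *\<^sub>R (0, 1) + c - x' \<in> dom.pos \<and>
    (\<exists>v v'. dom.unit_bounded v \<and> dom.unit_bounded v' \<and> dom.nrm (v - v') = dom.nrm y / \<Lambda> \<and>
       dom.nrm (x' - x) \<le> 72 * \<Lambda> * dom.nrm (dom.rt v - dom.rt v'))"
proof -
  have \<Lambda>: "0 < \<Lambda>" using \<eta> by simp
  have 1: "\<eta> + dom.nrm (c + y) \<le> \<Lambda>" using dom.nrm_add[of c y] \<eta>(3) by linarith
  have 2: "\<eta> + dom.nrm c \<le> \<Lambda>" using dom.nrm_ge_0[of y] \<eta>(3) by linarith
  define v where "v = (0, 1) - (1/\<Lambda>) *\<^sub>R (\<eta> *\<^sub>R (0, 1) + (c + y))"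
  define v' where "v' = (0, 1) - (1/\<Lambda>) *\<^sub>R (\<eta> *\<^sub>R (0, 1) + c)"
  define p where "p = dom.psqrt \<Lambda> (\<eta> *\<^sub>R (0, 1) + (c + y))"
  define p' where "p' = dom.psqrt \<Lambda> (\<eta> *\<^sub>R (0, 1) + c)"
  note P = dom.psqrt_automorphism[OF dom.pos_add[OF c y(1)] \<eta>(1,2) 1, folded v_def p_def]
  note P' = dom.psqrt_automorphism[OF c \<eta>(1,2) 2, folded v'_def p'_def]
  have pv: "p = sqrt \<Lambda> *\<^sub>R ((0, 1) - dom.rt v)" "p' = sqrt \<Lambda> *\<^sub>R ((0, 1) - dom.rt v')"
    by (simp_all add: p_def p'_def dom.psqrt_def v_def v'_def)
  obtain q where q: "q \<in> dom.sa" "\<And>x. x \<in> dom.pos \<Longrightarrow> dom.ext.U q x \<in> dom.pos"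
    "\<And>x. dom.ext.U p (dom.ext.U q x) = x" "\<And>x. dom.ext.U q (dom.ext.U p x) = x"
    using P(5) by blast
  have U1: "dom.ext.U s (0, 1) = dom.umul s s" for s
    by (simp add: dom.ext.U_alt scaleR_2)
  define z where "z = dom.ext.U q x"
  have z: "z \<in> dom.pos" using q(2)[OF x(1)] by (simp add: z_def)
  \<comment> \<open>The inverse \<open>U q\<close> carries \<eta> + c + y = p^2 to the unit and
    \<open>x\<close> to \<open>z\<close>, so the bound on \<open>x\<close> becomes z \<le>
    1.\<close>
  have "(0, 1) - z = dom.ext.U q (\<eta> *\<^sub>R (0, 1) + (c + y - x))"
    using q(4)[of "(0, 1)"] P(3) by (simp add: U1 z_def dom.ext.trip_linear(2,5) add_diff_eq)
  also have "\<dots> \<in> dom.pos"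
    using \<eta>(1) by (intro q(2) dom.pos_add dom.pos_scaleR dom.one_pos xy) auto
  finally have z1: "(0, 1) - z \<in> dom.pos" .
  define x' where "x' = dom.ext.U p' z"
  have xp: "x = dom.ext.U p z" by (simp add: z_def q)
  have "x' \<in> dom.pos" using P'(4)[OF z] by (simp add: x'_def)
  moreover have "snd x' = 0" using x(2) by (simp add: x'_def z_def dom.trip_fst)
  moreover have "\<Psi> x' = \<Psi> x"
  proof -
    have "\<Psi> v = \<Psi> v'" by (simp add: v_def v'_def Psi_simps y)
    then have "\<Psi> p = \<Psi> p'" using Psi_rt_cong[OF P(1) P'(1)] by (simp add: pv Psi_simps)
    then show ?thesis by (simp add: xp x'_def Psi_trip)
  qed
  moreover have "\<eta> *\<^sub>R (0, 1) + c - x' \<in> dom.pos"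
    using P'(4)[OF z1] P'(3) by (simp add: dom.ext.trip_linear(5) U1 x'_def)
  moreover have "dom.nrm (v - v') = dom.nrm y / \<Lambda>"
  proof -
    have "v' - v = (1/\<Lambda>) *\<^sub>R y" by (simp add: v_def v'_def scaleR_add_right)
    then show ?thesis using \<Lambda> dom.nrm_scaleR[of "1/\<Lambda>" y] dom.nrm_minus_commute[of v v'] by simp
  qed
  moreover have "dom.nrm (x' - x) \<le> 72 * \<Lambda> * dom.nrm (dom.rt v - dom.rt v')"
  proof -
    have np: "dom.nrm (sqrt \<Lambda> *\<^sub>R ((0, 1) - dom.rt u)) \<le> 4 * sqrt \<Lambda>" if "dom.unit_bounded u" for u
    proof -
      have "dom.nrm ((0, 1) - dom.rt u) \<le> 4"
        using dom.nrm_diff[of "(0, 1)" "dom.rt u"] dom.unit_bounded_rt(2)[OF that] by simp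
      then have "sqrt \<Lambda> * dom.nrm ((0, 1) - dom.rt u) \<le> sqrt \<Lambda> * 4" using \<Lambda> by (intro mult_left_mono) auto
      then show ?thesis using \<Lambda> by (simp add: dom.nrm_scaleR)
    qed
    have nz: "dom.nrm z \<le> 3" by (rule dom.nrm_between_0_1[OF z z1])
    define d where "d = p' - p"
    have nd: "dom.nrm d = sqrt \<Lambda> * dom.nrm (dom.rt v - dom.rt v')"
    proof -
      have "d = sqrt \<Lambda> *\<^sub>R (dom.rt v - dom.rt v')" by (simp add: d_def pv scaleR_diff_right)
      then show ?thesis using \<Lambda> by (simp add: dom.nrm_scaleR)
    qed
    have e: "x' - x = dom.ext.trip p' z d + dom.ext.trip d z p"
      by (simp add: x'_def xp d_def dom.ext.trip_linear)
    have "dom.nrm (x' - x) \<le> 3 * dom.nrm p' * dom.nrm z * dom.nrm d + 3 * dom.nrm d * dom.nrm z * dom.nrm p"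
      unfolding e using dom.nrm_add[of "dom.ext.trip p' z d" "dom.ext.trip d z p"]
        dom.nrm_trip[of p' z d] dom.nrm_trip[of d z p] by linarith
    \<comment> \<open>Each of the two terms contributes 36: the triple product bound 3, the bound 3
      for \<open>z\<close>, and 4 sqrt \<Lambda> for a root. The second sqrt \<Lambda> comes from
      \<open>d\<close>.\<close>
    also have "\<dots> \<le> 3 * (4 * sqrt \<Lambda>) * 3 * dom.nrm d + 3 * dom.nrm d * 3 * (4 * sqrt \<Lambda>)"
      using np[OF P(1)] np[OF P'(1)] nz \<Lambda> unfolding pv[symmetric]
      by (intro add_mono mult_mono) auto
    also have "\<dots> = 72 * (sqrt \<Lambda> * sqrt \<Lambda>) * dom.nrm (dom.rt v - dom.rt v')"
      by (simp add: nd del: real_sqrt_mult_self)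
    finally show ?thesis using \<Lambda> by simp
  qed
  ultimately show ?thesis using P(1) P'(1) by blast
qed

text \<open>Stage n carries a positive lift of \<open>b\<close> lying below \<theta> n + c. Its
  excess over \<open>c\<close> bounds the kernel element \<open>y\<close>, hence the distance to
  stage n + 1, whose tolerance can be chosen independently.\<close>

lemma lift_interval:
  assumes c: "(c, 0) \<in> dom.pos" and b: "(b, 0) \<in> cod.pos" and bd: "(\<Phi> c - b, 0) \<in> cod.pos"
  shows "\<exists>a. (a, 0) \<in> dom.pos \<and> (c - a, 0) \<in> dom.pos \<and> b = \<Phi> a"
proof -
  let ?c = "(c, 0 :: complex)" and ?b = "(b, 0 :: complex)" and ?I = "(0, 1) :: 'a \<times> complex"
  have kernel: "\<exists>y\<in>dom.pos. \<Psi> y = 0 \<and> ?c + y - x \<in> dom.pos \<and> dom.nrm y \<le> 3 * \<theta>"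
    if x: "x \<in> dom.pos" "snd x = 0" "\<Psi> x = ?b" and \<theta>: "0 < \<theta>" "\<theta> *\<^sub>R ?I + ?c - x \<in> dom.pos" for x \<theta>
  proof -
    have "- \<Psi> (x - ?c) = (\<Phi> c - b, 0)" using x(3) by (simp add: Psi_diff prod_eq_iff)
    then have "\<exists>y\<in>dom.pos. \<Psi> y = 0 \<and> y - (x - ?c) \<in> dom.pos \<and> dom.nrm y \<le> 3 * \<theta>"
      using x c bd \<theta> by (intro positive_part dom.sa_diff dom.pos_sa) (auto simp: algebra_simps)
    then show ?thesis by (simp add: algebra_simps)
  qed
  \<comment> \<open>Leaves room for \<eta> \<le> 1 and |y| \<le> 3, so one constant serves all
    stages after the initial one.\<close>
  define \<Lambda> where "\<Lambda> = dom.nrm ?c + 5"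
  have \<Lambda>: "5 \<le> \<Lambda>" by (simp add: \<Lambda>_def)
  have "\<exists>\<delta>>0. \<forall>v v'. dom.unit_bounded v \<longrightarrow> dom.unit_bounded v' \<longrightarrow> dom.nrm (v - v') < \<delta> \<longrightarrow>
      dom.nrm (dom.rt v - dom.rt v') < (1/2) ^ n / (72 * \<Lambda>)" for n :: nat
    using \<Lambda> by (intro dom.rt_uniformly_continuous) simp
  then obtain \<delta> where \<delta>: "\<And>n. 0 < \<delta> n"
    "\<And>n v v'. dom.unit_bounded v \<Longrightarrow> dom.unit_bounded v' \<Longrightarrow> dom.nrm (v - v') < \<delta> n \<Longrightarrow>
      dom.nrm (dom.rt v - dom.rt v') < (1/2) ^ n / (72 * \<Lambda>)"
    by metis
  \<comment> \<open>The power forces the tolerances to 0. Since |y| \<le> 3 \<theta> n and \<Lambda>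
    > 3, the bound by \<open>\<delta> n\<close> makes |y| / \<Lambda> smaller than
    \<open>\<delta> n\<close>; the factor 72 \<Lambda> of \<open>compress\<close> then
    cancels.\<close>
  define \<theta> where "\<theta> n = min ((1/2) ^ n) (\<delta> n)" for n
  have \<theta>: "0 < \<theta> n" "\<theta> n \<le> (1/2) ^ n" "\<theta> n \<le> \<delta> n" for n using \<delta>(1) by (auto simp: \<theta>_def)
  have \<theta>1: "\<theta> n \<le> 1" for n using \<theta>(2)[of n] power_le_one[of "1/2::real" n] by linarith
  define Q where "Q n x \<longleftrightarrow> x \<in> dom.pos \<and> snd x = 0 \<and> \<Psi> x = ?b \<and> \<theta> n *\<^sub>R ?I + ?c - x \<in> dom.pos" for n x
  have "\<exists>x. Q 0 x"
  proof -
    obtain k where k: "?b = cod.umul k k" "k \<in> cod.sa" using b unfolding cod.pos_def by blast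
    have k0: "snd k = 0" using arg_cong[OF k(1), of snd] by simp
    obtain h where h: "\<Phi> h = fst k" using surj by (metis surjD)
    \<comment> \<open>The self-adjoint part of a preimage still maps to the root of
      \<open>b\<close>; its square is a positive lift.\<close>
    define h1 where "h1 = ((1/2) *\<^sub>R (h + starA h), 0 :: complex)"
    have h1: "h1 \<in> dom.sa"
      by (simp add: h1_def dom.sa_iff dom.star_scaleR dom.star_add dom.star_star add.commute)
    have "\<Psi> h1 = k"
      using k(2) k0 by (simp add: h1_def prod_eq_iff Phi_add Phi_scaleR map_star h cod.sa_iff flip: scaleR_2)
    define x where "x = dom.umul h1 h1"
    have x: "x \<in> dom.pos" "snd x = 0" "\<Psi> x = ?b"
      using h1 k(1) \<open>\<Psi> h1 = k\<close> by (auto simp: x_def dom.square_pos Psi_umul) (simp add: h1_def)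
    define t where "t = dom.nrm x + 1"
    have t: "0 < t" by (simp add: t_def add_nonneg_pos)
    have "(t *\<^sub>R ?I - x) + ?c \<in> dom.pos"
      by (intro dom.pos_add c dom.order_unit dom.pos_sa x) (simp add: t_def)
    then obtain y where y: "y \<in> dom.pos" "\<Psi> y = 0" "?c + y - x \<in> dom.pos"
      using kernel[OF x t] by (auto simp: algebra_simps)
    \<comment> \<open>The first correction may be large, so the constant is adapted to
      \<open>y\<close> and the distance estimate is discarded.\<close>
    have "\<exists>x'\<in>dom.pos. snd x' = 0 \<and> \<Psi> x' = \<Psi> x \<and> \<theta> 0 *\<^sub>R ?I + ?c - x' \<in> dom.pos \<and>
      (\<exists>v v'. dom.unit_bounded v \<and> dom.unit_bounded v' \<and> dom.nrm (v - v') = dom.nrm y / (2 + dom.nrm ?c + dom.nrm y) \<and>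
       dom.nrm (x' - x) \<le> 72 * (2 + dom.nrm ?c + dom.nrm y) * dom.nrm (dom.rt v - dom.rt v'))"
      using \<theta>(1)[of 0] \<theta>1[of 0] dom.nrm_ge_0[of ?c] dom.nrm_ge_0[of y]
      by (intro compress[OF c x(1,2) y]) linarith+
    then show ?thesis unfolding Q_def using x(3) by metis
  qed
  moreover have "\<exists>x'. Q (Suc n) x' \<and> dom.nrm (x' - x) \<le> (1/2) ^ n" if x: "Q n x" for n x
  proof -
    have x': "x \<in> dom.pos" "snd x = 0" "\<Psi> x = ?b" "\<theta> n *\<^sub>R ?I + ?c - x \<in> dom.pos"
      using x by (auto simp: Q_def)
    obtain y where y: "y \<in> dom.pos" "\<Psi> y = 0" "?c + y - x \<in> dom.pos" "dom.nrm y \<le> 3 * \<theta> n"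
      using kernel[OF x'(1-3) \<theta>(1) x'(4)] by blast
    have "\<theta> (Suc n) < \<Lambda>" "\<theta> (Suc n) + dom.nrm ?c + dom.nrm y \<le> \<Lambda>"
      using \<theta>1[of "Suc n"] \<theta>1[of n] y(4) \<Lambda> unfolding \<Lambda>_def by linarith+
    from compress[OF c x'(1,2) y(1-3) \<theta>(1)[of "Suc n"] this]
    obtain x'' v v' where x'': "Q (Suc n) x''" and v: "dom.unit_bounded v" "dom.unit_bounded v'"
      "dom.nrm (v - v') = dom.nrm y / \<Lambda>" "dom.nrm (x'' - x) \<le> 72 * \<Lambda> * dom.nrm (dom.rt v - dom.rt v')"
      unfolding Q_def using x'(3) by metis
    have "dom.nrm y < \<delta> n * \<Lambda>"
    proof -
      have "dom.nrm y \<le> 3 * \<delta> n" using y(4) \<theta>(3)[of n] by linarith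
      also have "\<dots> < \<Lambda> * \<delta> n" using \<Lambda> \<delta>(1)[of n] by (intro mult_strict_right_mono) auto
      finally show ?thesis by (simp add: mult.commute)
    qed
    then have "dom.nrm (v - v') < \<delta> n" using v(3) \<Lambda> by (simp add: pos_divide_less_eq)
    from \<delta>(2)[OF v(1,2) this] have "72 * \<Lambda> * dom.nrm (dom.rt v - dom.rt v') \<le> (1/2) ^ n"
      using \<Lambda> by (simp add: pos_less_divide_eq algebra_simps)
    with v(4) x'' show ?thesis by (meson order_trans)
  qed
  ultimately have "\<exists>f. \<forall>n. Q n (f n) \<and> dom.nrm (f (Suc n) - f n) \<le> (1/2) ^ n"
    by (rule dependent_nat_choice)
  then obtain f where f: "\<And>n. Q n (f n)" "\<And>n. dom.nrm (f (Suc n) - f n) \<le> (1/2) ^ n" by blast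
  have "norm (f (Suc n) - f n) \<le> (1/2) ^ n" for n
    using dom.norm_le_nrm f(2) by (rule order_trans)
  then have "summable (\<lambda>n. f (Suc n) - f n)"
    by (intro summable_comparison_test'[OF summable_geometric[of "1/2::real"]]) auto
  then have "(\<lambda>n. (\<Sum>k<n. f (Suc k) - f k) + f 0) \<longlonglongrightarrow> (\<Sum>n. f (Suc n) - f n) + f 0"
    by (intro tendsto_add tendsto_const summable_LIMSEQ)
  then obtain X where X: "f \<longlonglongrightarrow> X" by (auto simp: sum_lessThan_telescope)
  have "X \<in> dom.pos" using closed_sequentially[OF dom.closed_pos _ X] f(1) by (auto simp: Q_def)
  moreover have "snd X = 0"
  proof -
    have "(\<lambda>n. snd (f n)) \<longlonglongrightarrow> snd X" by (intro tendsto_intros X)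
    moreover have "(\<lambda>n. snd (f n)) = (\<lambda>n. 0)" using f(1) by (auto simp: Q_def)
    ultimately show ?thesis using LIMSEQ_unique[OF tendsto_const] by metis
  qed
  moreover have "\<Psi> X = ?b"
  proof -
    have "(\<lambda>n. \<Psi> (f n)) \<longlonglongrightarrow> \<Psi> X"
      by (rule Psi_LIMSEQ[OF X]) (use f(1) dom.pos_sa in \<open>auto simp: Q_def\<close>)
    moreover have "(\<lambda>n. \<Psi> (f n)) = (\<lambda>n. ?b)" using f(1) by (auto simp: Q_def)
    ultimately show ?thesis using LIMSEQ_unique[OF tendsto_const] by metis
  qed
  moreover have "?c - X \<in> dom.pos"
  proof -
    have "\<theta> \<longlonglongrightarrow> 0"
      by (rule tendsto_sandwich[of "\<lambda>_. 0" \<theta> sequentially "\<lambda>n. (1/2)^n"])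
        (use \<theta> in \<open>auto intro!: always_eventually LIMSEQ_realpow_zero less_imp_le\<close>)
    then have "(\<lambda>n. \<theta> n *\<^sub>R ?I + ?c - f n) \<longlonglongrightarrow> 0 *\<^sub>R ?I + ?c - X"
      by (intro tendsto_intros X)
    then have "0 *\<^sub>R ?I + ?c - X \<in> dom.pos"
      by (rule closed_sequentially[OF dom.closed_pos, rotated]) (use f(1) in \<open>simp add: Q_def\<close>)
    then show ?thesis by simp
  qed
  moreover have "(fst X, 0) \<in> dom.pos"
    using \<open>X \<in> dom.pos\<close> \<open>snd X = 0\<close> prod.collapse[of X] by simp
  ultimately show ?thesis
    by (intro exI[of _ "fst X"]) (auto simp: \<Psi>_def prod_eq_iff minus_prod_def)
qed

end

theorem theorem4p1:
  fixes csA :: "complex \<Rightarrow> 'a::banach \<Rightarrow> 'a" and jpA :: "'a \<Rightarrow> 'a \<Rightarrow> 'a" and starA :: "'a \<Rightarrow> 'a"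
    and csB :: "complex \<Rightarrow> 'b::banach \<Rightarrow> 'b" and jpB :: "'b \<Rightarrow> 'b \<Rightarrow> 'b" and starB :: "'b \<Rightarrow> 'b"
    and \<Phi> :: "'a \<Rightarrow> 'b" and b d :: 'b and c :: 'a
  assumes "jordan_star_epimorphism csA jpA starA csB jpB starB \<Phi>"
    and "jb_le jpB starB 0 b" and "jb_le jpB starB b d"
    and "jb_le jpA starA 0 c" and "\<Phi> c = d"
  shows "\<exists>a. jb_le jpA starA 0 a \<and> jb_le jpA starA a c \<and> b = \<Phi> a"
proof -
  interpret jordan_star_epimorphism csA jpA starA csB jpB starB \<Phi> by fact
  obtain a where "(a, 0) \<in> dom.pos" "(c - a, 0) \<in> dom.pos" "b = \<Phi> a"
    using lift_interval[of c b] assms by (auto simp: dom.jb_le_iff cod.jb_le_iff)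
  moreover from this have "starA a = a" using dom.pos_sa[of "(a, 0)"] by (simp add: dom.sa_iff)
  ultimately show ?thesis by (intro exI[of _ a]) (simp add: dom.jb_le_iff)
qed

end
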